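(* Let $\alpha$ be the approximation factor of a given approximation algorithm for DS-fair $k$-center. There exists an algorithm that, in polynomial time, computes an $(\alpha+1)$-approximation with GF-violation at most $2$ for the doubly constrained fair $k$-center problem; that is, it outputs a clustering $(\mathcal{C},\varphi)$ satisfying the diverse center selection constraint, whose clusters are group fair with additive violation at most $2$, and whose $k$-center cost is at most $(\alpha+1)$ times the optimal $k$-center cost of a clustering satisfying both group fairness (with no violation) and diverse center selection.
   Context: Let $(P,d)$ be a finite metric space with $|P|=n$ and let $k\in\{1,\dots,n\}$. The point set is partitioned into color classes $P=P_1\,\dot\cup\,\dots\,\dot\cup\,P_m$; write $H=\{1,\dots,m\}$. A (discrete) $k$-clustering is a pair $(\mathcal{C},\varphi)$ with $\mathcal{C}\subseteq P$, $|\mathcal{C}|\le k$, and an assignment $\varphi:P\to\mathcal{C}$; the cluster of $c\in\mathcal{C}$ is $\varphi^{-1}(c)$. The $k$-center cost is $\max_{p\in P} d(p,\varphi(p))$. Group fairness (GF): for each $h\in H$ numbers $0\le \ell_h\le u_h\le 1$ are given; a cluster $C$ is group fair with additive violation $\rho\in\mathbb{N}$ if $\ell_h|C|-\rho\le |C\cap P_h|\le u_h|C|+\rho$ for all $h\in H$, and group fair if $\rho=0$; a clustering satisfies GF (with violation $\rho$) if every cluster does. Diverse center selection (DS): integers $L_h\le U_h$ ($h\in H$) with $\sum_h L_h\le k\le \sum_h U_h$ are given, and a center set $\mathcal{C}$ satisfies DS if $L_h\le|\mathcal{C}\cap P_h|\le U_h$ for all $h$. The doubly constrained fair $k$-center problem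 asks for a clustering satisfying GF and DS minimizing the $k$-center cost; instances are assumed to admit a feasible solution. An $\alpha$-approximation algorithm for DS-fair $k$-center is a polynomial-time algorithm returning a clustering satisfying DS whose $k$-center cost is at most $\alpha$ times the optimum over clusterings satisfying DS. *)

theory Defs
  imports "HOL-Analysis.Analysis" "HOL-Library.Log_Nat" "HOL-Computational_Algebra.Polynomial"
begin

section \<open>Clusterings, costs and fairness constraints\<close>

text \<open>
  \<open>P\<close> is the point set, \<open>d\<close> the metric, \<open>H\<close> the set of colors and \<open>cls h\<close> the class of color \<open>h\<close>.
  An assignment is a total function of which only the values on \<open>P\<close> matter; a center may have
  an empty cluster.
\<close>

definition k_clustering :: "'a set \<Rightarrow> nat \<Rightarrow> 'a set \<Rightarrow> ('a \<Rightarrow> 'a) \<Rightarrow> bool" where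
  "k_clustering P k C \<phi> \<longleftrightarrow> C \<subseteq> P \<and> card C \<le> k \<and> (\<forall>p\<in>P. \<phi> p \<in> C)"

definition cluster :: "'a set \<Rightarrow> ('a \<Rightarrow> 'a) \<Rightarrow> 'a \<Rightarrow> 'a set" where
  "cluster P \<phi> c = {p \<in> P. \<phi> p = c}"

definition kcenter_cost :: "'a set \<Rightarrow> ('a \<Rightarrow> 'a \<Rightarrow> real) \<Rightarrow> ('a \<Rightarrow> 'a) \<Rightarrow> real" where
  "kcenter_cost P d \<phi> = Max ((\<lambda>p. d p (\<phi> p)) ` P)"

definition group_fair ::
    "nat set \<Rightarrow> (nat \<Rightarrow> 'a set) \<Rightarrow> (nat \<Rightarrow> real) \<Rightarrow> (nat \<Rightarrow> real) \<Rightarrow> nat \<Rightarrow> 'a set \<Rightarrow> bool" where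
  "group_fair H cls l u \<rho> K \<longleftrightarrow>
     (\<forall>h\<in>H. l h * real (card K) - real \<rho> \<le> real (card (K \<inter> cls h)) \<and>
            real (card (K \<inter> cls h)) \<le> u h * real (card K) + real \<rho>)"

definition satisfies_GF ::
    "'a set \<Rightarrow> nat set \<Rightarrow> (nat \<Rightarrow> 'a set) \<Rightarrow> (nat \<Rightarrow> real) \<Rightarrow> (nat \<Rightarrow> real) \<Rightarrow> nat \<Rightarrow>
     'a set \<Rightarrow> ('a \<Rightarrow> 'a) \<Rightarrow> bool" where
  "satisfies_GF P H cls l u \<rho> C \<phi> \<longleftrightarrow> (\<forall>c\<in>C. group_fair H cls l u \<rho> (cluster P \<phi> c))"

definition satisfies_DS ::
    "nat set \<Rightarrow> (nat \<Rightarrow> 'a set) \<Rightarrow> (nat \<Rightarrow> int) \<Rightarrow> (nat \<Rightarrow> int) \<Rightarrow> 'a set \<Rightarrow> bool" where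
  "satisfies_DS H cls L U C \<longleftrightarrow>
     (\<forall>h\<in>H. L h \<le> int (card (C \<inter> cls h)) \<and> int (card (C \<inter> cls h)) \<le> U h)"

definition opt_cost ::
    "'a set \<Rightarrow> ('a \<Rightarrow> 'a \<Rightarrow> real) \<Rightarrow> ('a set \<Rightarrow> ('a \<Rightarrow> 'a) \<Rightarrow> bool) \<Rightarrow> real" where
  "opt_cost P d feas = Min {kcenter_cost P d \<phi> | C \<phi>. feas C \<phi>}"


section \<open>A model of computation\<close>

text \<open>
  A WHILE language over binary trees with integer leaves. Every executed assignment or test is
  charged the size of the value it computes, integers being measured by their bit length.
  Hence after \<open>t\<close> time units on an input of size \<open>n\<close> each variable holds a value of size at most
  \<open>n + t\<close>, so that a multitape Turing machine simulates every step in time polynomial in \<open>n + t\<close>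
  (the expressions of a program have constant depth). Conversely, two variables used as stacks
  represent a tape, each move costing time linear in the length of the tape. Running time in this model is therefore
  polynomially related to Turing machine time.
\<close>

datatype val = Num int | Pair val val

primrec vsize :: "val \<Rightarrow> nat" where
  "vsize (Num i) = Suc (floorlog 2 (nat \<bar>i\<bar>))"
| "vsize (Pair v w) = Suc (vsize v + vsize w)"

primrec int_of_val :: "val \<Rightarrow> int" where
  "int_of_val (Num i) = i"
| "int_of_val (Pair v w) = 0"

primrec fst_val :: "val \<Rightarrow> val" where
  "fst_val (Num i) = Num 0"
| "fst_val (Pair v w) = v"

primrec snd_val :: "val \<Rightarrow> val" where
  "snd_val (Num i) = Num 0"
| "snd_val (Pair v w) = w"

primrec is_pair :: "val \<Rightarrow> bool" where
  "is_pair (Num i) \<longleftrightarrow> False"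
| "is_pair (Pair v w) \<longleftrightarrow> True"

datatype expr =
    Var nat
  | Const int
  | MkPair expr expr
  | Fst expr
  | Snd expr
  | IsPair expr
  | Add expr expr
  | Sub expr expr
  | Mul expr expr
  | Div expr expr
  | Less expr expr

type_synonym state = "nat \<Rightarrow> val"

primrec eval_expr :: "expr \<Rightarrow> state \<Rightarrow> val" where
  "eval_expr (Var x) s = s x"
| "eval_expr (Const i) s = Num i"
| "eval_expr (MkPair e f) s = Pair (eval_expr e s) (eval_expr f s)"
| "eval_expr (Fst e) s = fst_val (eval_expr e s)"
| "eval_expr (Snd e) s = snd_val (eval_expr e s)"
| "eval_expr (IsPair e) s = Num (of_bool (is_pair (eval_expr e s)))"
| "eval_expr (Add e f) s = Num (int_of_val (eval_expr e s) + int_of_val (eval_expr f s))"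
| "eval_expr (Sub e f) s = Num (int_of_val (eval_expr e s) - int_of_val (eval_expr f s))"
| "eval_expr (Mul e f) s = Num (int_of_val (eval_expr e s) * int_of_val (eval_expr f s))"
| "eval_expr (Div e f) s = Num (int_of_val (eval_expr e s) div int_of_val (eval_expr f s))"
| "eval_expr (Less e f) s = Num (of_bool (int_of_val (eval_expr e s) < int_of_val (eval_expr f s)))"

datatype prog =
    Skip
  | Assign nat expr
  | Seq prog prog
  | Cond expr prog prog
  | While expr prog

text \<open>\<open>exec c s t s'\<close>: started in \<open>s\<close>, program \<open>c\<close> halts in \<open>s'\<close> after time \<open>t\<close>.\<close>

inductive exec :: "prog \<Rightarrow> state \<Rightarrow> nat \<Rightarrow> state \<Rightarrow> bool" where
  Skip: "exec Skip s 1 s"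
| Assign: "exec (Assign x e) s (vsize (eval_expr e s)) (s(x := eval_expr e s))"
| Seq: "exec c s t s' \<Longrightarrow> exec c' s' t' s'' \<Longrightarrow> exec (Seq c c') s (t + t') s''"
| CondTrue: "eval_expr e s \<noteq> Num 0 \<Longrightarrow> exec c s t s' \<Longrightarrow>
    exec (Cond e c c') s (vsize (eval_expr e s) + t) s'"
| CondFalse: "eval_expr e s = Num 0 \<Longrightarrow> exec c' s t s' \<Longrightarrow>
    exec (Cond e c c') s (vsize (eval_expr e s) + t) s'"
| WhileFalse: "eval_expr e s = Num 0 \<Longrightarrow> exec (While e c) s (vsize (eval_expr e s)) s"
| WhileTrue: "eval_expr e s \<noteq> Num 0 \<Longrightarrow> exec c s t s' \<Longrightarrow> exec (While e c) s' t' s'' \<Longrightarrow>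
    exec (While e c) s (vsize (eval_expr e s) + t + t') s''"

inductive_cases exec_SkipE: "exec Skip s t s'"
inductive_cases exec_AssignE: "exec (Assign x e) s t s'"
inductive_cases exec_SeqE: "exec (Seq c c') s t s'"
inductive_cases exec_CondE: "exec (Cond e c c') s t s'"
inductive_cases exec_WhileE: "exec (While e c) s t s'"

lemma exec_deterministic:
  "exec c s t s' \<Longrightarrow> exec c s r s'' \<Longrightarrow> r = t \<and> s'' = s'"
proof (induction arbitrary: r s'' rule: exec.induct)
  case (Skip s)
  then show ?case by (rule exec_SkipE) simp
next
  case (Assign x e s)
  then show ?case by (rule exec_AssignE) simp
next
  case (Seq c s t s1 c' t' s2)
  from Seq.prems show ?case
    by (rule exec_SeqE) (auto dest!: Seq.IH)
next
  case (CondTrue e s c t s1 c')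
  from CondTrue.prems show ?case
    by (rule exec_CondE) (use CondTrue.hyps(1) in \<open>auto dest!: CondTrue.IH\<close>)
next
  case (CondFalse e s c' t s1 c)
  from CondFalse.prems show ?case
    by (rule exec_CondE) (use CondFalse.hyps(1) in \<open>auto dest!: CondFalse.IH\<close>)
next
  case (WhileFalse e s c)
  from WhileFalse.prems show ?case
    by (rule exec_WhileE) (use WhileFalse.hyps in auto)
next
  case (WhileTrue e s c t s1 t' s2)
  from WhileTrue.prems show ?case
    by (rule exec_WhileE) (use WhileTrue.hyps(1) in \<open>auto dest!: WhileTrue.IH\<close>)
qed

text \<open>The input is passed in variable 0, which also holds the output.\<close>

definition init_state :: "val \<Rightarrow> state" where
  "init_state v = (\<lambda>_. Num 0)(0 := v)"

definition solves_in_poly_time ::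
    "prog \<Rightarrow> ('i \<Rightarrow> bool) \<Rightarrow> ('i \<Rightarrow> val) \<Rightarrow> ('i \<Rightarrow> val \<Rightarrow> bool) \<Rightarrow> bool" where
  "solves_in_poly_time c valid enc correct \<longleftrightarrow>
     (\<exists>q :: nat poly. \<forall>I. valid I \<longrightarrow>
        (\<exists>t s. exec c (init_state (enc I)) t s \<and> t \<le> poly q (vsize (enc I)) \<and> correct I (s 0)))"


section \<open>Problem instances and their encodings\<close>

text \<open>
  The points are \<open>0, \<dots>, npoints - 1\<close> and the colors \<open>0, \<dots>, ncolors - 1\<close>. The functions
  are only relevant on these ranges.
\<close>

record ds_instance =
  npoints :: nat
  pdist :: "nat \<Rightarrow> nat \<Rightarrow> rat"
  kbound :: nat
  ncolors :: nat
  color :: "nat \<Rightarrow> nat"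
  ds_lower :: "nat \<Rightarrow> int"
  ds_upper :: "nat \<Rightarrow> int"

record gfds_instance = ds_instance +
  gf_lower :: "nat \<Rightarrow> rat"
  gf_upper :: "nat \<Rightarrow> rat"

definition points :: "'b ds_instance_scheme \<Rightarrow> nat set" where
  "points I = {..<npoints I}"

definition metric :: "'b ds_instance_scheme \<Rightarrow> nat \<Rightarrow> nat \<Rightarrow> real" where
  "metric I p q = real_of_rat (pdist I p q)"

definition colors :: "'b ds_instance_scheme \<Rightarrow> nat set" where
  "colors I = {..<ncolors I}"

definition color_class :: "'b ds_instance_scheme \<Rightarrow> nat \<Rightarrow> nat set" where
  "color_class I h = {p \<in> points I. color I p = h}"

definition ds_feasible :: "'b ds_instance_scheme \<Rightarrow> nat set \<Rightarrow> (nat \<Rightarrow> nat) \<Rightarrow> bool" where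
  "ds_feasible I C \<phi> \<longleftrightarrow>
     k_clustering (points I) (kbound I) C \<phi> \<and>
     satisfies_DS (colors I) (color_class I) (ds_lower I) (ds_upper I) C"

definition gfds_feasible ::
    "nat \<Rightarrow> 'b gfds_instance_scheme \<Rightarrow> nat set \<Rightarrow> (nat \<Rightarrow> nat) \<Rightarrow> bool" where
  "gfds_feasible \<rho> I C \<phi> \<longleftrightarrow>
     ds_feasible I C \<phi> \<and>
     satisfies_GF (points I) (colors I) (color_class I)
       (\<lambda>h. real_of_rat (gf_lower I h)) (\<lambda>h. real_of_rat (gf_upper I h)) \<rho> C \<phi>"

text \<open>
  The library's \<^locale>\<open>Metric_space\<close> also demands nonnegativity and symmetry outside the carrier.
  This excludes no finite metric: any metric on the points extends by zero, and the values outside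
  the points are not part of the encodings below. Color classes may be empty.
\<close>

definition ds_wellformed :: "'b ds_instance_scheme \<Rightarrow> bool" where
  "ds_wellformed I \<longleftrightarrow>
     Metric_space (points I) (metric I) \<and>
     1 \<le> kbound I \<and> kbound I \<le> npoints I \<and>
     (\<forall>p\<in>points I. color I p \<in> colors I) \<and>
     (\<forall>h\<in>colors I. ds_lower I h \<le> ds_upper I h) \<and>
     (\<Sum>h\<in>colors I. ds_lower I h) \<le> int (kbound I) \<and>
     int (kbound I) \<le> (\<Sum>h\<in>colors I. ds_upper I h)"

definition gf_wellformed :: "'b gfds_instance_scheme \<Rightarrow> bool" where
  "gf_wellformed I \<longleftrightarrow>
     (\<forall>h\<in>colors I. 0 \<le> gf_lower I h \<and> gf_lower I h \<le> gf_upper I h \<and> gf_upper I h \<le> 1)"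

definition ds_valid :: "ds_instance \<Rightarrow> bool" where
  "ds_valid I \<longleftrightarrow> ds_wellformed I \<and> (\<exists>C \<phi>. ds_feasible I C \<phi>)"

definition gfds_valid :: "gfds_instance \<Rightarrow> bool" where
  "gfds_valid I \<longleftrightarrow> ds_wellformed I \<and> gf_wellformed I \<and> (\<exists>C \<phi>. gfds_feasible 0 I C \<phi>)"

definition val_of_list :: "val list \<Rightarrow> val" where
  "val_of_list vs = foldr Pair vs (Num 0)"

definition val_of_nat :: "nat \<Rightarrow> val" where
  "val_of_nat n = Num (int n)"

definition val_of_rat :: "rat \<Rightarrow> val" where
  "val_of_rat r = (case quotient_of r of (a, b) \<Rightarrow> Pair (Num a) (Num b))"

definition enc_ds :: "'b ds_instance_scheme \<Rightarrow> val" where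
  "enc_ds I = val_of_list
     [val_of_nat (npoints I),
      val_of_list (map (\<lambda>p. val_of_list (map (\<lambda>q. val_of_rat (pdist I p q)) [0..<npoints I]))
        [0..<npoints I]),
      val_of_nat (kbound I),
      val_of_nat (ncolors I),
      val_of_list (map (\<lambda>p. val_of_nat (color I p)) [0..<npoints I]),
      val_of_list (map (\<lambda>h. Num (ds_lower I h)) [0..<ncolors I]),
      val_of_list (map (\<lambda>h. Num (ds_upper I h)) [0..<ncolors I])]"

definition enc_gfds :: "'b gfds_instance_scheme \<Rightarrow> val" where
  "enc_gfds I = val_of_list
     [enc_ds I,
      val_of_list (map (\<lambda>h. val_of_rat (gf_lower I h)) [0..<ncolors I]),
      val_of_list (map (\<lambda>h. val_of_rat (gf_upper I h)) [0..<ncolors I])]"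

text \<open>A clustering is output as a list of its centers together with the list of assigned centers.\<close>

definition encodes_clustering ::
    "'b ds_instance_scheme \<Rightarrow> val \<Rightarrow> nat set \<Rightarrow> (nat \<Rightarrow> nat) \<Rightarrow> bool" where
  "encodes_clustering I v C \<phi> \<longleftrightarrow>
     (\<exists>cs. distinct cs \<and> set cs = C \<and>
        v = Pair (val_of_list (map val_of_nat cs))
                 (val_of_list (map (\<lambda>p. val_of_nat (\<phi> p)) [0..<npoints I])))"


section \<open>Approximation algorithms\<close>

definition ds_approx_algorithm :: "real \<Rightarrow> prog \<Rightarrow> bool" where
  "ds_approx_algorithm \<alpha> A \<longleftrightarrow>
     solves_in_poly_time A ds_valid enc_ds
       (\<lambda>I v. \<exists>C \<phi>. encodes_clustering I v C \<phi> \<and> ds_feasible I C \<phi> \<and>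
          kcenter_cost (points I) (metric I) \<phi>
            \<le> \<alpha> * opt_cost (points I) (metric I) (ds_feasible I))"

text \<open>The violation \<open>\<rho>\<close> is granted to the output only; the optimum is over exactly fair clusterings.\<close>

definition gfds_approx_algorithm :: "real \<Rightarrow> nat \<Rightarrow> prog \<Rightarrow> bool" where
  "gfds_approx_algorithm \<beta> \<rho> B \<longleftrightarrow>
     solves_in_poly_time B gfds_valid enc_gfds
       (\<lambda>I v. \<exists>C \<phi>. encodes_clustering I v C \<phi> \<and> gfds_feasible \<rho> I C \<phi> \<and>
          kcenter_cost (points I) (metric I) \<phi>
            \<le> \<beta> * opt_cost (points I) (metric I) (gfds_feasible 0 I))"

end

theory Submission
  imports Defs
begin

text \<open>
  Let \<open>(C, \<psi>)\<close> be the output of the DS algorithm and \<open>(C*, \<phi>*)\<close> an optimal solution. Merging the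
  clusters of the optimum along \<open>\<psi>\<close>, i.e. assigning \<open>p\<close> to \<open>\<psi> (\<phi>* p)\<close>, keeps them exactly fair, and
  by the triangle inequality its cost is at most \<open>(\<alpha> + 1) OPT\<close>. So for some pair \<open>(p, c)\<close> there is an
  exactly fair assignment to \<open>C\<close> of radius \<open>d p c \<le> (\<alpha> + 1) OPT\<close>, and it remains to find, for a given
  radius for which an exactly fair assignment exists, an assignment of that radius with violation 2.

  Instead of solving the assignment LP exactly, it suffices to violate it by \<open>O(1/n)\<close>: a bound
  \<open>u > 1 - 1/n\<close> is void up to violation 1, a bound \<open>l > 1 - 1/n\<close> forces all points to have the same
  color, and in all other cases \<open>1/n\<close> of slack is left by the rounding. An approximate solution is the
  average of polynomially many integral assignments, each of which minimizes the sum of the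
  constraints weighted by their current violations; since a feasible assignment makes this sum
  nonpositive, the sum of the squared violations grows only linearly in the number of steps.

  The number of assignments is a power of two, and the multiset of their edges is repeatedly halved,
  keeping half of the edges of each point and, up to 1/2, half of the edges of each center and of
  each color at each center. A halving is a balanced orientation of the bipartite multigraph of
  edges, obtained by linking edges to trails. In the end each count differs from its average by less
  than 1, so that the violation is at most 2.
\<close>

section \<open>Programs\<close>

text \<open>Rounding moves the number of points of a color in a cluster by less than 1 and the size
  of the cluster by less than 1; the latter moves the bound by less than its factor u or l. So u m +
  2 is missed by a margin of 1 - u, and l m - 2 by 1 - l. This margin pays for the inexact solution
  and shrinks to 0 as the bound approaches 1, hence the special case. Fractions never appear: a
  fractional assignment is a list of edges with repetitions. Whether a radius admits an exactly fair
  assignment is never decided. The rounded assignment is computed for every candidate radius and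
  kept only if a direct check finds it fair up to 2; the least surviving radius wins. Polynomial
  time is derived by composing functions on HOL types. The obstacle is iteration: a value may double
  in every step, so every fold carries a bound on its intermediate values. Numbers of rounds are
  lengths of lists, as a number in binary may be exponential in its size.\<close>

primrec expr_below :: "nat \<Rightarrow> expr \<Rightarrow> bool" where
  "expr_below m (Var x) \<longleftrightarrow> x < m"
| "expr_below m (Const i) \<longleftrightarrow> True"
| "expr_below m (MkPair e f) \<longleftrightarrow> expr_below m e \<and> expr_below m f"
| "expr_below m (Fst e) \<longleftrightarrow> expr_below m e"
| "expr_below m (Snd e) \<longleftrightarrow> expr_below m e"
| "expr_below m (IsPair e) \<longleftrightarrow> expr_below m e"
| "expr_below m (Add e f) \<longleftrightarrow> expr_below m e \<and> expr_below m f"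
| "expr_below m (Sub e f) \<longleftrightarrow> expr_below m e \<and> expr_below m f"
| "expr_below m (Mul e f) \<longleftrightarrow> expr_below m e \<and> expr_below m f"
| "expr_below m (Div e f) \<longleftrightarrow> expr_below m e \<and> expr_below m f"
| "expr_below m (Less e f) \<longleftrightarrow> expr_below m e \<and> expr_below m f"

primrec prog_below :: "nat \<Rightarrow> prog \<Rightarrow> bool" where
  "prog_below m Skip \<longleftrightarrow> True"
| "prog_below m (Assign x e) \<longleftrightarrow> x < m \<and> expr_below m e"
| "prog_below m (Seq c d) \<longleftrightarrow> prog_below m c \<and> prog_below m d"
| "prog_below m (Cond e c d) \<longleftrightarrow> expr_below m e \<and> prog_below m c \<and> prog_below m d"
| "prog_below m (While e c) \<longleftrightarrow> expr_below m e \<and> prog_below m c"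

lemma expr_below_mono: "expr_below m e \<Longrightarrow> m \<le> n \<Longrightarrow> expr_below n e"
  by (induction e) auto

lemma prog_below_mono: "prog_below m c \<Longrightarrow> m \<le> n \<Longrightarrow> prog_below n c"
  by (induction c) (auto intro: expr_below_mono)

lemma ex_expr_below: "\<exists>m. expr_below m e"
proof (induction e)
  case (Var x) then show ?case by (auto intro: exI[of _ "Suc x"])
qed (simp; meson expr_below_mono nle_le)+

lemma ex_prog_below: "\<exists>m. prog_below m c"
proof (induction c)
  case (Assign x e)
  obtain m where "expr_below m e" using ex_expr_below by blast
  then have "prog_below (max m (Suc x)) (Assign x e)" by (auto intro: expr_below_mono)
  then show ?case by blast
next
  case (Seq c1 c2)
  then show ?case by (simp) (meson prog_below_mono nle_le)
next
  case (Cond e c1 c2)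
  then obtain a b d where "expr_below a e" "prog_below b c1" "prog_below d c2"
    using ex_expr_below by blast
  then have "prog_below (max a (max b d)) (Cond e c1 c2)"
    by (auto intro: expr_below_mono prog_below_mono)
  then show ?case by blast
next
  case (While e c)
  then obtain a b where "expr_below a e" "prog_below b c"
    using ex_expr_below by blast
  then have "prog_below (max a b) (While e c)"
    by (auto intro: expr_below_mono prog_below_mono)
  then show ?case by blast
qed auto

lemma eval_expr_cong: "expr_below m e \<Longrightarrow> \<forall>x<m. r x = s x \<Longrightarrow> eval_expr e r = eval_expr e s"
  by (induction e) auto

text \<open>Variables from \<open>m\<close> on are neither read nor written, so a run carries over
  to every state that agrees below \<open>m\<close> and leaves the rest as storage. Thus the given
  program, specified only from initial states, can be called inside another one.\<close>

lemma exec_frame: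
  "exec c s t s' \<Longrightarrow> prog_below m c \<Longrightarrow> \<forall>x<m. r x = s x \<Longrightarrow>
    exec c r t (\<lambda>x. if x < m then s' x else r x)"
proof (induction arbitrary: r rule: exec.induct)
  case (Skip s)
  then have "(\<lambda>x. if x < m then s x else r x) = r" by auto
  then show ?case using exec.Skip[of r] by simp
next
  case (Assign x e s)
  have "eval_expr e r = eval_expr e s"
    using Assign by (intro eval_expr_cong) auto
  moreover have "(\<lambda>y. if y < m then (s(x := eval_expr e s)) y else r y) = r(x := eval_expr e s)"
    using Assign by (auto simp: fun_eq_iff)
  ultimately show ?case using exec.Assign[of x e r] by simp
next
  case (Seq c s t s' c' t' s'')
  have 1: "exec c r t (\<lambda>x. if x < m then s' x else r x)" using Seq by auto
  have "exec c' (\<lambda>x. if x < m then s' x else r x) t'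
     (\<lambda>x. if x < m then s'' x else if x < m then s' x else r x)" using Seq by auto
  then have "exec c' (\<lambda>x. if x < m then s' x else r x) t' (\<lambda>x. if x < m then s'' x else r x)"
    by (simp cong: if_cong)
  then show ?case using 1 by (rule exec.Seq[rotated])
next
  case (CondTrue e s c t s' c')
  have "eval_expr e r = eval_expr e s"
    using CondTrue by (intro eval_expr_cong) auto
  then show ?case using CondTrue exec.CondTrue[of e r c t _ c'] by auto
next
  case (CondFalse e s c' t s' c)
  have "eval_expr e r = eval_expr e s"
    using CondFalse by (intro eval_expr_cong) auto
  then show ?case using CondFalse exec.CondFalse[of e r c' t _ c] by auto
next
  case (WhileFalse e s c)
  have "eval_expr e r = eval_expr e s"
    using WhileFalse by (intro eval_expr_cong) auto
  moreover have "(\<lambda>x. if x < m then s x else r x) = r" using WhileFalse by auto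
  ultimately show ?case using WhileFalse exec.WhileFalse[of e r c] by auto
next
  case (WhileTrue e s c t s' t' s'')
  have e: "eval_expr e r = eval_expr e s"
    using WhileTrue by (intro eval_expr_cong) auto
  have 1: "exec c r t (\<lambda>x. if x < m then s' x else r x)" using WhileTrue by auto
  have "exec (While e c) (\<lambda>x. if x < m then s' x else r x) t'
     (\<lambda>x. if x < m then s'' x else if x < m then s' x else r x)" using WhileTrue by auto
  then have "exec (While e c) (\<lambda>x. if x < m then s' x else r x) t' (\<lambda>x. if x < m then s'' x else r x)"
    by (simp cong: if_cong)
  then show ?case using e WhileTrue.hyps(1) exec.WhileTrue[OF _ 1, of e] by simp
qed

text \<open>An assignment is charged the size of its value, so a changed variable cannot be larger
  than the time spent.\<close>

lemma exec_size: "exec c s t s' \<Longrightarrow> vsize (s' x) \<le> max (vsize (s x)) t"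
  by (induction rule: exec.induct) auto

text \<open>A time bound instead of the exact time lets the branches of a conditional and the passes
  of a loop share one estimate.\<close>

definition execs :: "prog \<Rightarrow> state \<Rightarrow> nat \<Rightarrow> state \<Rightarrow> bool" where
  "execs c s t s' \<longleftrightarrow> (\<exists>t'\<le>t. exec c s t' s')"

lemma execs_mono: "execs c s t s' \<Longrightarrow> t \<le> u \<Longrightarrow> execs c s u s'"
  by (auto simp: execs_def intro: order_trans)

lemma execs_Skip: "execs Skip s 1 s"
  unfolding execs_def using exec.Skip by blast

lemma execs_Assign: "vsize (eval_expr e s) \<le> t \<Longrightarrow> s' = s(x := eval_expr e s) \<Longrightarrow> execs (Assign x e) s t s'"
  unfolding execs_def using exec.Assign by blast

lemma execs_Seq: "execs c s t s' \<Longrightarrow> execs d s' t' s'' \<Longrightarrow> execs (Seq c d) s (t + t') s''"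
  unfolding execs_def by (meson add_mono exec.Seq)

lemma execs_Cond:
  assumes "vsize (eval_expr e s) \<le> u"
    "eval_expr e s \<noteq> Num 0 \<Longrightarrow> execs c s t s'" "eval_expr e s = Num 0 \<Longrightarrow> execs d s t s'"
  shows "execs (Cond e c d) s (u + t) s'"
  using assms unfolding execs_def
  by (cases "eval_expr e s = Num 0") (meson add_mono exec.CondTrue exec.CondFalse)+

lemma execs_WhileFalse: "eval_expr e s = Num 0 \<Longrightarrow> execs (While e c) s 1 s"
  using exec.WhileFalse[of e s c] by (auto simp: execs_def floorlog_def)

lemma execs_WhileTrue:
  assumes "eval_expr e s \<noteq> Num 0" "vsize (eval_expr e s) \<le> u" "execs c s t s'" "execs (While e c) s' t' s''"
  shows "execs (While e c) s (u + t + t') s''"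
  using assms unfolding execs_def by (meson add_mono exec.WhileTrue)

lemma vsize_ge_1: "1 \<le> vsize v"
  by (cases v) auto

primrec clear_vars :: "nat \<Rightarrow> prog" where
  "clear_vars 0 = Skip"
| "clear_vars (Suc m) = Seq (clear_vars m) (if m = 0 then Skip else Assign m (Const 0))"

lemma execs_clear_vars:
  "execs (clear_vars m) s (Suc m) (\<lambda>x. if 0 < x \<and> x < m then Num 0 else s x)"
proof (induction m)
  case 0
  then show ?case using execs_Skip[of s] by simp
next
  case (Suc m)
  show ?case
  proof (cases "m = 0")
    case True
    have "execs (Seq Skip Skip) s (1 + 1) s"
      by (rule execs_Seq[OF execs_Skip execs_Skip])
    moreover have "(\<lambda>x. if 0 < x \<and> x < Suc m then Num 0 else s x) = s"
      using True by auto
    ultimately show ?thesis using True by simp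
  next
    case False
    have "execs (Assign m (Const 0)) (\<lambda>x. if 0 < x \<and> x < m then Num 0 else s x) 1
       (\<lambda>x. if 0 < x \<and> x < Suc m then Num 0 else s x)"
      using False by (intro execs_Assign) (auto simp: fun_eq_iff floorlog_def)
    from execs_Seq[OF Suc this] show ?thesis using False by simp
  qed
qed

section \<open>Polynomial-time functions\<close>

text \<open>With one representation per type, polynomial time becomes a predicate on HOL functions.
  Types may share representations, such as naturals with integers, and then conversion costs
  nothing.\<close>

class enc = fixes enc :: "'a \<Rightarrow> val"

lemma floorlog_0 [simp]: "floorlog b 0 = 0"
  by (simp add: floorlog_def)

lemma floorlog_2_1 [simp]: "floorlog 2 (Suc 0) = 1"
  by (simp add: floorlog_def)

abbreviation sz :: "'a::enc \<Rightarrow> nat" where "sz x \<equiv> vsize (enc x)"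

lemma poly_nat_mono: "x \<le> y \<Longrightarrow> poly (q :: nat poly) x \<le> poly q y"
  by (induction q) (auto intro!: mult_mono)

definition poly_bounded :: "'a::enc set \<Rightarrow> ('a \<Rightarrow> nat) \<Rightarrow> bool" where
  "poly_bounded D T \<longleftrightarrow> (\<exists>q. \<forall>x\<in>D. T x \<le> poly q (sz x))"

named_theorems poly_bounded_intros

lemma poly_bounded_mono: "poly_bounded D T \<Longrightarrow> (\<And>x. x \<in> D \<Longrightarrow> T' x \<le> T x) \<Longrightarrow> poly_bounded D T'"
  unfolding poly_bounded_def by (meson order_trans)

lemma poly_bounded_const [poly_bounded_intros]: "poly_bounded D (\<lambda>_. k)"
  unfolding poly_bounded_def by (rule exI[of _ "[:k:]"]) simp

lemma poly_bounded_sz [poly_bounded_intros]: "poly_bounded D sz"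
  unfolding poly_bounded_def by (rule exI[of _ "[:0, 1:]"]) simp

lemma poly_bounded_add [poly_bounded_intros]:
  assumes "poly_bounded D S" "poly_bounded D T"
  shows "poly_bounded D (\<lambda>x. S x + T x)"
proof -
  obtain p q where "\<forall>x\<in>D. S x \<le> poly p (sz x)" "\<forall>x\<in>D. T x \<le> poly q (sz x)"
    using assms unfolding poly_bounded_def by blast
  then have "\<forall>x\<in>D. S x + T x \<le> poly (p + q) (sz x)" by (auto intro: add_mono)
  then show ?thesis unfolding poly_bounded_def by blast
qed

lemma poly_bounded_Suc [poly_bounded_intros]: "poly_bounded D T \<Longrightarrow> poly_bounded D (\<lambda>x. Suc (T x))"
  using poly_bounded_add[OF poly_bounded_const[of D 1], of T] by simp

lemma poly_bounded_mult [poly_bounded_intros]: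
  assumes "poly_bounded D S" "poly_bounded D T"
  shows "poly_bounded D (\<lambda>x. S x * T x)"
proof -
  obtain p q where "\<forall>x\<in>D. S x \<le> poly p (sz x)" "\<forall>x\<in>D. T x \<le> poly q (sz x)"
    using assms unfolding poly_bounded_def by blast
  then have "\<forall>x\<in>D. S x * T x \<le> poly (p * q) (sz x)" by (auto intro: mult_mono)
  then show ?thesis unfolding poly_bounded_def by blast
qed

lemma poly_bounded_comp:
  assumes "poly_bounded E T" "poly_bounded D (\<lambda>x. sz (f x))" "\<And>x. x \<in> D \<Longrightarrow> f x \<in> E"
  shows "poly_bounded D (\<lambda>x. T (f x))"
proof -
  obtain p q where pq: "\<forall>x\<in>E. T x \<le> poly p (sz x)" "\<forall>x\<in>D. sz (f x) \<le> poly q (sz x)"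
    using assms unfolding poly_bounded_def by blast
  have "T (f x) \<le> poly (pcompose p q) (sz x)" if "x \<in> D" for x
    using pq assms(3)[OF that] poly_nat_mono[of "sz (f x)" "poly q (sz x)" p] that
    by (fastforce simp: poly_pcompose)
  then show ?thesis unfolding poly_bounded_def by blast
qed

text \<open>
  The program restores all variables other than 0. Variables from \<open>m\<close> on may hold arbitrary values,
  so that a surrounding program can use them as storage.
\<close>

definition runs :: "prog \<Rightarrow> nat \<Rightarrow> ('a::enc \<Rightarrow> 'b::enc) \<Rightarrow> 'a \<Rightarrow> nat \<Rightarrow> bool" where
  "runs c m f x t \<longleftrightarrow>
     (\<forall>s. s 0 = enc x \<longrightarrow> (\<forall>y. 0 < y \<and> y < m \<longrightarrow> s y = Num 0) \<longrightarrow> execs c s t (s(0 := enc (f x))))"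

lemma runs_mono: "runs c m f x t \<Longrightarrow> m \<le> m' \<Longrightarrow> t \<le> t' \<Longrightarrow> runs c m' f x t'"
  unfolding runs_def by (metis execs_mono order_less_le_trans)

lemma runsD: "runs c m f x t \<Longrightarrow> s 0 = enc x \<Longrightarrow> (\<And>y. 0 < y \<Longrightarrow> y < m \<Longrightarrow> s y = Num 0) \<Longrightarrow>
    execs c s t (s(0 := enc (f x)))"
  unfolding runs_def by blast

text \<open>The domain \<open>D\<close> is there for the given program: its running time and output
  are known only on encodings of valid instances.\<close>

definition ptime_on :: "'a::enc set \<Rightarrow> ('a \<Rightarrow> 'b::enc) \<Rightarrow> bool" where
  "ptime_on D f \<longleftrightarrow> (\<exists>c m T. poly_bounded D T \<and> (\<forall>x\<in>D. runs c m f x (T x)))"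

abbreviation ptime :: "('a::enc \<Rightarrow> 'b::enc) \<Rightarrow> bool" where
  "ptime \<equiv> ptime_on UNIV"

named_theorems ptime_intros

lemma ptime_onI:
  "poly_bounded D T \<Longrightarrow> (\<And>x. x \<in> D \<Longrightarrow> runs c m f x (T x)) \<Longrightarrow> ptime_on D f"
  unfolding ptime_on_def by blast

text \<open>Turns an arbitrary program into one that restores its variables: run it, then reset the
  variables 1 to \<open>m\<close> to 0.\<close>

lemma ptime_on_exec:
  assumes "poly_bounded D T"
    "\<And>x. x \<in> D \<Longrightarrow> \<exists>t s. exec c (init_state (enc x)) t s \<and> t \<le> T x \<and> s 0 = enc (f x)"
  shows "ptime_on D f"
proof -
  obtain m where m: "prog_below m c" using ex_prog_below by blast
  have m': "prog_below (Suc m) c" using m by (rule prog_below_mono) simp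
  have "runs (Seq c (clear_vars (Suc m))) (Suc m) f x (T x + Suc (Suc m))" if x: "x \<in> D" for x
    unfolding runs_def
  proof (intro allI impI)
    fix s assume s0: "s 0 = enc x" and sy: "\<forall>y. 0 < y \<and> y < Suc m \<longrightarrow> s y = Num 0"
    obtain t s' where e: "exec c (init_state (enc x)) t s'" "t \<le> T x" "s' 0 = enc (f x)"
      using assms(2)[OF x] by blast
    have "exec c s t (\<lambda>x. if x < Suc m then s' x else s x)"
      using e(1) m' by (rule exec_frame) (use s0 sy in \<open>auto simp: init_state_def\<close>)
    then have 1: "execs c s (T x) (\<lambda>x. if x < Suc m then s' x else s x)"
      using e(2) unfolding execs_def by blast
    have "(\<lambda>x. if 0 < x \<and> x < Suc m then Num 0 else if x < Suc m then s' x else s x)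
       = s(0 := enc (f x))"
      using sy e(3) by (auto simp: fun_eq_iff)
    then show "execs (Seq c (clear_vars (Suc m))) s (T x + Suc (Suc m)) (s(0 := enc (f x)))"
      using execs_Seq[OF 1 execs_clear_vars[of "Suc m"]] by (simp only:)
  qed
  moreover have "poly_bounded D (\<lambda>x. T x + Suc (Suc m))"
    using assms(1) by (intro poly_bounded_intros)
  ultimately show ?thesis by (intro ptime_onI)
qed

lemma ptime_onE:
  assumes "ptime_on D f"
  obtains c T where "poly_bounded D T"
    "\<And>x. x \<in> D \<Longrightarrow> \<exists>t\<le>T x. exec c (init_state (enc x)) t (init_state (enc (f x)))"
proof -
  obtain c m T where T: "poly_bounded D T" "\<forall>x\<in>D. runs c m f x (T x)"
    using assms unfolding ptime_on_def by (elim exE conjE)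
  have "\<exists>t\<le>T x. exec c (init_state (enc x)) t (init_state (enc (f x)))" if "x \<in> D" for x
  proof -
    have "execs c (init_state (enc x)) (T x) ((init_state (enc x))(0 := enc (f x)))"
      using T(2) that by (intro runsD) (auto simp: init_state_def)
    then show ?thesis by (simp add: init_state_def execs_def)
  qed
  with T(1) show ?thesis by (rule that)
qed

text \<open>The output is at most the input size plus the running time. This keeps the running time
  of a composition polynomial in the original input.\<close>

lemma ptime_on_sz:
  assumes "ptime_on D f"
  shows "poly_bounded D (\<lambda>x. sz (f x))"
proof -
  obtain c T where T: "poly_bounded D T"
    "\<And>x. x \<in> D \<Longrightarrow> \<exists>t\<le>T x. exec c (init_state (enc x)) t (init_state (enc (f x)))"
    by (rule ptime_onE[OF assms]) (rule that)
  have "sz (f x) \<le> sz x + T x" if "x \<in> D" for x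
    using T(2)[OF that] exec_size[of c "init_state (enc x)" _ "init_state (enc (f x))" 0]
    by (fastforce simp: init_state_def)
  moreover have "poly_bounded D (\<lambda>x. sz x + T x)"
    using T(1) by (intro poly_bounded_intros)
  ultimately show ?thesis by (rule poly_bounded_mono[rotated])
qed

text \<open>Only the encodings must agree, so \<open>f\<close> and \<open>g\<close> may have
  different result types; a pair of head and tail, for instance, is encoded like the list.\<close>

lemma ptime_on_cong:
  assumes "ptime_on D f" "\<And>x. x \<in> D \<Longrightarrow> enc (f x) = enc (g x)"
  shows "ptime_on D g"
proof -
  obtain c m T where T: "poly_bounded D T" "\<forall>x\<in>D. runs c m f x (T x)"
    using assms(1) unfolding ptime_on_def by (elim exE conjE)
  show ?thesis
    by (rule ptime_onI[OF T(1), of c m]) (use T(2) assms(2) in \<open>simp add: runs_def\<close>)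
qed

lemma ptime_on_obtain:
  assumes "ptime_on D f"
  obtains c m T where "poly_bounded D T" "\<And>x m'. x \<in> D \<Longrightarrow> m \<le> m' \<Longrightarrow> runs c m' f x (T x)" "1 \<le> m"
proof -
  obtain c m T where T: "poly_bounded D T" "\<forall>x\<in>D. runs c m f x (T x)"
    using assms unfolding ptime_on_def by (elim exE conjE)
  show ?thesis
    by (rule that[OF T(1), of "Suc m" c]) (use T(2) in \<open>auto intro: runs_mono\<close>)
qed

lemma ptime_on_comp:
  assumes "ptime_on E g" "ptime_on D f" "\<And>x. x \<in> D \<Longrightarrow> f x \<in> E"
  shows "ptime_on D (\<lambda>x. g (f x))"
proof -
  obtain c m T where f: "poly_bounded D T" "\<And>x m'. x \<in> D \<Longrightarrow> m \<le> m' \<Longrightarrow> runs c m' f x (T x)" "1 \<le> m"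
    by (rule ptime_on_obtain[OF assms(2)]) (rule that)
  obtain d k S where g: "poly_bounded E S" "\<And>x m'. x \<in> E \<Longrightarrow> k \<le> m' \<Longrightarrow> runs d m' g x (S x)" "1 \<le> k"
    by (rule ptime_on_obtain[OF assms(1)]) (rule that)
  show ?thesis
  proof (rule ptime_onI)
    show "poly_bounded D (\<lambda>x. T x + S (f x))"
      by (intro poly_bounded_intros f(1) poly_bounded_comp[OF g(1)] ptime_on_sz assms)
    fix x assume x: "x \<in> D"
    show "runs (Seq c d) (max m k) (\<lambda>x. g (f x)) x (T x + S (f x))"
      unfolding runs_def
    proof (intro allI impI)
      fix s assume s: "s 0 = enc x" "\<forall>y. 0 < y \<and> y < max m k \<longrightarrow> s y = Num 0"
      have 1: "execs c s (T x) (s(0 := enc (f x)))"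
        using s by (intro runsD[OF f(2)[OF x order_refl]]) auto
      have 2: "execs d (s(0 := enc (f x))) (S (f x)) ((s(0 := enc (f x)))(0 := enc (g (f x))))"
        using s by (intro runsD[OF g(2)[OF assms(3)[OF x] order_refl]]) auto
      show "execs (Seq c d) s (T x + S (f x)) (s(0 := enc (g (f x))))"
        using execs_Seq[OF 1 2] by simp
    qed
  qed
qed

lemma ptime_comp: "ptime g \<Longrightarrow> ptime_on D f \<Longrightarrow> ptime_on D (\<lambda>x. g (f x))"
  by (rule ptime_on_comp) auto

lemma ptime_expr:
  assumes "\<And>x s. s 0 = enc x \<Longrightarrow> eval_expr e s = enc (f x)" "poly_bounded D (\<lambda>x. sz (f x))"
  shows "ptime_on D f"
  using assms(2)
proof (rule ptime_onI)
  show "runs (Assign 0 e) 1 f x (sz (f x))" for x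
    unfolding runs_def using assms(1) by (auto intro!: execs_Assign)
qed

section \<open>Constants, pairs and case distinctions\<close>

lemma ptime_id [ptime_intros]: "ptime_on D (\<lambda>x. x)"
  by (rule ptime_expr[of "Var 0"]) (auto intro: poly_bounded_intros)

primrec expr_of_val :: "val \<Rightarrow> expr" where
  "expr_of_val (Num i) = Const i"
| "expr_of_val (Pair v w) = MkPair (expr_of_val v) (expr_of_val w)"

lemma eval_expr_of_val: "eval_expr (expr_of_val v) s = v"
  by (induction v) auto

lemma ptime_const [ptime_intros]: "ptime_on D (\<lambda>_. k)"
  by (rule ptime_expr[of "expr_of_val (enc k)"]) (auto simp: eval_expr_of_val intro: poly_bounded_intros)

instantiation prod :: (enc, enc) enc
begin

primrec enc_prod :: "'a \<times> 'b \<Rightarrow> val" where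
  "enc_prod (x, y) = Pair (enc x) (enc y)"

instance ..

end

lemma enc_prod_eq: "enc p = Pair (enc (fst p)) (enc (snd p))"
  by (cases p) simp

instantiation bool :: enc
begin

definition enc_bool :: "bool \<Rightarrow> val" where
  "enc_bool b = Num (of_bool b)"

instance ..

end

lemma enc_bool_eq_0: "enc b = Num 0 \<longleftrightarrow> \<not> b"
  by (simp add: enc_bool_def)

lemma sz_bool_le: "sz (b :: bool) \<le> 2"
  by (cases b) (simp_all add: enc_bool_def)

lemma ptime_fst [ptime_intros]: "ptime_on D f \<Longrightarrow> ptime_on D (\<lambda>x. fst (f x))"
  by (rule ptime_comp[of fst])
    (auto intro!: ptime_expr[of "Fst (Var 0)"] poly_bounded_mono[OF poly_bounded_sz] simp: enc_prod_eq)

lemma ptime_snd [ptime_intros]: "ptime_on D f \<Longrightarrow> ptime_on D (\<lambda>x. snd (f x))"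
  by (rule ptime_comp[of snd])
    (auto intro!: ptime_expr[of "Snd (Var 0)"] poly_bounded_mono[OF poly_bounded_sz] simp: enc_prod_eq)

text \<open>The variables \<open>m\<close> and \<open>m+1\<close> lie above those that either
  program expects to be 0, and both programs restore them. They save the argument and the first
  result, and are reset at the end.\<close>

lemma ptime_pair [ptime_intros]:
  assumes "ptime_on D f" "ptime_on D g"
  shows "ptime_on D (\<lambda>x. (f x, g x))"
proof -
  obtain c a T where f: "poly_bounded D T" "\<And>x m'. x \<in> D \<Longrightarrow> a \<le> m' \<Longrightarrow> runs c m' f x (T x)" "1 \<le> a"
    by (rule ptime_on_obtain[OF assms(1)]) (rule that)
  obtain d b S where g: "poly_bounded D S" "\<And>x m'. x \<in> D \<Longrightarrow> b \<le> m' \<Longrightarrow> runs d m' g x (S x)" "1 \<le> b"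
    by (rule ptime_on_obtain[OF assms(2)]) (rule that)
  define m where "m = max a b"
  have m: "a \<le> m" "b \<le> m" "1 \<le> m" using f(3) by (auto simp: m_def)
  define p where "p = Seq (Assign m (Var 0)) (Seq c (Seq (Assign (m+1) (Var 0)) (Seq (Assign 0 (Var m))
    (Seq d (Seq (Assign 0 (MkPair (Var (m+1)) (Var 0)))
      (Seq (Assign m (Const 0)) (Assign (m+1) (Const 0))))))))"
  show ?thesis
  proof (rule ptime_onI)
    show "poly_bounded D (\<lambda>x. sz x + (T x + (sz (f x) + (sz x + (S x + (sz (f x, g x) + (1 + 1)))))))"
      unfolding enc_prod_eq fst_conv snd_conv vsize.simps
      by (intro poly_bounded_intros f(1) g(1) ptime_on_sz assms)
    fix x assume x: "x \<in> D"
    show "runs p (m + 2) (\<lambda>x. (f x, g x)) x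
      (sz x + (T x + (sz (f x) + (sz x + (S x + (sz (f x, g x) + (1 + 1)))))))"
      unfolding runs_def
    proof (intro allI impI)
      fix s assume s: "s 0 = enc x" "\<forall>y. 0 < y \<and> y < m + 2 \<longrightarrow> s y = Num 0"
      define s1 where "s1 = s(m := enc x)"
      define s2 where "s2 = s1(0 := enc (f x))"
      define s3 where "s3 = s2(m+1 := enc (f x))"
      define s4 where "s4 = s3(0 := enc x)"
      define s5 where "s5 = s4(0 := enc (g x))"
      define s6 where "s6 = s5(0 := enc (f x, g x))"
      define s7 where "s7 = s6(m := Num 0)"
      note defs = s1_def s2_def s3_def s4_def s5_def s6_def s7_def
      have e1: "execs (Assign m (Var 0)) s (sz x) s1"
        by (rule execs_Assign) (auto simp: defs s)
      have e2: "execs c s1 (T x) s2"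
        unfolding s2_def by (rule runsD[OF f(2)[OF x m(1)]]) (use m s in \<open>auto simp: s1_def\<close>)
      have e3: "execs (Assign (m+1) (Var 0)) s2 (sz (f x)) s3"
        by (rule execs_Assign) (auto simp: defs s)
      have e4: "execs (Assign 0 (Var m)) s3 (sz x) s4"
        using m by (intro execs_Assign) (auto simp: defs s)
      have e5: "execs d s4 (S x) s5"
        unfolding s5_def by (rule runsD[OF g(2)[OF x m(2)]]) (use m s in \<open>auto simp: defs\<close>)
      have e6: "execs (Assign 0 (MkPair (Var (m+1)) (Var 0))) s5 (sz (f x, g x)) s6"
        using m by (intro execs_Assign) (auto simp: defs)
      have e7: "execs (Assign m (Const 0)) s6 1 s7"
        using m by (intro execs_Assign) (auto simp: defs floorlog_def)
      have e8: "execs (Assign (m+1) (Const 0)) s7 1 (s(0 := enc (f x, g x)))"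
        using m s by (intro execs_Assign) (auto simp: defs floorlog_def fun_eq_iff)
      show "execs p s (sz x + (T x + (sz (f x) + (sz x + (S x + (sz (f x, g x) + (1 + 1)))))))
        (s(0 := enc (f x, g x)))"
        unfolding p_def by (rule execs_Seq[OF e1 execs_Seq[OF e2 execs_Seq[OF e3 execs_Seq[OF e4
          execs_Seq[OF e5 execs_Seq[OF e6 execs_Seq[OF e7 e8]]]]]]])
    qed
  qed
qed

lemma ptime_if [ptime_intros]:
  assumes "ptime_on D b" "ptime_on D f" "ptime_on D g"
  shows "ptime_on D (\<lambda>x. if b x then f x else g x)"
proof -
  obtain c1 a1 T where f: "poly_bounded D T" "\<And>x m'. x \<in> D \<Longrightarrow> a1 \<le> m' \<Longrightarrow> runs c1 m' f x (T x)" "1 \<le> a1"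
    by (rule ptime_on_obtain[OF assms(2)]) (rule that)
  obtain c2 a2 S where g: "poly_bounded D S" "\<And>x m'. x \<in> D \<Longrightarrow> a2 \<le> m' \<Longrightarrow> runs c2 m' g x (S x)" "1 \<le> a2"
    by (rule ptime_on_obtain[OF assms(3)]) (rule that)
  obtain c3 a3 U where b: "poly_bounded D U" "\<And>x m'. x \<in> D \<Longrightarrow> a3 \<le> m' \<Longrightarrow> runs c3 m' b x (U x)" "1 \<le> a3"
    by (rule ptime_on_obtain[OF assms(1)]) (rule that)
  define m where "m = max a1 (max a2 a3)"
  have m: "a1 \<le> m" "a2 \<le> m" "a3 \<le> m" "1 \<le> m" using f(3) by (auto simp: m_def)
  define p where "p = Seq (Assign m (Var 0)) (Seq c3 (Seq (Assign (m+1) (Var 0)) (Seq (Assign 0 (Var m))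
    (Seq (Assign m (Const 0)) (Cond (Var (m+1)) (Seq (Assign (m+1) (Const 0)) c1)
       (Seq (Assign (m+1) (Const 0)) c2))))))"
  let ?h = "\<lambda>x. if b x then f x else g x"
  let ?B = "\<lambda>x. sz x + (U x + (sz (b x) + (sz x + (1 + (sz (b x) + (1 + (T x + S x)))))))"
  show ?thesis
  proof (rule ptime_onI)
    show "poly_bounded D ?B"
      by (intro poly_bounded_intros f(1) g(1) b(1) ptime_on_sz assms)
    fix x assume x: "x \<in> D"
    show "runs p (m + 2) ?h x (?B x)"
      unfolding runs_def
    proof (intro allI impI)
      fix s assume s: "s 0 = enc x" "\<forall>y. 0 < y \<and> y < m + 2 \<longrightarrow> s y = Num 0"
      define s1 where "s1 = s(m := enc x)"
      define s2 where "s2 = s1(0 := enc (b x))"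
      define s3 where "s3 = s2(m+1 := enc (b x))"
      define s4 where "s4 = s3(0 := enc x)"
      define s5 where "s5 = s4(m := Num 0)"
      note defs = s1_def s2_def s3_def s4_def s5_def
      have e1: "execs (Assign m (Var 0)) s (sz x) s1"
        by (rule execs_Assign) (auto simp: defs s)
      have e2: "execs c3 s1 (U x) s2"
        unfolding s2_def by (rule runsD[OF b(2)[OF x m(3)]]) (use m s in \<open>auto simp: s1_def\<close>)
      have e3: "execs (Assign (m+1) (Var 0)) s2 (sz (b x)) s3"
        by (rule execs_Assign) (auto simp: defs s)
      have e4: "execs (Assign 0 (Var m)) s3 (sz x) s4"
        using m by (intro execs_Assign) (auto simp: defs s)
      have e5: "execs (Assign m (Const 0)) s4 1 s5"
        using m by (intro execs_Assign) (auto simp: defs floorlog_def)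
      have s5: "s5(m+1 := Num 0) = s"
        using m s by (auto simp: defs fun_eq_iff)
      have e6: "execs (Assign (m+1) (Const 0)) s5 1 s"
        using m s s5 by (intro execs_Assign) (auto simp: floorlog_def)
      have t1: "execs c1 s (T x + S x) (s(0 := enc (?h x)))" if "b x"
        using runsD[OF f(2)[OF x m(1)], of s] s m that by (auto intro: execs_mono)
      have t2: "execs c2 s (T x + S x) (s(0 := enc (?h x)))" if "\<not> b x"
        using runsD[OF g(2)[OF x m(2)], of s] s m that by (auto intro: execs_mono)
      have s5v: "eval_expr (Var (m+1)) s5 = enc (b x)" using m by (simp add: defs)
      have "execs (Cond (Var (m+1)) (Seq (Assign (m+1) (Const 0)) c1) (Seq (Assign (m+1) (Const 0)) c2)) s5
        (sz (b x) + (1 + (T x + S x))) (s(0 := enc (?h x)))"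
      proof (rule execs_Cond, unfold s5v enc_bool_eq_0)
        show "execs (Seq (Assign (m+1) (Const 0)) c1) s5 (1 + (T x + S x)) (s(0 := enc (?h x)))"
          if "\<not> \<not> b x" using that by (intro execs_Seq[OF e6] t1) simp
        show "execs (Seq (Assign (m+1) (Const 0)) c2) s5 (1 + (T x + S x)) (s(0 := enc (?h x)))"
          if "\<not> b x" using that by (intro execs_Seq[OF e6] t2)
      qed simp
      then show "execs p s (?B x) (s(0 := enc (?h x)))"
        unfolding p_def by (rule execs_Seq[OF e1 execs_Seq[OF e2 execs_Seq[OF e3 execs_Seq[OF e4
          execs_Seq[OF e5]]]]])
    qed
  qed
qed

section \<open>Lists and iteration over a list\<close>

instantiation list :: (enc) enc
begin

primrec enc_list :: "'a list \<Rightarrow> val" where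
  "enc_list [] = Num 0"
| "enc_list (x # xs) = Pair (enc x) (enc_list xs)"

instance ..

end

lemma length_less_sz: "length xs < sz xs"
  by (induction xs) auto

lemma sz_mem_le: "x \<in> set xs \<Longrightarrow> sz x \<le> sz xs"
  by (induction xs) auto

lemma poly_bounded_poly:
  assumes "poly_bounded D T"
  shows "poly_bounded D (\<lambda>x. poly q (T x))"
proof -
  obtain p where p: "\<forall>x\<in>D. T x \<le> poly p (sz x)"
    using assms unfolding poly_bounded_def by blast
  have "poly q (T x) \<le> poly (pcompose q p) (sz x)" if "x \<in> D" for x
    using p that poly_nat_mono[of "T x" "poly p (sz x)" q] by (simp add: poly_pcompose)
  then show ?thesis unfolding poly_bounded_def by blast
qed

text \<open>Variable \<open>m\<close> holds a parameter, \<open>m+1\<close> the rest of the list and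
  \<open>m+2\<close> the accumulator. The test works because a nonempty list is encoded as a pair
  and the empty one as a number.\<close>

definition fold_loop :: "nat \<Rightarrow> prog \<Rightarrow> prog" where
  "fold_loop m c =
     While (IsPair (Var (m + 1)))
       (Seq (Assign 0 (MkPair (Var m) (MkPair (Fst (Var (m+1))) (Var (m+2)))))
         (Seq c (Seq (Assign (m+2) (Var 0)) (Assign (m+1) (Snd (Var (m+1)))))))"

text \<open>The bound \<open>B\<close> must hold after every prefix, since each pass handles the
  current accumulator. The value \<open>v\<close> is whatever the last pass left in variable
  0.\<close>

lemma execs_fold_loop:
  fixes u :: "'u::enc" and ys :: "'y::enc list" and b :: "'a::enc" and F :: "'u \<times> 'y \<times> 'a \<Rightarrow> 'a"
  assumes m: "1 \<le> m"
    and step: "\<And>y b. sz y \<le> L \<Longrightarrow> sz b \<le> B \<Longrightarrow> runs c m F (u, y, b) P"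
  shows "(\<And>k. k \<le> length ys \<Longrightarrow> sz (fold (\<lambda>y b. F (u, y, b)) (take k ys) b) \<le> B) \<Longrightarrow> sz ys \<le> L \<Longrightarrow>
    (\<And>y. 0 < y \<Longrightarrow> y < m \<Longrightarrow> s y = Num 0) \<Longrightarrow>
    s m = enc u \<Longrightarrow> s (m + 1) = enc ys \<Longrightarrow> s (m + 2) = enc b \<Longrightarrow>
    \<exists>v. execs (fold_loop m c)
      s (length ys * (2 + (2 + sz u + L + B + (P + (B + L)))) + 1)
      (s(0 := v, m + 1 := Num 0, m + 2 := enc (fold (\<lambda>y b. F (u, y, b)) ys b)))"
proof (induction ys arbitrary: b s)
  case Nil
  have "s(0 := s 0, m + 1 := Num 0, m + 2 := enc b) = s"
    using Nil.prems by auto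
  moreover have "execs (fold_loop m c) s 1 s"
    using Nil.prems unfolding fold_loop_def by (intro execs_WhileFalse) simp
  ultimately have "execs (fold_loop m c) s 1 (s(0 := s 0, m + 1 := Num 0, m + 2 := enc b))"
    by (simp only:)
  then show ?case by (intro exI[of _ "s 0"]) (simp only: list.size mult_0 add_0 fold_simps)
next
  case (Cons y ys)
  let ?b = "F (u, y, b)"
  have b: "sz b \<le> B" using Cons.prems(1)[of 0] by simp
  have b': "sz ?b \<le> B" using Cons.prems(1)[of 1] by simp
  have y: "sz y \<le> L" "sz ys \<le> L" using Cons.prems(2) by auto
  define s1 where "s1 = s(0 := enc (u, y, b))"
  define s2 where "s2 = s1(0 := enc ?b)"
  define s3 where "s3 = s2(m + 2 := enc ?b)"
  define s4 where "s4 = s3(m + 1 := enc ys)"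
  note defs = s1_def s2_def s3_def s4_def
  have e1: "execs (Assign 0 (MkPair (Var m) (MkPair (Fst (Var (m+1))) (Var (m+2))))) s (2 + sz u + L + B) s1"
    using Cons.prems(4,5,6) b y by (intro execs_Assign) (auto simp: defs)
  have e2: "execs c s1 P s2"
    unfolding s2_def by (rule runsD[OF step[OF y(1) b]]) (use Cons.prems(3) in \<open>auto simp: defs\<close>)
  have e3: "execs (Assign (m+2) (Var 0)) s2 B s3"
    using b' by (intro execs_Assign) (auto simp: defs)
  have e4: "execs (Assign (m+1) (Snd (Var (m+1)))) s3 L s4"
    using y Cons.prems(5) by (intro execs_Assign) (auto simp: defs)
  have "\<exists>v. execs (fold_loop m c) s4 (length ys * (2 + (2 + sz u + L + B + (P + (B + L)))) + 1)
      (s4(0 := v, m + 1 := Num 0, m + 2 := enc (fold (\<lambda>y b. F (u, y, b)) ys ?b)))"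
  proof (rule Cons.IH)
    show "sz (fold (\<lambda>y b. F (u, y, b)) (take k ys) ?b) \<le> B" if "k \<le> length ys" for k
      using Cons.prems(1)[of "Suc k"] that by simp
  qed (use y m Cons.prems(3,4) in \<open>auto simp: defs\<close>)
  then obtain v where v: "execs (fold_loop m c) s4 (length ys * (2 + (2 + sz u + L + B + (P + (B + L)))) + 1)
      (s4(0 := v, m + 1 := Num 0, m + 2 := enc (fold (\<lambda>y b. F (u, y, b)) ys ?b)))" by blast
  have "s4(0 := v, m + 1 := Num 0, m + 2 := enc (fold (\<lambda>y b. F (u, y, b)) ys ?b)) =
    s(0 := v, m + 1 := Num 0, m + 2 := enc (fold (\<lambda>y b. F (u, y, b)) (y # ys) b))"
    by (auto simp: defs fun_eq_iff)
  note v = v[unfolded this]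
  have "execs (fold_loop m c) s (2 + (2 + sz u + L + B + (P + (B + L))) + (length ys * (2 + (2 + sz u + L + B + (P + (B + L)))) + 1))
     (s(0 := v, m + 1 := Num 0, m + 2 := enc (fold (\<lambda>y b. F (u, y, b)) (y # ys) b)))"
    unfolding fold_loop_def
    by (rule execs_WhileTrue[OF _ _ execs_Seq[OF e1 execs_Seq[OF e2 execs_Seq[OF e3 e4]]] v[unfolded fold_loop_def]])
      (use Cons.prems(5) in simp_all)
  then have "execs (fold_loop m c) s (length (y # ys) * (2 + (2 + sz u + L + B + (P + (B + L)))) + 1)
     (s(0 := v, m + 1 := Num 0, m + 2 := enc (fold (\<lambda>y b. F (u, y, b)) (y # ys) b)))"
    by (rule execs_mono) simp
  then show ?case by (rule exI[of _ v])
qed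

lemma ptime_fold_core:
  fixes F :: "'u::enc \<times> 'y::enc \<times> 'a::enc \<Rightarrow> 'a"
  assumes F: "ptime F" and B: "poly_bounded E B"
    and bound: "\<And>u ys b k. (u, ys, b) \<in> E \<Longrightarrow> k \<le> length ys \<Longrightarrow>
      sz (fold (\<lambda>y b. F (u, y, b)) (take k ys) b) \<le> B (u, ys, b)"
  shows "ptime_on E (\<lambda>e. fold (\<lambda>y b. F (fst e, y, b)) (fst (snd e)) (snd (snd e)))"
proof -
  obtain c m T where T: "poly_bounded UNIV T" "\<And>x m'. x \<in> UNIV \<Longrightarrow> m \<le> m' \<Longrightarrow> runs c m' F x (T x)" "1 \<le> m"
    by (rule ptime_on_obtain[OF F]) (rule that)
  obtain q where q: "T z \<le> poly q (sz z)" for z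
    using T(1) unfolding poly_bounded_def by blast
  define W where "W = fold_loop m c"
  define p where "p = Seq (Assign m (Fst (Var 0))) (Seq (Assign (m+1) (Fst (Snd (Var 0))))
    (Seq (Assign (m+2) (Snd (Snd (Var 0)))) (Seq W (Seq (Assign 0 (Var (m+2)))
     (Seq (Assign m (Const 0)) (Assign (m+2) (Const 0)))))))"
  define P where "P e = poly q (2 + sz e + sz e + B e)" for e
  define R where "R e = (let n = sz e in n + (n + (n + (n * (2 + (2 + n + n + B e + (P e + (B e + n)))) + 1
     + (B e + (1 + 1))))))" for e
  show ?thesis
  proof (rule ptime_onI)
    show "poly_bounded E R"
      unfolding R_def P_def Let_def numeral_2_eq_2 One_nat_def
      by (intro poly_bounded_intros B poly_bounded_poly)
    fix e assume "e \<in> E"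
    moreover obtain u ys b where e: "e = (u, ys, b)" by (cases e)
    ultimately have E: "(u, ys, b) \<in> E" by simp
    let ?f = "\<lambda>e. fold (\<lambda>y b. F (fst e, y, b)) (fst (snd e)) (snd (snd e))"
    let ?r = "fold (\<lambda>y b. F (u, y, b)) ys b"
    show "runs p (m + 3) ?f e (R e)"
      unfolding runs_def
    proof (intro allI impI)
      fix s assume s: "s 0 = enc e" "\<forall>y. 0 < y \<and> y < m + 3 \<longrightarrow> s y = Num 0"
      define s1 where "s1 = s(m := enc u)"
      define s2 where "s2 = s1(m + 1 := enc ys)"
      define s3 where "s3 = s2(m + 2 := enc b)"
      note defs = s1_def s2_def s3_def
      have e1: "execs (Assign m (Fst (Var 0))) s (sz e) s1"
        using s by (intro execs_Assign) (auto simp: defs e)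
      have e2: "execs (Assign (m+1) (Fst (Snd (Var 0)))) s1 (sz e) s2"
        using s T(3) by (intro execs_Assign) (auto simp: defs e)
      have e3: "execs (Assign (m+2) (Snd (Snd (Var 0)))) s2 (sz e) s3"
        using s T(3) by (intro execs_Assign) (auto simp: defs e)
      have "\<exists>v. execs W s3 (length ys * (2 + (2 + sz u + sz ys + B e + (P e + (B e + sz ys)))) + 1)
          (s3(0 := v, m + 1 := Num 0, m + 2 := enc ?r))"
        unfolding W_def
      proof (rule execs_fold_loop)
        show "runs c m F (u, y, b') (P e)" if "sz y \<le> sz ys" "sz b' \<le> B e" for y b'
        proof (rule runs_mono[OF T(2)])
          have "sz (u, y, b') \<le> 2 + sz e + sz e + B e"
            using that by (simp add: e)
          then show "T (u, y, b') \<le> P e"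
            unfolding P_def using q order_trans poly_nat_mono by blast
        qed auto
        show "sz (fold (\<lambda>y b. F (u, y, b)) (take k ys) b) \<le> B e" if "k \<le> length ys" for k
          using bound[OF E that] by (simp add: e)
      qed (use T(3) s in \<open>auto simp: defs\<close>)
      then obtain v where v: "execs W s3 (length ys * (2 + (2 + sz u + sz ys + B e + (P e + (B e + sz ys)))) + 1)
          (s3(0 := v, m + 1 := Num 0, m + 2 := enc ?r))" by blast
      have "execs W s3 (sz e * (2 + (2 + sz e + sz e + B e + (P e + (B e + sz e)))) + 1)
          (s3(0 := v, m + 1 := Num 0, m + 2 := enc ?r))"
        by (rule execs_mono[OF v]) (use length_less_sz[of ys] in \<open>intro add_mono mult_mono; simp add: e\<close>)
      note e4 = this
      define s4 where "s4 = s3(0 := v, m + 1 := Num 0, m + 2 := enc ?r)"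
      define s5 where "s5 = s4(0 := enc ?r)"
      define s6 where "s6 = s5(m := Num 0)"
      note defs = defs s4_def s5_def s6_def
      have e5: "execs (Assign 0 (Var (m+2))) s4 (B e) s5"
        using bound[OF E, of "length ys"] by (intro execs_Assign) (auto simp: defs e)
      have e6: "execs (Assign m (Const 0)) s5 1 s6"
        by (intro execs_Assign) (auto simp: defs)
      have e7: "execs (Assign (m+2) (Const 0)) s6 1 (s(0 := enc (?f e)))"
        using s T(3) by (intro execs_Assign) (auto simp: defs fun_eq_iff e)
      show "execs p s (R e) (s(0 := enc (?f e)))"
        unfolding p_def R_def Let_def
        by (rule execs_Seq[OF e1 execs_Seq[OF e2 execs_Seq[OF e3 execs_Seq[OF e4[folded s4_def] execs_Seq[OF e5 execs_Seq[OF e6 e7]]]]]])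
    qed
  qed
qed

text \<open>Iterating a polynomial-time step may produce values of exponential size, so a polynomial
  bound on all intermediate accumulators has to be supplied.\<close>

lemma ptime_fold:
  fixes step :: "'x::enc \<Rightarrow> 'y::enc \<Rightarrow> 'a::enc \<Rightarrow> 'a"
  assumes step: "ptime (\<lambda>z. step (fst z) (fst (snd z)) (snd (snd z)))"
    and xs: "ptime_on D xs" and a: "ptime_on D a" and B: "poly_bounded D B"
    and bound: "\<And>x k. x \<in> D \<Longrightarrow> k \<le> length (xs x) \<Longrightarrow> sz (fold (step x) (take k (xs x)) (a x)) \<le> B x"
  shows "ptime_on D (\<lambda>x. fold (step x) (xs x) (a x))"
proof -
  let ?F = "\<lambda>z. step (fst z) (fst (snd z)) (snd (snd z))"
  let ?E = "(\<lambda>x. (x, (xs x, a x))) ` D"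
  have "ptime_on D (\<lambda>x. (\<lambda>e. fold (\<lambda>y b. ?F (fst e, y, b)) (fst (snd e)) (snd (snd e))) (x, (xs x, a x)))"
  proof (rule ptime_on_comp[where E = ?E])
    show "ptime_on ?E (\<lambda>e. fold (\<lambda>y b. ?F (fst e, y, b)) (fst (snd e)) (snd (snd e)))"
    proof (rule ptime_fold_core[OF step])
      show "poly_bounded ?E (\<lambda>e. B (fst e))"
        by (rule poly_bounded_comp[OF B]) (auto intro!: ptime_on_sz ptime_intros)
    qed (use bound in auto)
    show "ptime_on D (\<lambda>x. (x, (xs x, a x)))"
      by (intro ptime_intros xs a)
  qed auto
  then show ?thesis by simp
qed

text \<open>The increment \<open>B x\<close> depends on the input and not on the accumulator, so at
  most \<open>length (xs x)\<close> increments add up to a polynomial.\<close>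

lemma ptime_fold_add:
  fixes step :: "'x::enc \<Rightarrow> 'y::enc \<Rightarrow> 'a::enc \<Rightarrow> 'a"
  assumes step: "ptime (\<lambda>z. step (fst z) (fst (snd z)) (snd (snd z)))"
    and xs: "ptime_on D xs" and a: "ptime_on D a" and B: "poly_bounded D B"
    and bound: "\<And>x y b. x \<in> D \<Longrightarrow> y \<in> set (xs x) \<Longrightarrow> sz (step x y b) \<le> sz b + B x"
  shows "ptime_on D (\<lambda>x. fold (step x) (xs x) (a x))"
proof (rule ptime_fold[OF step xs a])
  show "poly_bounded D (\<lambda>x. sz (a x) + sz (xs x) * B x)"
    by (intro poly_bounded_intros ptime_on_sz xs a B)
  fix x k assume x: "x \<in> D" "k \<le> length (xs x)"
  have "sz (fold (step x) ys b) \<le> sz b + length ys * B x" if "set ys \<subseteq> set (xs x)" for ys b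
    using that
  proof (induction ys arbitrary: b)
    case (Cons y ys)
    have "sz (fold (step x) (y # ys) b) \<le> sz (step x y b) + length ys * B x" using Cons by simp
    also have "\<dots> \<le> sz b + B x + length ys * B x" using bound x(1) Cons by simp
    finally show ?case by simp
  qed simp
  from this[of "take k (xs x)" "a x"] have "sz (fold (step x) (take k (xs x)) (a x)) \<le> sz (a x) + k * B x"
    using set_take_subset[of k "xs x"] x by (simp add: min_absorb2)
  also have "\<dots> \<le> sz (a x) + sz (xs x) * B x"
    using x(2) length_less_sz[of "xs x"] by (intro add_left_mono mult_right_mono) auto
  finally show "sz (fold (step x) (take k (xs x)) (a x)) \<le> sz (a x) + sz (xs x) * B x" .
qed

text \<open>An element is no larger than the list that contains it, which bounds the results
  uniformly over all elements.\<close>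

lemma ptime_elem_bound:
  assumes f: "ptime (\<lambda>z. f (fst z) (snd z))" and xs: "ptime_on D xs"
  obtains B where "poly_bounded D B" "\<And>x y. x \<in> D \<Longrightarrow> y \<in> set (xs x) \<Longrightarrow> sz (f x y) \<le> B x"
proof -
  obtain q where q: "sz (f (fst z) (snd z)) \<le> poly q (sz z)" for z
    using ptime_on_sz[OF f] unfolding poly_bounded_def by blast
  show ?thesis
  proof (rule that)
    show "poly_bounded D (\<lambda>x. poly q (Suc (sz x + sz (xs x))))"
      by (intro poly_bounded_poly poly_bounded_intros ptime_on_sz xs)
    fix x y assume "x \<in> D" "y \<in> set (xs x)"
    then have le: "sz (x, y) \<le> Suc (sz x + sz (xs x))"
      using sz_mem_le[of y "xs x"] by simp
    show "sz (f x y) \<le> poly q (Suc (sz x + sz (xs x)))"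
      using order_trans[OF q[of "(x, y)"] poly_nat_mono[OF le]] by simp
  qed
qed

section \<open>Operations on lists and truth values\<close>

lemma sz_append: "sz (xs @ ys) + 1 = sz xs + sz ys"
  by (induction xs) auto

lemma ptime_comp2:
  assumes "ptime (\<lambda>z. f (fst z) (snd z))" "ptime_on D a" "ptime_on D b"
  shows "ptime_on D (\<lambda>x. f (a x) (b x))"
  using ptime_comp[OF assms(1) ptime_pair[OF assms(2,3)]] by simp

lemma ptime_Cons [ptime_intros]:
  assumes "ptime_on D f" "ptime_on D g"
  shows "ptime_on D (\<lambda>x. f x # g x)"
  by (rule ptime_on_cong[OF ptime_pair[OF assms]]) simp

lemma ptime_null [ptime_intros]:
  assumes "ptime_on D xs"
  shows "ptime_on D (\<lambda>x. xs x = [])"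
proof (rule ptime_comp[OF _ assms])
  show "ptime (\<lambda>xs :: 'b list. xs = [])"
  proof (rule ptime_expr[of "Sub (Const 1) (IsPair (Var 0))"])
    show "eval_expr (Sub (Const 1) (IsPair (Var 0))) s = enc (xs = [])" if "s 0 = enc xs" for s and xs :: "'b list"
      using that by (cases xs) (auto simp: enc_bool_def)
    show "poly_bounded UNIV (\<lambda>xs :: 'b list. sz (xs = []))"
      by (rule poly_bounded_mono[OF poly_bounded_const[of _ 2] sz_bool_le])
  qed
qed

text \<open>\<open>hd []\<close> is unspecified but a fixed value, which the program may contain as a constant.\<close>

lemma ptime_hd [ptime_intros]:
  assumes "ptime_on D xs"
  shows "ptime_on D (\<lambda>x. hd (xs x))"
proof (rule ptime_comp[OF _ assms])
  let ?k = "hd ([] :: 'b list)"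
  have "ptime (\<lambda>xs :: 'b list. if xs = [] then ?k else hd xs)"
  proof (rule ptime_onI)
    show "poly_bounded UNIV (\<lambda>xs :: 'b list. 2 + (sz xs + sz ?k))"
      by (intro poly_bounded_intros)
    show "runs (Cond (IsPair (Var 0)) (Assign 0 (Fst (Var 0))) (Assign 0 (expr_of_val (enc ?k)))) 1
      (\<lambda>xs :: 'b list. if xs = [] then ?k else hd xs) xs (2 + (sz xs + sz ?k))" for xs
      unfolding runs_def
    proof (intro allI impI execs_Cond)
      fix s :: state assume s: "s 0 = enc xs"
      show "vsize (eval_expr (IsPair (Var 0)) s) \<le> 2" by (simp add: of_bool_def)
      show "execs (Assign 0 (Fst (Var 0))) s (sz xs + sz ?k) (s(0 := enc (if xs = [] then ?k else hd xs)))"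
        if "eval_expr (IsPair (Var 0)) s \<noteq> Num 0"
        using s that by (cases xs) (auto intro!: execs_Assign)
      show "execs (Assign 0 (expr_of_val (enc ?k))) s (sz xs + sz ?k) (s(0 := enc (if xs = [] then ?k else hd xs)))"
        if "eval_expr (IsPair (Var 0)) s = Num 0"
        using s that by (cases xs) (auto intro!: execs_Assign simp: eval_expr_of_val)
    qed
  qed
  then show "ptime (hd :: 'b list \<Rightarrow> 'b)"
    by (rule ptime_on_cong) auto
qed

lemma ptime_tl [ptime_intros]:
  assumes "ptime_on D xs"
  shows "ptime_on D (\<lambda>x. tl (xs x))"
proof (rule ptime_comp[OF _ assms])
  show "ptime (tl :: 'b list \<Rightarrow> 'b list)"
  proof (rule ptime_expr[of "Snd (Var 0)"])
    show "eval_expr (Snd (Var 0)) s = enc (tl xs)" if "s 0 = enc xs" for s and xs :: "'b list"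
      using that by (cases xs) auto
    have "sz (tl xs) \<le> sz xs" for xs :: "'b list" by (cases xs) auto
    then show "poly_bounded UNIV (\<lambda>xs :: 'b list. sz (tl xs))"
      by (rule poly_bounded_mono[OF poly_bounded_sz])
  qed
qed

lemma ptime_case_list [ptime_intros]:
  assumes "ptime_on D xs" "ptime_on D a" "ptime_on D (\<lambda>x. b x (hd (xs x)) (tl (xs x)))"
  shows "ptime_on D (\<lambda>x. case xs x of [] \<Rightarrow> a x | y # ys \<Rightarrow> b x y ys)"
proof -
  have "ptime_on D (\<lambda>x. if xs x = [] then a x else b x (hd (xs x)) (tl (xs x)))"
    by (intro ptime_intros assms)
  then show ?thesis by (rule ptime_on_cong) (auto split: list.split)
qed

lemma ptime_case_prod [ptime_intros]:
  assumes "ptime_on D (\<lambda>x. f x (fst (p x)) (snd (p x)))"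
  shows "ptime_on D (\<lambda>x. case p x of (a, b) \<Rightarrow> f x a b)"
  using assms by (simp add: case_prod_beta)

lemma ptime_rev [ptime_intros]:
  assumes "ptime_on D xs"
  shows "ptime_on D (\<lambda>x. rev (xs x))"
proof -
  have "ptime_on D (\<lambda>x. fold (\<lambda>y b. y # b) (xs x) [])"
  proof (rule ptime_fold_add)
    show "poly_bounded D (\<lambda>x. Suc (sz (xs x)))"
      by (intro poly_bounded_intros ptime_on_sz assms)
    show "sz (y # b) \<le> sz b + Suc (sz (xs x))" if "y \<in> set (xs x)" for x y and b :: "'b list"
      using sz_mem_le[OF that] by simp
  qed (intro ptime_intros assms)+
  then show ?thesis by (simp add: fold_Cons_rev)
qed

lemma ptime_append [ptime_intros]:
  assumes "ptime_on D xs" "ptime_on D ys"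
  shows "ptime_on D (\<lambda>x. xs x @ ys x)"
proof -
  have "ptime_on D (\<lambda>x. fold (\<lambda>y b. y # b) (rev (xs x)) (ys x))"
  proof (rule ptime_fold_add)
    show "poly_bounded D (\<lambda>x. Suc (sz (xs x)))"
      by (intro poly_bounded_intros ptime_on_sz assms)
    show "sz (y # b) \<le> sz b + Suc (sz (xs x))" if "y \<in> set (rev (xs x))" for x y and b :: "'b list"
      using sz_mem_le[of y "xs x"] that by simp
  qed (intro ptime_intros assms)+
  then show ?thesis by (simp add: fold_Cons_rev)
qed

lemma fold_Cons_map: "fold (\<lambda>y b. f y # b) xs b = rev (map f xs) @ b"
  by (induction xs arbitrary: b) auto

lemma fold_Cons_filter: "fold (\<lambda>y b. if P y then y # b else b) xs b = rev (filter P xs) @ b"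
  by (induction xs arbitrary: b) auto

lemma ptime_map [ptime_intros]:
  assumes f: "ptime (\<lambda>z. f (fst z) (snd z))" and xs: "ptime_on D xs"
  shows "ptime_on D (\<lambda>x. map (f x) (xs x))"
proof -
  obtain B where B: "poly_bounded D B" "\<And>x y. x \<in> D \<Longrightarrow> y \<in> set (xs x) \<Longrightarrow> sz (f x y) \<le> B x"
    by (rule ptime_elem_bound[OF assms]) (rule that)
  have "ptime_on D (\<lambda>x. rev (fold (\<lambda>y b. f x y # b) (xs x) []))"
  proof (intro ptime_rev ptime_fold_add)
    show "ptime (\<lambda>z. f (fst z) (fst (snd z)) # snd (snd z))"
      by (intro ptime_intros ptime_comp2[OF f])
    show "poly_bounded D (\<lambda>x. Suc (B x))"
      by (intro poly_bounded_intros B(1))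
    show "sz (f x y # b) \<le> sz b + Suc (B x)" if "x \<in> D" "y \<in> set (xs x)" for x y b
      using B(2)[OF that] by simp
  qed (intro ptime_intros assms)+
  then show ?thesis by (simp add: fold_Cons_map)
qed

lemma ptime_filter [ptime_intros]:
  assumes f: "ptime (\<lambda>z. P (fst z) (snd z))" and xs: "ptime_on D xs"
  shows "ptime_on D (\<lambda>x. filter (P x) (xs x))"
proof -
  have "ptime_on D (\<lambda>x. rev (fold (\<lambda>y b. if P x y then y # b else b) (xs x) []))"
  proof (intro ptime_rev ptime_fold_add)
    show "ptime (\<lambda>z. if P (fst z) (fst (snd z)) then fst (snd z) # snd (snd z) else snd (snd z))"
      by (intro ptime_intros ptime_comp2[OF f])
    show "poly_bounded D (\<lambda>x. Suc (sz (xs x)))"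
      by (intro poly_bounded_intros ptime_on_sz assms)
    show "sz (if P x y then y # b else b) \<le> sz b + Suc (sz (xs x))" if "y \<in> set (xs x)" for x y b
      using sz_mem_le[OF that] by simp
  qed (intro ptime_intros assms)+
  then show ?thesis by (simp add: fold_Cons_filter)
qed

lemma ptime_concat [ptime_intros]:
  assumes "ptime_on D xs"
  shows "ptime_on D (\<lambda>x. concat (xs x))"
proof -
  have eq: "fold (\<lambda>y b. y @ b) xs b = concat (rev xs) @ b" for xs and b :: "'b list"
    by (induction xs arbitrary: b) auto
  have "ptime_on D (\<lambda>x. fold (\<lambda>y b. y @ b) (rev (xs x)) [])"
  proof (rule ptime_fold_add)
    show "poly_bounded D (\<lambda>x. sz (xs x))"
      by (intro poly_bounded_intros ptime_on_sz assms)
    show "sz (y @ b) \<le> sz b + sz (xs x)" if "y \<in> set (rev (xs x))" for x y and b :: "'b list"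
      using sz_mem_le[of y "xs x"] that sz_append[of y b] by simp
  qed (intro ptime_intros assms)+
  then show ?thesis by (simp add: eq)
qed

lemma ptime_conj [ptime_intros]:
  assumes "ptime_on D a" "ptime_on D b"
  shows "ptime_on D (\<lambda>x. a x \<and> b x)"
  by (rule ptime_on_cong[OF ptime_if[OF assms(1) assms(2) ptime_const[of _ False]]]) simp

lemma ptime_not [ptime_intros]:
  assumes "ptime_on D a"
  shows "ptime_on D (\<lambda>x. \<not> a x)"
  by (rule ptime_on_cong[OF ptime_if[OF assms ptime_const[of _ False] ptime_const[of _ True]]]) simp

lemma ptime_disj [ptime_intros]:
  assumes "ptime_on D a" "ptime_on D b"
  shows "ptime_on D (\<lambda>x. a x \<or> b x)"
  by (rule ptime_on_cong[OF ptime_if[OF assms(1) ptime_const[of _ True] assms(2)]]) simp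

lemma ptime_eq_bool [ptime_intros]:
  assumes "ptime_on D a" "ptime_on D b"
  shows "ptime_on D (\<lambda>x. a x = (b x :: bool))"
  by (rule ptime_on_cong[OF ptime_if[OF assms ptime_not[OF assms(2)]]]) simp

lemma ptime_list_all [ptime_intros]:
  assumes "ptime (\<lambda>z. P (fst z) (snd z))" "ptime_on D xs"
  shows "ptime_on D (\<lambda>x. \<forall>y\<in>set (xs x). P x y)"
proof -
  have "ptime_on D (\<lambda>x. filter (\<lambda>y. \<not> P x y) (xs x) = [])"
    by (intro ptime_intros assms)
  then show ?thesis by (simp add: filter_empty_conv)
qed

lemma ptime_list_ex [ptime_intros]:
  assumes "ptime (\<lambda>z. P (fst z) (snd z))" "ptime_on D xs"
  shows "ptime_on D (\<lambda>x. \<exists>y\<in>set (xs x). P x y)"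
proof -
  have "ptime_on D (\<lambda>x. \<not> (\<forall>y\<in>set (xs x). \<not> P x y))"
    by (intro ptime_intros assms)
  then show ?thesis by simp
qed

subsection \<open>Arithmetic\<close>

instantiation int :: enc
begin

definition enc_int :: "int \<Rightarrow> val" where
  "enc_int i = Num i"

instance ..

end

instantiation nat :: enc
begin

definition enc_nat :: "nat \<Rightarrow> val" where
  "enc_nat n = Num (int n)"

instance ..

end

instantiation unit :: enc
begin

definition enc_unit :: "unit \<Rightarrow> val" where
  "enc_unit u = Num 0"

instance ..

end

lemma sz_int_le_iff: "sz (i :: int) \<le> Suc k \<longleftrightarrow> \<bar>i\<bar> < 2 ^ k"
  by (simp add: enc_int_def floorlog_le_iff nat_less_iff)

lemma abs_less_sz: "\<bar>i :: int\<bar> < 2 ^ (sz i - 1)"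
  using sz_int_le_iff[of i "sz i - 1"] vsize_ge_1[of "enc i"] by simp

lemma sz_int_mono: "\<bar>i :: int\<bar> \<le> \<bar>j\<bar> \<Longrightarrow> sz i \<le> sz j"
  using abs_less_sz[of j] sz_int_le_iff[of i "sz j - 1"] vsize_ge_1[of "enc j"] by simp

lemma sz_uminus [simp]: "sz (- i :: int) = sz i"
  by (simp add: enc_int_def)

lemma sz_add_le: "sz (i + j :: int) \<le> sz i + sz j"
proof -
  obtain a b where ab: "sz i = Suc a" "sz j = Suc b"
    using vsize_ge_1[of "enc i"] vsize_ge_1[of "enc j"] by (metis Suc_le_D One_nat_def)
  have "\<bar>i\<bar> < 2 ^ a" "\<bar>j\<bar> < 2 ^ b"
    using abs_less_sz[of i] abs_less_sz[of j] ab by auto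
  moreover have "(2::int) ^ a \<le> 2 ^ (a + b)" "(2::int) ^ b \<le> 2 ^ (a + b)"
    by (intro power_increasing; simp)+
  ultimately have "\<bar>i + j\<bar> < 2 * 2 ^ (a + b)" by linarith
  then have "sz (i + j) \<le> Suc (Suc (a + b))"
    by (subst sz_int_le_iff) simp
  then show ?thesis using ab by simp
qed

lemma sz_mult_le: "sz (i * j :: int) \<le> sz i + sz j"
proof -
  obtain a b where ab: "sz i = Suc a" "sz j = Suc b"
    using vsize_ge_1[of "enc i"] vsize_ge_1[of "enc j"] by (metis Suc_le_D One_nat_def)
  have "\<bar>i\<bar> < 2 ^ a" "\<bar>j\<bar> < 2 ^ b"
    using abs_less_sz[of i] abs_less_sz[of j] ab by auto
  then have "\<bar>i * j\<bar> < 2 ^ (a + b)"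
    by (simp add: abs_mult power_add mult_strict_mono)
  then have "sz (i * j) \<le> Suc (a + b)"
    by (subst sz_int_le_iff)
  then show ?thesis using ab by simp
qed

lemma abs_int_div_le: "\<bar>i div j :: int\<bar> \<le> \<bar>i\<bar>"
proof -
  have *: "\<bar>i div j\<bar> \<le> \<bar>i\<bar>" if "0 < j" for i j :: int
  proof -
    let ?q = "i div j"
    have q: "?q * j \<le> i" "i < (?q + 1) * j"
      using div_mult_mod_eq[of i j] pos_mod_bound[OF that, of i] pos_mod_sign[OF that, of i]
      by (simp_all only: distrib_right mult_1)
    show ?thesis
    proof (cases "0 \<le> ?q")
      case True
      then have "?q * 1 \<le> ?q * j" using that by (intro mult_left_mono) auto
      with q True show ?thesis by linarith
    next
      case False
      then have "(?q + 1) * j \<le> (?q + 1) * 1" using that by (intro mult_left_mono_neg) auto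
      with q(2) have "i < ?q + 1" by simp
      with False show ?thesis by linarith
    qed
  qed
  show ?thesis
    using *[of j i] *[of "- j" "- i"] by (cases j "0 :: int" rule: linorder_cases) auto
qed

lemma sz_div_le: "sz (i div j :: int) \<le> sz i"
  by (rule sz_int_mono[OF abs_int_div_le])

lemma poly_bounded_pair_UNIV:
  "poly_bounded UNIV (\<lambda>z. sz (fst z) + sz (snd z))"
  by (rule poly_bounded_mono[OF poly_bounded_sz]) (simp add: enc_prod_eq)

lemma ptime_int_add [ptime_intros]:
  assumes "ptime_on D f" "ptime_on D g"
  shows "ptime_on D (\<lambda>x. f x + g x :: int)"
proof -
  have "ptime (\<lambda>z. fst z + snd z :: int)"
    by (rule ptime_expr[of "Add (Fst (Var 0)) (Snd (Var 0))"],
        simp add: enc_prod_eq enc_int_def,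
        rule poly_bounded_mono[OF poly_bounded_pair_UNIV sz_add_le])
  from ptime_comp[OF this ptime_pair[OF assms]] show ?thesis by simp
qed

lemma ptime_int_diff [ptime_intros]:
  assumes "ptime_on D f" "ptime_on D g"
  shows "ptime_on D (\<lambda>x. f x - g x :: int)"
proof -
  have "sz (i - j) \<le> sz i + sz j" for i j :: int
    using sz_add_le[of i "- j"] by simp
  then have "ptime (\<lambda>z. fst z - snd z :: int)"
    by (intro ptime_expr[of "Sub (Fst (Var 0)) (Snd (Var 0))"],
        simp add: enc_prod_eq enc_int_def)
       (rule poly_bounded_mono[OF poly_bounded_pair_UNIV])
  from ptime_comp[OF this ptime_pair[OF assms]] show ?thesis by simp
qed

lemma ptime_int_uminus [ptime_intros]:
  assumes "ptime_on D f"
  shows "ptime_on D (\<lambda>x. - f x :: int)"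
  using ptime_int_diff[OF ptime_const[of _ 0] assms] by simp

lemma ptime_int_mult [ptime_intros]:
  assumes "ptime_on D f" "ptime_on D g"
  shows "ptime_on D (\<lambda>x. f x * g x :: int)"
proof -
  have "ptime (\<lambda>z. fst z * snd z :: int)"
    by (rule ptime_expr[of "Mul (Fst (Var 0)) (Snd (Var 0))"],
        simp add: enc_prod_eq enc_int_def,
        rule poly_bounded_mono[OF poly_bounded_pair_UNIV sz_mult_le])
  from ptime_comp[OF this ptime_pair[OF assms]] show ?thesis by simp
qed

lemma ptime_int_div [ptime_intros]:
  assumes "ptime_on D f" "ptime_on D g"
  shows "ptime_on D (\<lambda>x. f x div g x :: int)"
proof -
  have "ptime (\<lambda>z. fst z div snd z :: int)"
    by (rule ptime_expr[of "Div (Fst (Var 0)) (Snd (Var 0))"],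
        simp add: enc_prod_eq enc_int_def,
        rule poly_bounded_mono[OF poly_bounded_pair_UNIV trans_le_add1[OF sz_div_le]])
  from ptime_comp[OF this ptime_pair[OF assms]] show ?thesis by simp
qed

lemma ptime_int_less [ptime_intros]:
  assumes "ptime_on D f" "ptime_on D g"
  shows "ptime_on D (\<lambda>x. f x < (g x :: int))"
proof -
  have "ptime (\<lambda>z. fst z < (snd z :: int))"
    by (rule ptime_expr[of "Less (Fst (Var 0)) (Snd (Var 0))"],
        simp add: enc_prod_eq enc_int_def enc_bool_def,
        rule poly_bounded_mono[OF poly_bounded_const[of _ 2] sz_bool_le])
  from ptime_comp[OF this ptime_pair[OF assms]] show ?thesis by simp
qed

lemma ptime_int_le [ptime_intros]:
  assumes "ptime_on D f" "ptime_on D g"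
  shows "ptime_on D (\<lambda>x. f x \<le> (g x :: int))"
  using ptime_not[OF ptime_int_less[OF assms(2,1)]] by (simp add: not_less)

lemma ptime_int_eq [ptime_intros]:
  assumes "ptime_on D f" "ptime_on D g"
  shows "ptime_on D (\<lambda>x. f x = (g x :: int))"
  using ptime_conj[OF ptime_int_le[OF assms] ptime_int_le[OF assms(2,1)]] by (simp add: eq_iff)

lemma ptime_of_nat [ptime_intros]:
  assumes "ptime_on D f"
  shows "ptime_on D (\<lambda>x. int (f x))"
  by (rule ptime_on_cong[OF assms]) (simp add: enc_int_def enc_nat_def)

lemma ptime_of_nat_iff: "ptime_on D (\<lambda>x. int (f x)) \<longleftrightarrow> ptime_on D f"
  by (auto intro: ptime_on_cong simp: enc_int_def enc_nat_def)

lemma ptime_nat_eq [ptime_intros]: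
  assumes "ptime_on D f" "ptime_on D g"
  shows "ptime_on D (\<lambda>x. f x = (g x :: nat))"
  using ptime_int_eq[OF ptime_of_nat[OF assms(1)] ptime_of_nat[OF assms(2)]] by simp

lemma ptime_nat_less [ptime_intros]:
  assumes "ptime_on D f" "ptime_on D g"
  shows "ptime_on D (\<lambda>x. f x < (g x :: nat))"
  using ptime_int_less[OF ptime_of_nat[OF assms(1)] ptime_of_nat[OF assms(2)]] by simp

lemma ptime_Suc [ptime_intros]:
  assumes "ptime_on D f"
  shows "ptime_on D (\<lambda>x. Suc (f x))"
  using ptime_int_add[OF ptime_of_nat[OF assms] ptime_const[of _ 1]]
  by (subst ptime_of_nat_iff[symmetric]) (simp add: add.commute)

lemma ptime_sum_list [ptime_intros]:
  assumes "ptime_on D xs"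
  shows "ptime_on D (\<lambda>x. sum_list (xs x) :: int)"
proof -
  have eq: "fold (\<lambda>y b. y + b) xs b = sum_list xs + b" for xs and b :: int
    by (induction xs arbitrary: b) auto
  have "ptime_on D (\<lambda>x. fold (\<lambda>y b. y + b) (xs x) 0)"
  proof (rule ptime_fold_add)
    show "poly_bounded D (\<lambda>x. sz (xs x))"
      by (intro poly_bounded_intros ptime_on_sz assms)
    show "sz (y + b) \<le> sz b + sz (xs x)" if "y \<in> set (xs x)" for x and y b :: int
      using sz_mem_le[OF that] sz_add_le[of y b] by linarith
  qed (intro ptime_intros assms)+
  then show ?thesis by (simp add: eq)
qed

lemma ptime_length [ptime_intros]:
  assumes "ptime_on D xs"
  shows "ptime_on D (\<lambda>x. length (xs x))"
proof (subst ptime_of_nat_iff[symmetric])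
  have "ptime_on D (\<lambda>x. sum_list (map (\<lambda>_. 1 :: int) (xs x)))"
    by (intro ptime_intros assms)
  then show "ptime_on D (\<lambda>x. int (length (xs x)))" by (simp add: sum_list_triv)
qed

lemma ptime_comp3:
  assumes "ptime (\<lambda>z. f (fst z) (fst (snd z)) (snd (snd z)))" "ptime_on D a" "ptime_on D b" "ptime_on D c"
  shows "ptime_on D (\<lambda>x. f (a x) (b x) (c x))"
  using ptime_comp[OF assms(1) ptime_pair[OF assms(2) ptime_pair[OF assms(3,4)]]] by simp

subsection \<open>Lists\<close>

lemma sz_nat_le: "sz (n :: nat) \<le> Suc n"
proof -
  have "sz (int n) \<le> Suc n" by (subst sz_int_le_iff) simp
  then show ?thesis by (simp add: enc_int_def enc_nat_def)
qed

text \<open>Out of range, \<open>nth\<close> is an unspecified function of the index, for which no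
  running time could be shown; a default value takes its place.\<close>

definition lookup :: "'a \<Rightarrow> 'a list \<Rightarrow> nat \<Rightarrow> 'a" where
  "lookup d xs i = (if i < length xs then xs ! i else d)"

text \<open>The counter decreases with every element, and an element is taken when it reads 0.
  Starting negative or beyond the list, it never reads 0 at an element, and the default
  survives.\<close>

lemma fold_lookup:
  "fold (\<lambda>y z. (fst z - 1, if fst z = 0 then y else snd z)) xs (j, d)
    = (j - int (length xs), if 0 \<le> j \<and> nat j < length xs then xs ! nat j else d)"
proof (induction xs arbitrary: j d)
  case (Cons x xs)
  have "nat j = Suc (nat (j - 1))" if "0 < j" using that by simp
  then show ?case using Cons[of "j - 1"] by (auto simp: less_Suc_eq_le nth_Cons')
qed simp

lemma ptime_lookup [ptime_intros]:
  assumes "ptime_on D d" "ptime_on D xs" "ptime_on D i"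
  shows "ptime_on D (\<lambda>x. lookup (d x) (xs x) (i x))"
proof -
  have "ptime_on D (\<lambda>x. snd (fold (\<lambda>y z. (fst z - 1, if fst z = 0 then y else snd z)) (xs x) (int (i x), d x)))"
  proof (intro ptime_snd ptime_fold_add)
    show "poly_bounded D (\<lambda>x. 2 + sz (xs x))"
      by (intro poly_bounded_intros ptime_on_sz assms)
    show "sz (fst z - 1 :: int, if fst z = 0 then y else snd z) \<le> sz z + (2 + sz (xs x))" if "y \<in> set (xs x)" for x y z
      using sz_mem_le[OF that] sz_add_le[of "fst z" "- 1"]
      by (cases z) (simp add: enc_int_def)
  qed (intro ptime_intros assms)+
  then show ?thesis by (simp add: fold_lookup lookup_def cong: if_cong)
qed

lemma sz_rev_upt_le: "sz (rev [0..<k]) \<le> 1 + k * (k + 2)"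
proof (induction k)
  case (Suc k)
  then show ?case using sz_nat_le[of k] by simp
qed simp

lemma fold_upt: "fold (\<lambda>_ z. (Suc (fst z), fst z # snd z)) xs (0, []) = (length xs, rev [0..<length xs])"
  by (induction xs rule: rev_induct) auto

text \<open>The upper end is the length of a list: for a number given in binary, the interval could
  be exponentially long.\<close>

lemma ptime_upt [ptime_intros]:
  assumes "ptime_on D xs"
  shows "ptime_on D (\<lambda>x. [0..<length (xs x)])"
proof -
  have "ptime_on D (\<lambda>x. rev (snd (fold (\<lambda>_ z. (Suc (fst z), fst z # snd z)) (xs x) (0, []))))"
  proof (intro ptime_rev ptime_snd ptime_fold)
    show "poly_bounded D (\<lambda>x. (3 + sz (xs x)) + sz (xs x) * (sz (xs x) + 2))"
      by (intro poly_bounded_intros ptime_on_sz assms)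
    fix x k assume "k \<le> length (xs x)"
    then have *: "k \<le> sz (xs x)" "length (take k (xs x)) = k"
      using length_less_sz[of "xs x"] by auto
    have "sz (k, rev [0..<k]) \<le> 3 + k + k * (k + 2)"
      using sz_rev_upt_le[of k] sz_nat_le[of k] by simp
    also have "\<dots> \<le> (3 + sz (xs x)) + sz (xs x) * (sz (xs x) + 2)"
      using * by (intro add_mono mult_mono) auto
    finally show "sz (fold (\<lambda>_ z. (Suc (fst z), fst z # snd z)) (take k (xs x)) (0, []))
      \<le> (3 + sz (xs x)) + sz (xs x) * (sz (xs x) + 2)"
      by (simp only: fold_upt *)
  qed (intro ptime_intros assms)+
  then show ?thesis by (simp add: fold_upt)
qed

definition argmin :: "('a \<Rightarrow> int) \<Rightarrow> 'a list \<Rightarrow> 'a" where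
  "argmin f xs = fold (\<lambda>y b. if f y < f b then y else b) (tl xs) (hd xs)"

lemma argmin_fold:
  "(let r = fold (\<lambda>y b. if f y < f b then y else b) ys a :: 'a in
     r \<in> insert a (set ys) \<and> (\<forall>y\<in>insert a (set ys). (f r :: int) \<le> f y))"
proof (induction ys arbitrary: a)
  case (Cons y ys)
  then show ?case using Cons[of "if f y < f a then y else a"]
    by (fastforce simp: Let_def split: if_splits)
qed simp

lemma argmin_in: "xs \<noteq> [] \<Longrightarrow> argmin f xs \<in> set xs"
  and argmin_le: "y \<in> set xs \<Longrightarrow> f (argmin f xs) \<le> f y"
  using argmin_fold[of f "tl xs" "hd xs"] by (cases xs; auto simp: argmin_def Let_def)+

lemma sz_argmin_le: "sz (argmin f xs) \<le> sz xs + sz (hd [] :: 'a::enc)" for xs :: "'a::enc list"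
  using argmin_in[of xs f] sz_mem_le[of "argmin f xs" xs]
  by (cases "xs = []") (auto simp: argmin_def)

lemma ptime_argmin [ptime_intros]:
  assumes f: "ptime (\<lambda>z. f (fst z) (snd z))" and xs: "ptime_on D xs"
  shows "ptime_on D (\<lambda>x. argmin (f x) (xs x))"
  unfolding argmin_def
proof (rule ptime_fold_add)
  show "ptime (\<lambda>z. if f (fst z) (fst (snd z)) < f (fst z) (snd (snd z)) then fst (snd z) else snd (snd z))"
    by (intro ptime_intros ptime_comp2[OF f])
  show "poly_bounded D (\<lambda>x. sz (tl (xs x)))"
    by (intro poly_bounded_intros ptime_on_sz ptime_intros assms)
  show "sz (if f x y < f x b then y else b) \<le> sz b + sz (tl (xs x))" if "y \<in> set (tl (xs x))" for x y b
    using sz_mem_le[OF that] by simp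
qed (intro ptime_intros xs)+

section \<open>Approximate solution of the assignment problem\<close>

type_synonym point = "nat \<times> nat"
type_synonym edge = "point \<times> nat"
type_synonym constr = "nat \<times> nat \<times> int \<times> int"

text \<open>
  An edge \<open>((p, g), c)\<close> assigns the point \<open>p\<close> of color \<open>g\<close> to the center \<open>c\<close>. The constraint
  \<open>(c, h, a, b)\<close> demands that \<open>a\<close> times the number of points of color \<open>h\<close> at \<open>c\<close> plus \<open>b\<close> times the
  number of other points at \<open>c\<close> be nonpositive.
\<close>

definition weight :: "constr \<Rightarrow> edge \<Rightarrow> int" where
  "weight i e = (case i of (c, h, a, b) \<Rightarrow> if snd e = c then if snd (fst e) = h then a else b else 0)"

definition viol :: "edge list \<Rightarrow> constr \<Rightarrow> int" where
  "viol S i = (let s = sum_list (map (weight i) S) in if s < 0 then 0 else s)"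

text \<open>The score weighted by violations is a sum over the points, so the best center can be
  chosen for each point separately. The weights are, up to a factor 2, the gradient of the sum of
  squared violations; this is a linear minimization step as in the Frank-Wolfe method.\<close>

definition best_edges :: "constr list \<Rightarrow> edge list \<Rightarrow> (point \<times> nat list) list \<Rightarrow> edge list" where
  "best_edges W S Q =
     map (\<lambda>z. (fst z, argmin (\<lambda>c. sum_list (map (\<lambda>i. viol S i * weight i (fst z, c)) W)) (snd z))) Q"

text \<open>Each round prepends one complete assignment. The list represents the fractional
  assignment that gives every edge its multiplicity divided by \<open>length D\<close>.\<close>

definition average :: "constr list \<Rightarrow> (point \<times> nat list) list \<Rightarrow> unit list \<Rightarrow> edge list" where
  "average W Q D = fold (\<lambda>_ S. best_edges W S Q @ S) D []"

lemma ptime_weight [ptime_intros]: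
  assumes "ptime_on D i" "ptime_on D e"
  shows "ptime_on D (\<lambda>x. weight (i x) (e x))"
  unfolding weight_def by (intro ptime_intros assms)

lemma ptime_viol [ptime_intros]:
  assumes "ptime_on D i" "ptime_on D e"
  shows "ptime_on D (\<lambda>x. viol (i x) (e x))"
proof -
  have "ptime (\<lambda>z. viol (fst z) (snd z))"
    unfolding viol_def Let_def by (intro ptime_intros)
  then show ?thesis by (rule ptime_comp2) fact+
qed

lemma ptime_best_edges:
  assumes "ptime_on D W" "ptime_on D S" "ptime_on D Q"
  shows "ptime_on D (\<lambda>x. best_edges (W x) (S x) (Q x))"
proof -
  have "ptime (\<lambda>z. best_edges (fst z) (fst (snd z)) (snd (snd z)))"
    unfolding best_edges_def by (intro ptime_intros)
  then show ?thesis by (rule ptime_comp3) fact+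
qed

text \<open>The bound does not mention \<open>S\<close>, so \<open>average\<close> grows by a fixed
  amount per round. The summand for \<open>hd []\<close> covers a point without candidate
  centers.\<close>

lemma sz_best_edges_le: "sz (best_edges W S Q) \<le> sz Q * (3 + sz (hd [] :: nat))"
proof (induction Q)
  case (Cons z Q)
  then show ?case
    using sz_argmin_le[of "(\<lambda>c. sum_list (map (\<lambda>i. viol S i * weight i (fst z, c)) W))" "snd z"]
    by (cases z) (simp add: best_edges_def algebra_simps)
qed (simp add: best_edges_def)

lemma ptime_average [ptime_intros]:
  assumes "ptime_on D W" "ptime_on D Q" "ptime_on D T"
  shows "ptime_on D (\<lambda>x. average (W x) (Q x) (T x))"
proof -
  have "ptime (\<lambda>x. average (fst x) (fst (snd x)) (snd (snd x)))"
    unfolding average_def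
  proof (rule ptime_fold_add)
    show "poly_bounded UNIV (\<lambda>x. sz (fst (snd x) :: (point \<times> nat list) list) * (3 + sz (hd [] :: nat)))"
      by (intro poly_bounded_intros ptime_on_sz ptime_intros)
    show "sz (best_edges (fst x) b (fst (snd x)) @ b) \<le> sz b + sz (fst (snd x)) * (3 + sz (hd [] :: nat))" for x b
      using sz_append[of "best_edges (fst x) b (fst (snd x))" b] sz_best_edges_le[of "fst x" b "fst (snd x)"]
      by simp
  qed (intro ptime_intros ptime_best_edges)+
  then show ?thesis by (rule ptime_comp3) fact+
qed

section \<open>Halving a multiset of edges\<close>

text \<open>
  Edges join point nodes to nodes that stand for a color at a center. In a trail from \<open>v\<close> to \<open>w\<close> each
  edge has sign 1 if it is traversed from the point to the center, and -1 otherwise; the edges of sign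
  1 are kept. Signs are integers, as negation must not change the size of their encoding. A key
  matches a single node if its first component is set, and otherwise all nodes of a center.
\<close>

type_synonym node = "bool \<times> nat \<times> nat"
type_synonym key = "bool \<times> node"
type_synonym trail = "node \<times> node \<times> (edge \<times> int) list"

definition left :: "edge \<Rightarrow> node" where
  "left e = (True, fst e)"

definition right :: "edge \<Rightarrow> node" where
  "right e = (False, snd e, snd (fst e))"

definition hits :: "key \<Rightarrow> node \<Rightarrow> bool" where
  "hits k v \<longleftrightarrow> fst v = fst (snd k) \<and> fst (snd v) = fst (snd (snd k)) \<and>
     (\<not> fst k \<or> snd (snd v) = snd (snd (snd k)))"

definition flip :: "trail \<Rightarrow> trail" where
  "flip r = (fst (snd r), fst r, map (\<lambda>x. (fst x, - snd x)) (snd (snd r)))"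

definition join :: "trail \<Rightarrow> trail \<Rightarrow> trail" where
  "join r r' = (fst r, fst (snd r'), snd (snd r) @ snd (snd r'))"

text \<open>The state consists of at most one trail waiting for a partner and of the finished
  trails. Trails with exactly one end at \<open>k\<close> are paired: the waiting one is turned to
  end at \<open>k\<close>, the new one to start there. Trails with both ends or no end at
  \<open>k\<close> pass unchanged.\<close>

definition link_step :: "key \<Rightarrow> trail \<Rightarrow> trail list \<times> trail list \<Rightarrow> trail list \<times> trail list" where
  "link_step k r z =
    (if hits k (fst r) = hits k (fst (snd r)) then (fst z, r # snd z)
     else case fst z of
       [] \<Rightarrow> ([r], snd z)
     | r' # _ \<Rightarrow> ([], join (if hits k (fst (snd r')) then r' else flip r')
                          (if hits k (fst r) then r else flip r) # snd z))"

definition link :: "key \<Rightarrow> trail list \<Rightarrow> trail list" where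
  "link k R = (case fold (link_step k) R ([], []) of (pend, out) \<Rightarrow> pend @ out)"

text \<open>
  Single nodes come before centers: a link at a center may join two colors, which would destroy the
  balance of trails (\<open>exact\<close> below) at a color not yet processed.
\<close>

definition keys :: "edge list \<Rightarrow> key list" where
  "keys S = map (\<lambda>e. (True, left e)) S @ map (\<lambda>e. (True, right e)) S @ map (\<lambda>e. (False, right e)) S"

definition trails :: "edge list \<Rightarrow> trail list" where
  "trails S = fold link (keys S) (map (\<lambda>e. (left e, right e, [(e, 1)])) S)"

definition halve :: "edge list \<Rightarrow> edge list" where
  "halve S = map fst (filter (\<lambda>x. snd x = 1) (concat (map (\<lambda>r. snd (snd r)) (trails S))))"

text \<open>Linking uses every trail once and only flips and joins, so a measure that ignores
  orientation and is subadditive under joining cannot grow in total. The general codomain serves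
  imbalances, sizes of encodings and sums over edges alike.\<close>

lemma link_sum_le:
  fixes \<mu> :: "trail \<Rightarrow> 'a::ordered_comm_monoid_add"
  assumes "\<And>r. \<mu> (flip r) = \<mu> r" "\<And>r r'. \<mu> (join r r') \<le> \<mu> r + \<mu> r'"
  shows "sum_list (map \<mu> (link k R)) \<le> sum_list (map \<mu> R)"
proof -
  let ?s = "\<lambda>R. sum_list (map \<mu> R)"
  have step: "length (fst (link_step k r z)) \<le> 1 \<and>
     ?s (fst (link_step k r z)) + ?s (snd (link_step k r z)) \<le> ?s (fst z) + ?s (snd z) + \<mu> r"
    if "length (fst z) \<le> 1" for r z
  proof -
    obtain p out where z: "z = (p, out)" by (cases z)
    then consider "p = []" | r' where "p = [r']"
      using \<open>length (fst z) \<le> 1\<close> by (cases p) auto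
    then show ?thesis
    proof cases
      case 1
      then show ?thesis by (simp add: z link_step_def algebra_simps)
    next
      case 2
      let ?a = "if hits k (fst (snd r')) then r' else flip r'"
      let ?b = "if hits k (fst r) then r else flip r"
      have "\<mu> (join ?a ?b) \<le> \<mu> ?a + \<mu> ?b" by (rule assms(2))
      also have "\<dots> = \<mu> r' + \<mu> r" by (simp add: assms(1))
      finally have "\<mu> (join ?a ?b) + ?s out \<le> \<mu> r' + \<mu> r + ?s out" by (rule add_right_mono)
      then show ?thesis using 2 by (auto simp add: z link_step_def algebra_simps)
    qed
  qed
  have "?s (fst (fold (link_step k) R z)) + ?s (snd (fold (link_step k) R z)) \<le> ?s (fst z) + ?s (snd z) + ?s R"
    if "length (fst z) \<le> 1" for z
    using that
  proof (induction R arbitrary: z)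
    case (Cons r R)
    let ?z = "link_step k r z"
    have "?s (fst (fold (link_step k) R ?z)) + ?s (snd (fold (link_step k) R ?z)) \<le> ?s (fst ?z) + ?s (snd ?z) + ?s R"
      using step[OF Cons.prems, of r] by (intro Cons.IH) auto
    also have "\<dots> \<le> ?s (fst z) + ?s (snd z) + \<mu> r + ?s R"
      using step[OF Cons.prems, of r] by (intro add_right_mono) auto
    finally show ?case by (simp add: add.assoc)
  qed simp
  from this[of "([], [])"] show ?thesis
    by (simp add: link_def case_prod_beta)
qed

text \<open>Joining hides two ends at \<open>k\<close> and leaves two ends elsewhere. Hence only a
  trail still waiting can have exactly one end at \<open>k\<close>, which is the second
  claim.\<close>

lemma link_preserves:
  assumes "\<And>r. P r \<Longrightarrow> P (flip r)"
    and "\<And>r r'. P r \<Longrightarrow> P r' \<Longrightarrow> hits k (fst (snd r)) \<Longrightarrow> hits k (fst r') \<Longrightarrow> P (join r r')"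
    and "\<forall>r\<in>set R. P r"
  shows "\<forall>r\<in>set (link k R). P r"
    and "length (filter (\<lambda>r. hits k (fst r) \<noteq> hits k (fst (snd r))) (link k R)) \<le> 1"
proof -
  let ?h = "\<lambda>r. hits k (fst r) \<noteq> hits k (fst (snd r))"
  let ?I = "\<lambda>z :: trail list \<times> trail list. length (fst z) \<le> 1 \<and> (\<forall>r\<in>set (fst z). P r \<and> ?h r) \<and>
     (\<forall>r\<in>set (snd z). P r \<and> \<not> ?h r)"
  have step: "?I (link_step k r z)" if "?I z" "P r" for r z
  proof -
    obtain p out where z: "z = (p, out)" by (cases z)
    then consider "p = []" | r' where "p = [r']"
      using \<open>?I z\<close> by (cases p) auto
    then show ?thesis
    proof cases
      case 1
      then show ?thesis using that by (auto simp: z link_step_def)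
    next
      case 2
      let ?a = "if hits k (fst (snd r')) then r' else flip r'"
      let ?b = "if hits k (fst r) then r else flip r"
      have r': "P r'" "?h r'" using that 2 by (auto simp: z)
      then have a: "P ?a" "hits k (fst (snd ?a))" "\<not> hits k (fst ?a)" using assms(1)[of r'] by (auto simp: flip_def)
      have b: "P ?b" "hits k (fst ?b)" "\<not> hits k (fst (snd ?b))" if "?h r"
        using that \<open>P r\<close> assms(1)[of r] by (auto simp: flip_def)
      have "P (join ?a ?b) \<and> \<not> ?h (join ?a ?b)" if "?h r"
        using assms(2)[OF a(1) b(1)[OF that] a(2) b(2)[OF that]] a(3) b(3)[OF that]
        by (simp add: join_def)
      moreover have "link_step k r z = (if ?h r then ([], join ?a ?b # out) else (p, r # out))"
        using 2 by (auto simp: z link_step_def)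
      ultimately show ?thesis using \<open>?I z\<close> \<open>P r\<close> by (auto simp: z)
    qed
  qed
  have fold: "?I z \<Longrightarrow> \<forall>r\<in>set R. P r \<Longrightarrow> ?I (fold (link_step k) R z)" for z R
  proof (induction R arbitrary: z)
    case (Cons r R)
    have "?I (link_step k r z)"
      by (rule step[OF Cons.prems(1)]) (simp add: Cons.prems(2))
    moreover have "\<forall>r\<in>set R. P r" using Cons.prems(2) by simp
    ultimately have "?I (fold (link_step k) R (link_step k r z))" by (rule Cons.IH)
    then show ?case unfolding fold_simps .
  qed simp
  have "?I (fold (link_step k) R ([], []))" by (rule fold[OF _ assms(3)]) simp
  then obtain p out where z: "fold (link_step k) R ([], []) = (p, out)" "?I (p, out)"
    by (metis surj_pair)
  then show "\<forall>r\<in>set (link k R). P r" by (auto simp: link_def)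
  have "filter ?h out = []" using z(2) by (simp add: filter_empty_conv)
  moreover have "length (filter ?h p) \<le> 1" using z(2) length_filter_le[of ?h p] by simp
  ultimately show "length (filter ?h (link k R)) \<le> 1" using z(1) by (simp add: link_def)
qed

text \<open>If \<open>m\<close> selects nodes of one side only, this is, up to sign, the number of
  kept minus the number of dropped edges at these nodes. The opposite signs for the two sides make
  contributions at inner nodes of a trail cancel.\<close>

definition net :: "(node \<Rightarrow> bool) \<Rightarrow> (edge \<times> int) list \<Rightarrow> int" where
  "net m L = sum_list (map (\<lambda>x. snd x * (of_bool (m (right (fst x))) - of_bool (m (left (fst x))))) L)"

text \<open>
  Flipping a trail may change the imbalance of the whole edge set, but not the sum of the absolute
  imbalances of the trails.
\<close>

definition cap :: "(node \<Rightarrow> bool) \<Rightarrow> trail list \<Rightarrow> int" where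
  "cap m R = sum_list (map (\<lambda>r. \<bar>net m (snd (snd r))\<bar>) R)"

text \<open>The sum telescopes to the two ends of the trail. This may fail once trails have been
  joined at two different nodes between which \<open>m\<close> distinguishes.\<close>

definition exact :: "(node \<Rightarrow> bool) \<Rightarrow> trail \<Rightarrow> bool" where
  "exact m r \<longleftrightarrow> net m (snd (snd r)) = of_bool (m (fst (snd r))) - of_bool (m (fst r))"

lemma net_append: "net m (L @ L') = net m L + net m L'"
  by (simp add: net_def)

lemma net_flip: "net m (snd (snd (flip r))) = - net m (snd (snd r))"
  by (simp add: net_def flip_def comp_def uminus_sum_list_map)

lemma cap_link: "cap m (link k R) \<le> cap m R"
  unfolding cap_def
  by (rule link_sum_le) (simp_all add: net_flip, simp add: join_def net_append)

lemma abs_net_concat: "\<bar>net m (concat (map (\<lambda>r. snd (snd r)) R))\<bar> \<le> cap m R"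
  by (induction R) (auto simp: cap_def net_append net_def)

text \<open>At a joint, the end of one trail cancels the start of the other, because
  \<open>m\<close> is constant on the nodes hit by \<open>k\<close>.\<close>

lemma exact_link:
  assumes "\<forall>r\<in>set R. exact m r" "\<And>a b. hits k a \<Longrightarrow> hits k b \<Longrightarrow> m a = m b"
  shows "\<forall>r\<in>set (link k R). exact m r"
proof (rule link_preserves(1)[OF _ _ assms(1)])
  show "exact m r \<Longrightarrow> exact m (flip r)" for r
    using net_flip[of m r] by (simp add: exact_def) (simp add: flip_def)
  show "exact m (join r r')" if "exact m r" "exact m r'" "hits k (fst (snd r))" "hits k (fst r')" for r r'
    using that assms(2)[OF that(3,4)] by (simp add: exact_def join_def net_append)
qed

lemma cap_exact:
  "\<forall>r\<in>set R. exact m r \<Longrightarrow> cap m R = int (length (filter (\<lambda>r. m (fst r) \<noteq> m (fst (snd r))) R))"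
  by (induction R) (auto simp: exact_def cap_def)

text \<open>An exact trail contributes 1 if just one of its ends is at \<open>k\<close> and 0
  otherwise; linking at \<open>k\<close> leaves at most one trail of the former kind.\<close>

lemma cap_link_self:
  assumes "\<forall>r\<in>set R. exact (hits k) r"
  shows "cap (hits k) (link k R) \<le> 1"
proof -
  let ?h = "\<lambda>r. hits k (fst r) \<noteq> hits k (fst (snd r))"
  have "\<forall>r\<in>set (link k R). exact (hits k) r"
    by (rule exact_link[OF assms]) simp
  then have "cap (hits k) (link k R) = int (length (filter ?h (link k R)))"
    by (rule cap_exact)
  moreover have "length (filter ?h (link k R)) \<le> 1"
    by (rule link_preserves(2)[where P = "\<lambda>_. True"]) auto
  ultimately show ?thesis by simp
qed

lemma cap_fold_link: "cap m (fold link ks R) \<le> cap m R"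
proof (induction ks arbitrary: R)
  case (Cons k ks)
  show ?case using order_trans[OF Cons cap_link, of k R] by simp
qed simp

definition refines :: "key \<Rightarrow> key \<Rightarrow> bool" where
  "refines k k' \<longleftrightarrow> (\<forall>a b. hits k a \<longrightarrow> hits k b \<longrightarrow> hits k' a = hits k' b)"

text \<open>Until a key is processed, all trails stay exact for it, since the earlier keys refine
  it. Processing it reduces the total imbalance to at most 1. Later links may destroy exactness, but
  the total no longer grows.\<close>

lemma cap_fold_link_le_1:
  assumes "sorted_wrt refines ks"
    "\<forall>k\<in>set ks. \<forall>r\<in>set R. exact (hits k) r"
  shows "\<forall>k\<in>set ks. cap (hits k) (fold link ks R) \<le> 1"
  using assms
proof (induction ks arbitrary: R)
  case (Cons k ks)
  have "\<forall>r\<in>set (link k R). exact (hits k') r" if k': "k' \<in> set ks" for k'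
  proof (rule exact_link)
    show "\<forall>r\<in>set R. exact (hits k') r" using Cons.prems(2) k' by simp
    show "hits k' a = hits k' b" if "hits k a" "hits k b" for a b
      using Cons.prems(1) k' that unfolding sorted_wrt.simps refines_def by blast
  qed
  then have "\<forall>k'\<in>set ks. cap (hits k') (fold link ks (link k R)) \<le> 1"
    using Cons.prems(1) by (intro Cons.IH) auto
  moreover have "cap (hits k) (fold link ks (link k R)) \<le> 1"
    using Cons.prems(2) by (intro order_trans[OF cap_fold_link cap_link_self]) simp
  ultimately show ?case by simp
qed simp

lemma hits_fine: "hits (True, v) a \<longleftrightarrow> a = v"
  by (cases a; cases v) (auto simp: hits_def)

lemma sorted_wrtI: "(\<And>x y. x \<in> set xs \<Longrightarrow> y \<in> set xs \<Longrightarrow> P x y) \<Longrightarrow> sorted_wrt P xs"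
  by (induction xs) auto

text \<open>A key of a single node refines every key, and keys of centers refine each other because
  their node sets are equal or disjoint. Initially every trail is a single edge and hence
  exact.\<close>

lemma cap_trails: "k \<in> set (keys S) \<Longrightarrow> cap (hits k) (trails S) \<le> 1"
  unfolding trails_def
proof (rule cap_fold_link_le_1[rule_format])
  show "sorted_wrt refines (keys S)"
    unfolding keys_def sorted_wrt_append
    by (intro conjI sorted_wrtI ballI)
      (auto simp: refines_def hits_fine simp del: split_paired_All, auto simp: hits_def right_def)
qed (auto simp: exact_def net_def)

lemma fold_link_sum_le:
  fixes \<mu> :: "trail \<Rightarrow> 'a::ordered_comm_monoid_add"
  assumes "\<And>r. \<mu> (flip r) = \<mu> r" "\<And>r r'. \<mu> (join r r') \<le> \<mu> r + \<mu> r'"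
  shows "sum_list (map \<mu> (fold link ks R)) \<le> sum_list (map \<mu> R)"
proof (induction ks arbitrary: R)
  case (Cons k ks)
  show ?case using order_trans[OF Cons link_sum_le[OF assms], of k R] by simp
qed simp

section \<open>Counting edges before and after halving\<close>

definition cnt :: "(edge \<Rightarrow> bool) \<Rightarrow> edge list \<Rightarrow> int" where
  "cnt Q S = int (length (filter Q S))"

abbreviation trail_edges :: "trail list \<Rightarrow> (edge \<times> int) list" where
  "trail_edges R \<equiv> concat (map (\<lambda>r. snd (snd r)) R)"

lemma sum_list_trail_edges:
  "sum_list (map f (trail_edges R)) = sum_list (map (\<lambda>r. sum_list (map f (snd (snd r)))) R)"
  by (induction R) auto

lemma sum_trails_le:
  fixes f :: "edge \<Rightarrow> 'a::ordered_comm_monoid_add"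
  shows "sum_list (map (\<lambda>x. f (fst x)) (trail_edges (trails S))) \<le> sum_list (map f S)"
proof -
  have "sum_list (map (\<lambda>r. sum_list (map (\<lambda>x. f (fst x)) (snd (snd r)))) (trails S))
    \<le> sum_list (map (\<lambda>r. sum_list (map (\<lambda>x. f (fst x)) (snd (snd r)))) (map (\<lambda>e. (left e, right e, [(e, 1 :: int)])) S))"
    unfolding trails_def by (rule fold_link_sum_le) (simp_all add: flip_def join_def comp_def)
  then show ?thesis by (simp add: sum_list_trail_edges comp_def)
qed

text \<open>Applying the inequality to \<open>- f\<close> as well gives equality.\<close>

lemma sum_trails:
  fixes f :: "edge \<Rightarrow> int"
  shows "sum_list (map (\<lambda>x. f (fst x)) (trail_edges (trails S))) = sum_list (map f S)"
  using sum_trails_le[of f S] sum_trails_le[of "\<lambda>e. - f e" S]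
  by (simp add: uminus_sum_list_map[symmetric, unfolded comp_def])

lemma cnt_sum: "cnt Q S = sum_list (map (\<lambda>e. of_bool (Q e)) S)"
  by (induction S) (auto simp: cnt_def)

lemma cnt_pos_iff: "0 < cnt Q S \<longleftrightarrow> (\<exists>e\<in>set S. Q e)"
  by (induction S) (auto simp: cnt_def)

lemma trails_signs: "\<forall>r\<in>set (trails S). \<forall>x\<in>set (snd (snd r)). snd x = 1 \<or> snd x = - 1"
proof -
  have fold: "\<forall>r\<in>set R. \<forall>x\<in>set (snd (snd r)). snd x = 1 \<or> snd x = - 1 \<Longrightarrow>
    \<forall>r\<in>set (fold link ks R). \<forall>x\<in>set (snd (snd r)). snd x = 1 \<or> snd x = - 1" for ks R
  proof (induction ks arbitrary: R)
    case (Cons k ks)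
    show ?case unfolding fold_simps
      by (rule Cons.IH, rule link_preserves(1)[OF _ _ Cons.prems]) (auto simp: flip_def join_def)
  qed simp
  show ?thesis unfolding trails_def by (rule fold) auto
qed

lemma sign_sum:
  assumes "\<forall>x\<in>set L. snd x = 1 \<or> snd x = - 1"
  shows "sum_list (map (\<lambda>x. snd x * of_bool (Q (fst x))) L) =
    2 * cnt Q (map fst (filter (\<lambda>x. snd x = 1) L)) - sum_list (map (\<lambda>x. of_bool (Q (fst x))) L)"
  using assms by (induction L) (auto simp: cnt_def)

text \<open>Kept minus dropped edges satisfying \<open>Q\<close> is
  \<open>2 * cnt Q (halve S) - cnt Q S\<close>. It equals the imbalance at \<open>k\<close> up to
  the sign \<sigma>, which is 1 for nodes of centers and -1 for nodes of points.\<close>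

lemma cnt_halve:
  assumes k: "k \<in> set (keys S)"
    and Q: "\<And>e. of_bool (hits k (right e)) - of_bool (hits k (left e)) = \<sigma> * of_bool (Q e)" "\<bar>\<sigma>\<bar> = (1 :: int)"
  shows "\<bar>2 * cnt Q (halve S) - cnt Q S\<bar> \<le> 1"
proof -
  let ?L = "trail_edges (trails S)"
  have "net (hits k) ?L = \<sigma> * sum_list (map (\<lambda>x. snd x * of_bool (Q (fst x))) ?L)"
    by (simp add: net_def Q(1) sum_list_const_mult[symmetric] mult.left_commute)
  also have "\<dots> = \<sigma> * (2 * cnt Q (halve S) - cnt Q S)"
    using trails_signs[of S] sum_trails[of "\<lambda>e. of_bool (Q e)" S]
    by (subst sign_sum) (auto simp: halve_def cnt_sum)
  finally have "\<bar>2 * cnt Q (halve S) - cnt Q S\<bar> = \<bar>net (hits k) ?L\<bar>"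
    using Q(2) by (simp add: abs_mult)
  also have "\<dots> \<le> cap (hits k) (trails S)" by (rule abs_net_concat)
  also have "\<dots> \<le> 1" by (rule cap_trails[OF k])
  finally show ?thesis .
qed

text \<open>Linking preserves the multiplicity of every edge, so an edge on a trail occurs in
  \<open>S\<close>.\<close>

lemma set_halve: "set (halve S) \<subseteq> set S"
proof
  fix e assume "e \<in> set (halve S)"
  then have "e \<in> fst ` set (trail_edges (trails S))" by (auto simp: halve_def)
  then have "0 < cnt (\<lambda>x. x = e) (map fst (trail_edges (trails S)))"
    by (auto simp: cnt_pos_iff)
  then have "0 < cnt (\<lambda>x. x = e) S"
    using sum_trails[of "\<lambda>x. of_bool (x = e)" S] by (simp add: cnt_sum comp_def)
  then show "e \<in> set S" by (simp add: cnt_pos_iff)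
qed

lemma cnt_eq_0: "\<forall>e\<in>set S. \<not> Q e \<Longrightarrow> cnt Q S = 0"
  by (simp add: cnt_def filter_empty_conv)

lemma cnt_halve_class: "\<bar>2 * cnt (\<lambda>e. snd e = c \<and> snd (fst e) = g) (halve S) - cnt (\<lambda>e. snd e = c \<and> snd (fst e) = g) S\<bar> \<le> 1"
proof (cases "\<exists>e\<in>set S. snd e = c \<and> snd (fst e) = g")
  case True
  then obtain e where "e \<in> set S" "snd e = c" "snd (fst e) = g" by blast
  then have "(True, False, c, g) \<in> set (keys S)" by (auto simp: keys_def right_def image_iff intro: bexI)
  then show ?thesis
    by (rule cnt_halve[where \<sigma> = 1]) (auto simp: hits_fine right_def left_def)
next
  case False
  \<comment> \<open>Without an edge in the class its key does not occur in \<open>keys S\<close>,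
    but then both counts are 0.\<close>
  then show ?thesis using set_halve[of S] by (subst (1 2) cnt_eq_0) auto
qed

lemma cnt_halve_center: "\<bar>2 * cnt (\<lambda>e. snd e = c) (halve S) - cnt (\<lambda>e. snd e = c) S\<bar> \<le> 1"
proof (cases "\<exists>e\<in>set S. snd e = c")
  case True
  then obtain e where "e \<in> set S" "snd e = c" by blast
  then have "(False, right e) \<in> set (keys S)" by (auto simp: keys_def)
  then show ?thesis
    by (rule cnt_halve[where \<sigma> = 1]) (auto simp: hits_def right_def left_def \<open>snd e = c\<close>)
next
  case False
  then show ?thesis using set_halve[of S] by (subst (1 2) cnt_eq_0) auto
qed

text \<open>For an even count the deviation is even and at most 1 in absolute value, hence
  0.\<close>

lemma cnt_halve_point:
  assumes "even (cnt (\<lambda>e. fst e = q) S)"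
  shows "2 * cnt (\<lambda>e. fst e = q) (halve S) = cnt (\<lambda>e. fst e = q) S"
proof -
  have "\<bar>2 * cnt (\<lambda>e. fst e = q) (halve S) - cnt (\<lambda>e. fst e = q) S\<bar> \<le> 1"
  proof (cases "\<exists>e\<in>set S. fst e = q")
    case True
    then obtain e where "e \<in> set S" "fst e = q" by blast
    then have "(True, left e) \<in> set (keys S)" by (auto simp: keys_def)
    then show ?thesis
      by (rule cnt_halve[where \<sigma> = "- 1"]) (auto simp: hits_fine right_def left_def \<open>fst e = q\<close>)
  next
    case False
    then show ?thesis using set_halve[of S] by (subst (1 2) cnt_eq_0) auto
  qed
  then show ?thesis using assms by presburger
qed

text \<open>One more halving turns an error e into at most 2 e + 1, and from 0 this recursion gives
  2^j - 1 after j halvings. Being strictly below 2^j, the error is less than 1 after division by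
  2^j.\<close>

lemma cnt_halvings:
  fixes J :: "unit list"
  assumes "\<And>S. \<bar>2 * cnt Q (halve S) - cnt Q S\<bar> \<le> 1"
  shows "\<bar>2 ^ length J * cnt Q (fold (\<lambda>_. halve) J S) - cnt Q S\<bar> \<le> 2 ^ length J - 1"
proof (induction J arbitrary: S)
  case (Cons u J)
  let ?a = "cnt Q S" and ?b = "cnt Q (halve S)" and ?c = "cnt Q (fold (\<lambda>_. halve) J (halve S))"
  have "\<bar>2 ^ length J * ?c - ?b\<bar> \<le> 2 ^ length J - 1" by (rule Cons)
  moreover have "\<bar>2 * ?b - ?a\<bar> \<le> 1" by (rule assms)
  ultimately have "\<bar>2 * (2 ^ length J * ?c) - ?a\<bar> \<le> 2 * 2 ^ length J - 1" by linarith
  then show ?case by (simp add: algebra_simps)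
qed simp

lemma cnt_halvings_point:
  fixes J :: "unit list"
  assumes "cnt (\<lambda>e. fst e = q) S = 2 ^ length J"
  shows "cnt (\<lambda>e. fst e = q) (fold (\<lambda>_. halve) J S) = 1"
  using assms
proof (induction J arbitrary: S)
  case (Cons u J)
  have "2 * cnt (\<lambda>e. fst e = q) (halve S) = cnt (\<lambda>e. fst e = q) S"
    using Cons.prems by (intro cnt_halve_point) simp
  then have "cnt (\<lambda>e. fst e = q) (halve S) = 2 ^ length J" using Cons.prems by simp
  from Cons.IH[OF this] show ?case by simp
qed simp

lemma set_halvings: "set (fold (\<lambda>_. halve) J S) \<subseteq> set S" for J :: "unit list"
proof (induction J arbitrary: S)
  case (Cons u J)
  show ?case using Cons[of "halve S"] set_halve[of S] by simp
qed simp

subsection \<open>Running time of halving\<close>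

lemma sz_list: "sz xs = Suc (sum_list (map (\<lambda>x. Suc (sz x)) xs))"
  by (induction xs) auto

lemma sz_mem_less: "x \<in> set xs \<Longrightarrow> Suc (sz x) \<le> sz xs"
  by (induction xs) auto

lemma sz_flip: "sz (flip r) = sz r"
proof -
  have "sz (map (\<lambda>x. (fst x, - snd x)) L) = sz L" for L :: "(edge \<times> int) list"
    by (induction L) (auto simp: enc_prod_eq[of "_ :: edge \<times> int"])
  then show ?thesis by (cases r) (simp add: flip_def)
qed

lemma sz_join_le: "sz (join r r') \<le> sz r + sz r'"
  using sz_append[of "snd (snd r)" "snd (snd r')"] by (cases r; cases r') (simp add: join_def)

text \<open>Flipping preserves the size because negation does, and joining merges two list cells
  into one. So the fold over all keys runs without any growth.\<close>

lemma sz_link_le: "sz (link k R) \<le> sz R"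
  unfolding sz_list[of "link k R"] sz_list[of R] Suc_le_mono
proof (rule link_sum_le)
  show "Suc (sz (join r r')) \<le> Suc (sz r) + Suc (sz r')" for r r'
    using sz_join_le[of r r'] by linarith
qed (simp add: sz_flip)

lemma ptime_hits [ptime_intros]:
  assumes "ptime_on D k" "ptime_on D v"
  shows "ptime_on D (\<lambda>x. hits (k x) (v x))"
  unfolding hits_def by (intro ptime_intros assms)

lemma ptime_flip [ptime_intros]:
  assumes "ptime_on D r"
  shows "ptime_on D (\<lambda>x. flip (r x))"
  unfolding flip_def by (intro ptime_intros assms)

lemma ptime_join [ptime_intros]:
  assumes "ptime_on D r" "ptime_on D r'"
  shows "ptime_on D (\<lambda>x. join (r x) (r' x))"
  unfolding join_def by (intro ptime_intros assms)

lemma ptime_link [ptime_intros]: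
  assumes "ptime_on D k" "ptime_on D R"
  shows "ptime_on D (\<lambda>x. link (k x) (R x))"
proof -
  have "ptime_on UNIV (\<lambda>x. fold (link_step (fst x)) (snd x) ([], []))"
  proof (rule ptime_fold_add)
    show "ptime (\<lambda>z. link_step (fst (fst z)) (fst (snd z)) (snd (snd z)))"
      unfolding link_step_def by (intro ptime_intros)
    show "poly_bounded UNIV (\<lambda>x. sz (snd x :: trail list))"
      by (intro ptime_on_sz ptime_intros)
    show "sz (link_step (fst x) r z) \<le> sz z + sz (snd x)" if "r \<in> set (snd x)" for x :: "key \<times> trail list" and r z
    proof -
      have "Suc (sz r) \<le> sz (snd x)" using that by (rule sz_mem_less)
      moreover have "sz (link_step k r z) \<le> sz z + Suc (sz r)" for k
        using vsize_ge_1[of "enc (tl (fst z))"]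
          sz_join_le[of "if hits k (fst (snd (hd (fst z)))) then hd (fst z) else flip (hd (fst z))"
            "if hits k (fst r) then r else flip r"]
        by (cases z) (auto simp: link_step_def sz_flip split: list.split if_splits)
      ultimately show ?thesis by (meson add_left_mono order_trans)
    qed
  qed (intro ptime_intros)+
  then have "ptime (\<lambda>x. link (fst x) (snd x))"
    unfolding link_def by (intro ptime_intros)
  then show ?thesis by (rule ptime_comp2) fact+
qed

lemma ptime_left [ptime_intros]: "ptime_on D e \<Longrightarrow> ptime_on D (\<lambda>x. left (e x))"
  unfolding left_def by (intro ptime_intros)

lemma ptime_right [ptime_intros]: "ptime_on D e \<Longrightarrow> ptime_on D (\<lambda>x. right (e x))"
  unfolding right_def by (intro ptime_intros)

lemma ptime_halve [ptime_intros]: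
  assumes "ptime_on D S"
  shows "ptime_on D (\<lambda>x. halve (S x))"
proof (rule ptime_comp[OF _ assms])
  show "ptime halve"
    unfolding halve_def trails_def keys_def
  proof (intro ptime_intros ptime_fold_add)
    show "poly_bounded UNIV (\<lambda>_ :: edge list. 0)" by (intro poly_bounded_intros)
    show "sz (link y b) \<le> sz b + 0" for y b using sz_link_le by simp
  qed
qed

lemma sz_halve_le: "sz (halve S) \<le> sz S"
proof -
  have "sz (halve S) \<le> Suc (sum_list (map (\<lambda>x. Suc (sz (fst x))) (trail_edges (trails S))))"
  proof -
    have "sz (map fst (filter P L)) \<le> Suc (sum_list (map (\<lambda>x. Suc (sz (fst x))) L))" for P and L :: "(edge \<times> int) list"
      by (induction L) auto
    then show ?thesis by (simp add: halve_def)
  qed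
  also have "\<dots> \<le> sz S"
    unfolding sz_list[of S] Suc_le_mono by (rule sum_trails_le)
  finally show ?thesis .
qed

lemma ptime_halvings [ptime_intros]:
  fixes J :: "'a::enc \<Rightarrow> unit list"
  assumes "ptime_on D J" "ptime_on D S"
  shows "ptime_on D (\<lambda>x. fold (\<lambda>_. halve) (J x) (S x))"
proof (rule ptime_fold_add)
  show "poly_bounded D (\<lambda>_. 0)" by (intro poly_bounded_intros)
  show "sz (halve b) \<le> sz b + 0" for b using sz_halve_le by simp
qed (intro ptime_intros assms)+

section \<open>Convergence of the average\<close>

lemma sum_list_swap:
  fixes f :: "'a \<Rightarrow> 'b \<Rightarrow> 'c::comm_monoid_add"
  shows "sum_list (map (\<lambda>x. sum_list (map (f x) ys)) xs) = sum_list (map (\<lambda>y. sum_list (map (\<lambda>x. f x y) xs)) ys)"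
  by (induction xs) (simp_all add: sum_list_addf)

definition score :: "edge list \<Rightarrow> constr \<Rightarrow> int" where
  "score S i = sum_list (map (weight i) S)"

lemma viol_eq: "viol S i = max 0 (score S i)"
  by (simp add: viol_def score_def Let_def max_def)

definition potential :: "constr list \<Rightarrow> edge list \<Rightarrow> int" where
  "potential W S = sum_list (map (\<lambda>i. (viol S i)\<^sup>2) W)"

text \<open>Truncation at 0 commutes with addition up to an inequality: max 0 (s + v) \<le> |max 0 s
  + v|. The claim is the square of this, summed over the constraints.\<close>

lemma potential_append_le:
  "potential W (V @ S) \<le> potential W S + 2 * sum_list (map (\<lambda>i. viol S i * score V i) W)
     + sum_list (map (\<lambda>i. (score V i)\<^sup>2) W)"
proof -
  have *: "(viol (V @ S) i)\<^sup>2 \<le> (viol S i)\<^sup>2 + 2 * (viol S i * score V i) + (score V i)\<^sup>2" for i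
  proof -
    have "\<bar>viol (V @ S) i\<bar> \<le> \<bar>viol S i + score V i\<bar>"
      by (simp add: viol_eq score_def)
    then have "(viol (V @ S) i)\<^sup>2 \<le> (viol S i + score V i)\<^sup>2"
      by (simp add: abs_le_square_iff)
    then show ?thesis by (simp add: power2_sum algebra_simps)
  qed
  show ?thesis unfolding potential_def
  proof (induction W)
    case (Cons i W)
    then show ?case using *[of i] by simp
  qed simp
qed

lemma score_best_edges:
  "sum_list (map (\<lambda>i. viol S i * score (best_edges W S Q) i) W) =
   sum_list (map (\<lambda>z. sum_list (map (\<lambda>i. viol S i * weight i (fst z,
     argmin (\<lambda>c. sum_list (map (\<lambda>i. viol S i * weight i (fst z, c)) W)) (snd z))) W)) Q)"
proof -
  define a where "a z = argmin (\<lambda>c. sum_list (map (\<lambda>i. viol S i * weight i (fst z, c)) W)) (snd z)" for z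
  have "score (best_edges W S Q) i = sum_list (map (\<lambda>z. weight i (fst z, a z)) Q)" for i
    by (simp add: score_def best_edges_def comp_def a_def)
  then show ?thesis
    using sum_list_swap[of "\<lambda>i z. viol S i * weight i (fst z, a z)" Q W]
    by (simp add: sum_list_const_mult a_def)
qed

text \<open>The linear term is at most its value for the assignment \<open>f\<close>, since every
  point minimizes its own share. Exchanging the sums shows that value to be a nonnegative
  combination of the nonpositive scores of \<open>f\<close>. Only the quadratic term
  remains.\<close>

lemma potential_best_edges_le:
  assumes nonempty: "\<And>z. z \<in> set Q \<Longrightarrow> f z \<in> set (snd z)"
    and feasible: "\<And>i. i \<in> set W \<Longrightarrow> sum_list (map (\<lambda>z. weight i (fst z, f z)) Q) \<le> 0"
    and bound: "\<And>i e. i \<in> set W \<Longrightarrow> \<bar>weight i e\<bar> \<le> K"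
  shows "potential W (best_edges W S Q @ S) \<le> potential W S + int (length W) * (int (length Q) * K)\<^sup>2"
proof -
  let ?V = "best_edges W S Q"
  have "sum_list (map (\<lambda>i. viol S i * score ?V i) W)
    \<le> sum_list (map (\<lambda>z. sum_list (map (\<lambda>i. viol S i * weight i (fst z, f z)) W)) Q)"
    unfolding score_best_edges by (rule sum_list_mono) (rule argmin_le[OF nonempty])
  also have "\<dots> = sum_list (map (\<lambda>i. viol S i * sum_list (map (\<lambda>z. weight i (fst z, f z)) Q)) W)"
    by (subst sum_list_swap) (simp only: sum_list_const_mult)
  also have "\<dots> \<le> sum_list (map (\<lambda>_. 0) W)"
    by (rule sum_list_mono) (use feasible in \<open>auto simp: viol_eq intro: mult_nonneg_nonpos\<close>)
  finally have 1: "sum_list (map (\<lambda>i. viol S i * score ?V i) W) \<le> 0" by simp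
  have abs: "\<bar>score E i\<bar> \<le> int (length E) * K" if "i \<in> set W" for E i
  proof (induction E)
    case (Cons e E)
    have "\<bar>score (e # E) i\<bar> \<le> \<bar>weight i e\<bar> + \<bar>score E i\<bar>"
      by (simp add: score_def)
    then show ?case using Cons bound[OF that, of e] by (simp add: algebra_simps)
  qed (simp add: score_def)
  have "sum_list (map (\<lambda>i. (score ?V i)\<^sup>2) W) \<le> sum_list (map (\<lambda>_. (int (length Q) * K)\<^sup>2) W)"
  proof (rule sum_list_mono)
    fix i assume "i \<in> set W"
    then have "\<bar>score ?V i\<bar> \<le> int (length Q) * K" using abs[of i ?V] by (simp add: best_edges_def)
    then show "(score ?V i)\<^sup>2 \<le> (int (length Q) * K)\<^sup>2"
      by (simp add: abs_le_square_iff[symmetric])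
  qed
  then have 2: "sum_list (map (\<lambda>i. (score ?V i)\<^sup>2) W) \<le> int (length W) * (int (length Q) * K)\<^sup>2"
    by (simp add: sum_list_triv)
  show ?thesis using potential_append_le[of W ?V S] 1 2 by linarith
qed

text \<open>A score is at most the square root of the potential, hence of order square root of
  \<open>length D\<close>, while the target \<open>length D * K / E\<close> is linear. The
  hypothesis \<open>T\<close> on \<open>length D\<close> marks the point where the target takes
  over.\<close>

lemma average_score_le:
  assumes nonempty: "\<And>z. z \<in> set Q \<Longrightarrow> f z \<in> set (snd z)"
    and feasible: "\<And>i. i \<in> set W \<Longrightarrow> sum_list (map (\<lambda>z. weight i (fst z, f z)) Q) \<le> 0"
    and bound: "\<And>i e. i \<in> set W \<Longrightarrow> \<bar>weight i e\<bar> \<le> K"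
    and T: "int (length W) * (int (length Q))\<^sup>2 * E\<^sup>2 \<le> int (length D)" and i: "i \<in> set W"
    and E: "0 \<le> E"
  shows "E * score (average W Q D) i \<le> int (length D) * K"
proof -
  let ?B = "int (length W) * (int (length Q) * K)\<^sup>2"
  have "potential W (fold (\<lambda>_ S. best_edges W S Q @ S) D S) \<le> potential W S + int (length D) * ?B" for S
  proof (induction D arbitrary: S)
    case (Cons u D)
    show ?case
      using order_trans[OF Cons add_right_mono[OF potential_best_edges_le[OF nonempty feasible bound]]]
      by (simp add: algebra_simps)
  qed simp
  from this[of "[]"] have P: "potential W (average W Q D) \<le> int (length D) * ?B"
    by (simp add: average_def potential_def viol_eq score_def sum_list_triv)
  let ?v = "viol (average W Q D) i"
  have K: "0 \<le> K" using bound[OF i, of undefined] by linarith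
  have "?v\<^sup>2 \<le> potential W (average W Q D)"
    unfolding potential_def by (rule member_le_sum_list) (use i in auto)
  with P have "?v\<^sup>2 \<le> int (length D) * ?B" by linarith
  then have "E\<^sup>2 * ?v\<^sup>2 \<le> E\<^sup>2 * (int (length D) * ?B)" by (intro mult_left_mono) auto
  also have "\<dots> = int (length D) * K\<^sup>2 * (int (length W) * (int (length Q))\<^sup>2 * E\<^sup>2)"
    by (simp add: power_mult_distrib algebra_simps)
  also have "\<dots> \<le> int (length D) * K\<^sup>2 * int (length D)"
    by (rule mult_left_mono[OF T]) auto
  finally have "(E * ?v)\<^sup>2 \<le> (int (length D) * K)\<^sup>2"
    by (simp add: power_mult_distrib algebra_simps power2_eq_square)
  then have "\<bar>E * ?v\<bar> \<le> int (length D) * K"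
    using K by (subst (asm) abs_le_square_iff[symmetric]) (simp add: abs_mult)
  then have "E * ?v \<le> int (length D) * K" by linarith
  moreover have "E * score (average W Q D) i \<le> E * ?v"
    using E by (intro mult_left_mono) (simp_all add: viol_eq)
  ultimately show ?thesis by linarith
qed

lemma average_edges:
  assumes "e \<in> set (average W Q D)" "\<And>z. z \<in> set Q \<Longrightarrow> snd z \<noteq> []"
  shows "\<exists>z\<in>set Q. fst e = fst z \<and> snd e \<in> set (snd z)"
proof -
  have "e \<in> set (fold (\<lambda>_ S. best_edges W S Q @ S) D S) \<Longrightarrow>
     e \<in> set S \<or> (\<exists>z\<in>set Q. fst e = fst z \<and> snd e \<in> set (snd z))" for S
  proof (induction D arbitrary: S)
    case (Cons u D)
    have "(\<exists>z\<in>set Q. fst e = fst z \<and> snd e \<in> set (snd z))" if "e \<in> set (best_edges W S Q)"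
    proof -
      from that obtain z where z: "z \<in> set Q" "fst e = fst z"
        "snd e = argmin (\<lambda>c. sum_list (map (\<lambda>i. viol S i * weight i (fst z, c)) W)) (snd z)"
        by (auto simp: best_edges_def)
      then show ?thesis using argmin_in[OF assms(2)[OF z(1)]] by (intro bexI[OF _ z(1)]) simp
    qed
    then show ?case using Cons.IH[of "best_edges W S Q @ S"] Cons.prems by auto
  qed simp
  from this[of "[]"] show ?thesis using assms(1) by (simp add: average_def)
qed

lemma cnt_append: "cnt P (S @ S') = cnt P S + cnt P S'"
  by (simp add: cnt_def)

lemma cnt_average_point:
  assumes "distinct (map fst Q)" "q \<in> fst ` set Q"
  shows "cnt (\<lambda>e. fst e = q) (average W Q D) = int (length D)"
proof -
  have 1: "cnt (\<lambda>e. fst e = q) (best_edges W S Q) = 1" for S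
  proof -
    have "cnt (\<lambda>e. fst e = q) (best_edges W S Q) = int (length (filter (\<lambda>x. x = q) (map fst Q)))"
      by (simp add: cnt_def best_edges_def filter_map comp_def)
    also have "\<dots> = 1"
    proof -
      have "length (filter (\<lambda>x. x = q) xs) = 1" if "distinct xs" "q \<in> set xs" for xs
        using that by (induction xs) (auto simp: filter_empty_conv)
      from this[of "map fst Q"] show ?thesis using assms by (simp only: set_map of_nat_1)
    qed
    finally show ?thesis .
  qed
  have "cnt (\<lambda>e. fst e = q) (fold (\<lambda>_ S. best_edges W S Q @ S) D S) = cnt (\<lambda>e. fst e = q) S + int (length D)" for S
    by (induction D arbitrary: S) (auto simp: cnt_append 1)
  from this[of "[]"] show ?thesis by (simp add: average_def cnt_def)
qed

section \<open>The algorithm\<close>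

type_synonym frac = "int \<times> int"
type_synonym assignment_input = "frac list list \<times> nat list \<times> frac list \<times> frac list \<times> nat list"

abbreviation (input) "rows_of I \<equiv> fst (I :: assignment_input)"
abbreviation (input) "cols_of I \<equiv> fst (snd (I :: assignment_input))"
abbreviation (input) "lowers_of I \<equiv> fst (snd (snd (I :: assignment_input)))"
abbreviation (input) "uppers_of I \<equiv> fst (snd (snd (snd (I :: assignment_input))))"
abbreviation (input) "centers_of I \<equiv> snd (snd (snd (snd (I :: assignment_input))))"

definition frac_le :: "frac \<Rightarrow> frac \<Rightarrow> bool" where
  "frac_le r s \<longleftrightarrow> fst r * snd s \<le> fst s * snd r"

text \<open>The default fraction 0/1 has a positive denominator, as comparison by cross
  multiplication requires.\<close>

definition dist_of :: "assignment_input \<Rightarrow> nat \<Rightarrow> nat \<Rightarrow> frac" where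
  "dist_of I p c = lookup (0, 1) (lookup [] (rows_of I) p) c"

definition candidates :: "assignment_input \<Rightarrow> frac \<Rightarrow> (point \<times> nat list) list" where
  "candidates I r = map (\<lambda>p. ((p, lookup 0 (cols_of I) p),
     filter (\<lambda>c. frac_le (dist_of I p c) r) (centers_of I))) [0..<length (cols_of I)]"

text \<open>
  The fairness bounds are relaxed to multiples of \<open>1/K\<close> with \<open>K = 4n\<^sup>2\<close>; the same \<open>K\<close> is the accuracy
  of the averaged assignment. Note that \<open>- (- x div y)\<close> rounds up.
\<close>

definition grid :: "assignment_input \<Rightarrow> int" where
  "grid I = 4 * int (length (cols_of I)) * int (length (cols_of I))"

definition grid_lower :: "assignment_input \<Rightarrow> nat \<Rightarrow> int" where
  "grid_lower I h = (fst (lookup (0, 1) (lowers_of I) h) * grid I) div snd (lookup (0, 1) (lowers_of I) h)"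

definition grid_upper :: "assignment_input \<Rightarrow> nat \<Rightarrow> int" where
  "grid_upper I h = - (- (fst (lookup (0, 1) (uppers_of I) h) * grid I) div snd (lookup (0, 1) (uppers_of I) h))"

text \<open>If k of the m points at \<open>c\<close> have color \<open>h\<close>, the two scores are
  K k - U m and L m - K k, with K the grid and U, L the rounded bounds.\<close>

definition constraints :: "assignment_input \<Rightarrow> constr list" where
  "constraints I = concat (map (\<lambda>c. concat (map (\<lambda>h.
     [(c, h, grid I - grid_upper I h, - grid_upper I h),
      (c, h, grid_lower I h - grid I, grid_lower I h)])
     [0..<length (lowers_of I)])) (centers_of I))"

definition repeat_for :: "'a list \<Rightarrow> unit list \<Rightarrow> unit list" where
  "repeat_for xs ys = concat (map (\<lambda>_. ys) xs)"

text \<open>Unary arithmetic: the first component counts the doublings and the second has length two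
  to that number. Each step lengthens the second component by at least 1, so a fold over
  \<open>B\<close> provides enough steps to reach the length of \<open>B\<close>.\<close>

definition doubling :: "unit list \<Rightarrow> unit list \<times> unit list" where
  "doubling B = fold (\<lambda>_ z. if length (snd z) < length B then (() # fst z, snd z @ snd z) else z) B ([], [()])"

text \<open>The argument of \<open>doubling\<close> has length \<open>|W| n\<^sup>2 K\<^sup>2\<close> for the list \<open>W\<close> of constraints.\<close>

definition iterations :: "assignment_input \<Rightarrow> unit list \<times> unit list" where
  "iterations I = doubling (let N = cols_of I in
     repeat_for (constraints I) (repeat_for N (repeat_for N (repeat_for N (repeat_for N (repeat_for N (repeat_for N (replicate 16 ()))))))))"

definition averaged :: "assignment_input \<Rightarrow> frac \<Rightarrow> edge list" where
  "averaged I r = average (constraints I) (candidates I r) (snd (iterations I))"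

definition rounded :: "assignment_input \<Rightarrow> frac \<Rightarrow> edge list" where
  "rounded I r = fold (\<lambda>_. halve) (fst (iterations I)) (averaged I r)"

definition assigned :: "assignment_input \<Rightarrow> frac \<Rightarrow> nat list" where
  "assigned I r = map (\<lambda>p. hd (map snd (filter (\<lambda>e. fst (fst e) = p) (rounded I r)))) [0..<length (cols_of I)]"

definition count_where :: "(nat \<Rightarrow> bool) \<Rightarrow> assignment_input \<Rightarrow> int" where
  "count_where P I = int (length (filter P [0..<length (cols_of I)]))"

definition fair_class :: "assignment_input \<Rightarrow> nat list \<Rightarrow> nat \<Rightarrow> nat \<Rightarrow> bool" where
  "fair_class I \<phi> c h \<longleftrightarrow>
     (let m = count_where (\<lambda>p. lookup 0 \<phi> p = c) I;
          k = count_where (\<lambda>p. lookup 0 \<phi> p = c \<and> lookup 0 (cols_of I) p = h) I;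
          l = lookup (0, 1) (lowers_of I) h; u = lookup (0, 1) (uppers_of I) h
      in fst l * m \<le> snd l * (k + 2) \<and> snd u * (k - 2) \<le> fst u * m)"

text \<open>Membership is written as a bounded existential, the form in which a search through a
  list is known to take polynomial time.\<close>

definition accepted :: "assignment_input \<Rightarrow> frac \<Rightarrow> nat list \<Rightarrow> bool" where
  "accepted I r \<phi> \<longleftrightarrow>
     (\<forall>p\<in>set [0..<length (cols_of I)]. frac_le (dist_of I p (lookup 0 \<phi> p)) r \<and>
        (\<exists>c\<in>set (centers_of I). c = lookup 0 \<phi> p)) \<and>
     (\<forall>c\<in>set (centers_of I). \<forall>h\<in>set [0..<length (lowers_of I)]. fair_class I \<phi> c h)"

text \<open>Every distance between a point and a center is tried as a radius. For a radius without
  an exactly fair assignment the computed list carries no guarantee, so each one is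
  verified.\<close>

definition solutions :: "assignment_input \<Rightarrow> (frac \<times> nat list) list" where
  "solutions I = filter (\<lambda>x. accepted I (fst x) (snd x)) (concat (map (\<lambda>p. map (\<lambda>c.
     (dist_of I p c, assigned I (dist_of I p c))) (centers_of I)) [0..<length (cols_of I)]))"

definition best_solution :: "assignment_input \<Rightarrow> nat list" where
  "best_solution I = snd (hd (filter (\<lambda>x. \<forall>y\<in>set (solutions I). frac_le (fst x) (fst y)) (solutions I)))"

section \<open>Running time of the algorithm\<close>

lemma ptime_frac_le [ptime_intros]:
  assumes "ptime_on D r" "ptime_on D s"
  shows "ptime_on D (\<lambda>x. frac_le (r x) (s x))"
  unfolding frac_le_def by (intro ptime_intros assms)

lemma ptime_dist_of [ptime_intros]:
  assumes "ptime_on D I" "ptime_on D p" "ptime_on D c"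
  shows "ptime_on D (\<lambda>x. dist_of (I x) (p x) (c x))"
  unfolding dist_of_def by (intro ptime_intros assms)

lemma ptime_candidates [ptime_intros]:
  assumes "ptime_on D I" "ptime_on D r"
  shows "ptime_on D (\<lambda>x. candidates (I x) (r x))"
proof (rule ptime_comp2[OF _ assms])
  show "ptime (\<lambda>z. candidates (fst z) (snd z))"
    unfolding candidates_def by (intro ptime_intros)
qed

lemma ptime_grid [ptime_intros]:
  "ptime_on D I \<Longrightarrow> ptime_on D (\<lambda>x. grid (I x))"
  unfolding grid_def by (intro ptime_intros)

lemma ptime_grid_lower [ptime_intros]:
  "ptime_on D I \<Longrightarrow> ptime_on D h \<Longrightarrow> ptime_on D (\<lambda>x. grid_lower (I x) (h x))"
  unfolding grid_lower_def by (intro ptime_intros)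

lemma ptime_grid_upper [ptime_intros]:
  "ptime_on D I \<Longrightarrow> ptime_on D h \<Longrightarrow> ptime_on D (\<lambda>x. grid_upper (I x) (h x))"
  unfolding grid_upper_def by (intro ptime_intros)

lemma ptime_constraints [ptime_intros]:
  assumes "ptime_on D I"
  shows "ptime_on D (\<lambda>x. constraints (I x))"
proof (rule ptime_comp[OF _ assms])
  show "ptime constraints"
    unfolding constraints_def by (intro ptime_intros)
qed

lemma ptime_repeat_for [ptime_intros]:
  assumes "ptime_on D xs" "ptime_on D ys"
  shows "ptime_on D (\<lambda>x. repeat_for (xs x) (ys x))"
proof (rule ptime_comp2[OF _ assms])
  show "ptime (\<lambda>z. repeat_for (fst z) (snd z))"
    unfolding repeat_for_def by (intro ptime_intros)
qed

lemma length_repeat_for: "length (repeat_for xs ys) = length xs * length ys"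
  by (simp add: repeat_for_def length_concat comp_def sum_list_triv)

text \<open>Doubling happens only below \<open>n\<close>, which keeps the length below 2 n; the
  \<open>+ 1\<close> admits the initial length 1 when \<open>n\<close> is 0.\<close>

lemma doubling_fold:
  assumes "length (snd z) = 2 ^ length (fst z)" "length (snd z) \<le> 2 * n + 1"
  shows "let r = fold (\<lambda>_ z. if length (snd z) < n then (() # fst z, snd z @ snd z) else z) B z
    in length (snd r) = 2 ^ length (fst r) \<and> length (snd r) \<le> 2 * n + 1 \<and>
       min n (length (snd z) + length B) \<le> length (snd r)"
  using assms
proof (induction B arbitrary: z)
  case (Cons u B)
  let ?z = "if length (snd z) < n then (() # fst z, snd z @ snd z) else z"
  have "length (snd z) \<noteq> 0" using Cons.prems(1) by simp
  then obtain m where "length (snd z) = Suc m" using not0_implies_Suc by blast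
  then have "min n (length (snd z) + length (u # B)) \<le> min n (length (snd ?z) + length B)" by auto
  moreover have "length (snd ?z) = 2 ^ length (fst ?z)" "length (snd ?z) \<le> 2 * n + 1"
    using Cons.prems by auto
  note Cons.IH[OF this]
  ultimately show ?case by (auto simp: Let_def)
qed simp

lemma doubling:
  shows "length (snd (doubling B)) = 2 ^ length (fst (doubling B))" "length B \<le> length (snd (doubling B))"
  using doubling_fold[of "([], [()])" "length B" B] by (auto simp: doubling_def Let_def)

lemma sz_unit_list: "sz (us :: unit list) = 2 * length us + 1"
  by (induction us) (auto simp: enc_unit_def)

lemma ptime_doubling [ptime_intros]:
  assumes "ptime_on D B"
  shows "ptime_on D (\<lambda>x. doubling (B x))"
proof (rule ptime_comp[OF _ assms])
  show "ptime doubling"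
    unfolding doubling_def
  proof (rule ptime_fold)
    show "poly_bounded UNIV (\<lambda>B :: unit list. 7 + 8 * sz B)"
      by (intro poly_bounded_intros)
    fix B :: "unit list" and k
    let ?r = "fold (\<lambda>_ z. if length (snd z) < length B then (() # fst z, snd z @ snd z) else z) (take k B) ([], [()])"
    have r: "length (snd ?r) = 2 ^ length (fst ?r)" "length (snd ?r) \<le> 2 * length B + 1"
      using doubling_fold[of "([], [()])" "length B" "take k B"] by (auto simp: Let_def)
    have "length (fst ?r) < length (snd ?r)" unfolding r(1) by (rule less_exp)
    then have "sz ?r \<le> Suc (2 * (2 * length B + 1) + 1 + (2 * (2 * length B + 1) + 1))"
      unfolding enc_prod_eq[of ?r] vsize.simps sz_unit_list Suc_le_mono
      using r(2) by (intro add_mono mult_left_mono order_refl) linarith+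
    then show "sz ?r \<le> 7 + 8 * sz B"
      by (simp add: sz_unit_list)
  qed (intro ptime_intros)+
qed

lemma ptime_iterations [ptime_intros]:
  assumes "ptime_on D I"
  shows "ptime_on D (\<lambda>x. iterations (I x))"
  unfolding iterations_def Let_def by (intro ptime_intros assms)

lemma ptime_averaged [ptime_intros]:
  assumes "ptime_on D I" "ptime_on D r"
  shows "ptime_on D (\<lambda>x. averaged (I x) (r x))"
  unfolding averaged_def by (intro ptime_intros assms)

lemma ptime_rounded [ptime_intros]:
  assumes "ptime_on D I" "ptime_on D r"
  shows "ptime_on D (\<lambda>x. rounded (I x) (r x))"
  unfolding rounded_def by (intro ptime_intros assms)

lemma ptime_assigned [ptime_intros]:
  assumes "ptime_on D I" "ptime_on D r"
  shows "ptime_on D (\<lambda>x. assigned (I x) (r x))"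
proof (rule ptime_comp2[OF _ assms])
  show "ptime (\<lambda>z. assigned (fst z) (snd z))"
    unfolding assigned_def by (intro ptime_intros)
qed

lemma ptime_count_where [ptime_intros]:
  assumes "ptime (\<lambda>z. P (fst z) (snd z))" "ptime_on D I"
  shows "ptime_on D (\<lambda>x. count_where (P x) (I x))"
  unfolding count_where_def by (intro ptime_intros assms)

lemma ptime_fair_class [ptime_intros]:
  assumes "ptime_on D I" "ptime_on D \<phi>" "ptime_on D c" "ptime_on D h"
  shows "ptime_on D (\<lambda>x. fair_class (I x) (\<phi> x) (c x) (h x))"
proof -
  have "ptime (\<lambda>z. fair_class (fst z) (fst (snd z)) (fst (snd (snd z))) (snd (snd (snd z))))"
    unfolding fair_class_def Let_def by (intro ptime_intros)
  from ptime_comp[OF this ptime_pair[OF assms(1) ptime_pair[OF assms(2) ptime_pair[OF assms(3,4)]]]]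
  show ?thesis by simp
qed

lemma ptime_accepted [ptime_intros]:
  assumes "ptime_on D I" "ptime_on D r" "ptime_on D \<phi>"
  shows "ptime_on D (\<lambda>x. accepted (I x) (r x) (\<phi> x))"
proof (rule ptime_comp3[OF _ assms])
  show "ptime (\<lambda>z. accepted (fst z) (fst (snd z)) (snd (snd z)))"
    unfolding accepted_def by (intro ptime_intros)
qed

lemma ptime_solutions [ptime_intros]:
  assumes "ptime_on D I"
  shows "ptime_on D (\<lambda>x. solutions (I x))"
proof (rule ptime_comp[OF _ assms])
  show "ptime solutions"
    unfolding solutions_def by (intro ptime_intros)
qed

lemma ptime_best_solution [ptime_intros]:
  assumes "ptime_on D I"
  shows "ptime_on D (\<lambda>x. best_solution (I x))"
proof (rule ptime_comp[OF _ assms])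
  show "ptime best_solution"
    unfolding best_solution_def by (intro ptime_intros)
qed

section \<open>Correctness\<close>

lemma count_where_eq: "count_where P I = (\<Sum>p<length (cols_of I). of_bool (P p))"
proof -
  have "int (length (filter P [0..<n])) = (\<Sum>p<n. of_bool (P p))" for n
    by (induction n) auto
  then show ?thesis by (simp add: count_where_def)
qed

lemma count_where_le: "count_where P I \<le> int (length (cols_of I))"
  using length_filter_le[of P "[0..<length (cols_of I)]"] by (simp add: count_where_def)

lemma cnt_partition:
  assumes "\<forall>e\<in>set S. fst (fst e) < n"
  shows "cnt Q S = (\<Sum>p<n. cnt (\<lambda>e. Q e \<and> fst (fst e) = p) S)"
  using assms
proof (induction S)
  case (Cons e S)
  have "(\<Sum>p<n. of_bool (Q e \<and> fst (fst e) = p)) = (\<Sum>p<n. if p = fst (fst e) then of_bool (Q e) else 0 :: int)"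
    by (intro sum.cong) auto
  also have "\<dots> = of_bool (Q e)" using Cons.prems by simp
  finally show ?case using Cons by (simp add: cnt_sum sum.distrib)
qed (simp add: cnt_def)

lemma score_eq:
  "score S (c, h, a, b) = a * cnt (\<lambda>e. snd e = c \<and> snd (fst e) = h) S +
     b * (cnt (\<lambda>e. snd e = c) S - cnt (\<lambda>e. snd e = c \<and> snd (fst e) = h) S)"
  by (induction S) (auto simp: score_def cnt_def weight_def algebra_simps)

lemma int_ceil_bounds:
  fixes a b :: int
  assumes "0 < b"
  shows "a \<le> - (- a div b) * b" "- (- a div b) * b \<le> a + b - 1"
proof -
  have "- a = (- a div b) * b + (- a) mod b" by simp
  moreover have "0 \<le> (- a) mod b" "(- a) mod b \<le> b - 1" using assms by simp_all
  ultimately show "a \<le> - (- a div b) * b" "- (- a div b) * b \<le> a + b - 1"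
    by (simp_all only: mult_minus_left)
qed

lemma int_floor_bounds:
  fixes a b :: int
  assumes "0 < b"
  shows "(a div b) * b \<le> a" "a - b + 1 \<le> (a div b) * b"
proof -
  have "a = (a div b) * b + a mod b" by simp
  moreover have "0 \<le> a mod b" "a mod b \<le> b - 1" using assms by simp_all
  ultimately show "(a div b) * b \<le> a" "a - b + 1 \<le> (a div b) * b" by linarith+
qed

text \<open>Let u = a/b. After division by \<open>T\<close>, y < Y/T + 1 and M/T < m + 1. The grid
  value \<open>U\<close> exceeds u K by less than 1, and the solver adds an error of 1. Hence y - 2
  exceeds u m by at most (m + 2)/K - (1 - u). If 1 - u \<ge> 1/n this is nonpositive, as m + 2 \<le>
  4 n = K/n. Otherwise (1 - u) m < 1, and y \<le> m alone gives the bound.\<close>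

lemma upper_rounding:
  fixes a b K n m y :: int
  assumes ab: "0 \<le> a" "a \<le> b" "0 < b" and K: "K = 4 * n * n" and n: "1 \<le> n"
    and U: "U * b \<le> a * K + b - 1" "0 \<le> U" and T: "1 \<le> T"
    and avg: "K * Y - U * M \<le> T" and y: "T * y - Y \<le> T - 1" and m: "M - T * m \<le> T - 1"
    and my: "y \<le> m" "0 \<le> m" "m \<le> n"
  shows "b * (y - 2) \<le> a * m"
proof (cases "b \<le> n * (b - a)")
  case True
  have K0: "0 < K" using K n by simp
  have "K * (T * y) \<le> K * (Y + T)" using y T K0 by (intro mult_left_mono) auto
  moreover have "U * M \<le> U * (T * m + T)" using m U(2) by (intro mult_left_mono) auto
  ultimately have "T * (K * y) \<le> T * (U * m + U + 1 + K)" using avg by (simp add: algebra_simps)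
  then have "K * y \<le> U * m + U + 1 + K" using T by simp
  then have "b * (K * y) \<le> b * (U * m + U + 1 + K)" using ab by (intro mult_left_mono) auto
  moreover have "(U * b) * (m + 1) \<le> (a * K + b) * (m + 1)" using U my by (intro mult_right_mono) auto
  ultimately have 1: "K * (b * (y - 2)) \<le> K * (a * m) - K * (b - a) + b * (m + 2)"
    by (simp add: algebra_simps)
  have "b * (m + 2) \<le> b * (4 * n)" using my n ab by (intro mult_left_mono) auto
  also have "\<dots> = 4 * n * b" by simp
  also have "\<dots> \<le> 4 * n * (n * (b - a))" using True n by (intro mult_left_mono) auto
  also have "\<dots> = K * (b - a)" by (simp add: K)
  finally have "K * (b * (y - 2)) \<le> K * (a * m)" using 1 by linarith
  then show ?thesis using K0 by simp
next
  case False
  have "(b - a) * m \<le> (b - a) * n" using my ab by (intro mult_left_mono) auto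
  moreover have "b * y \<le> b * m" using my ab by simp
  moreover have "(b - a) * m = b * m - a * m" "(b - a) * n = n * (b - a)" "b * (y - 2) = b * y - 2 * b"
    by (simp_all add: algebra_simps)
  ultimately show ?thesis using False ab by linarith
qed

text \<open>As for the upper bound, with l = a/b and a deficit of at most (m + 1)/K - (1 - l). If 1
  - l < 1/n, the hypothesis \<open>mono\<close> takes over; it will hold because all points then
  have the color in question.\<close>

lemma lower_rounding:
  fixes a b K n m y :: int
  assumes ab: "0 \<le> a" "a \<le> b" "0 < b" and K: "K = 4 * n * n" and n: "1 \<le> n"
    and L: "a * K - b + 1 \<le> L * b" "L * b \<le> a * K" "0 \<le> L" and T: "1 \<le> T"
    and avg: "L * M - K * Y \<le> T" and y: "Y - T * y \<le> T - 1" and m: "T * m - M \<le> T - 1"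
    and my: "0 \<le> m" "m \<le> n" and mono: "n * (b - a) < b \<Longrightarrow> m \<le> y"
  shows "a * m \<le> b * (y + 2)"
proof (cases "b \<le> n * (b - a)")
  case True
  have K0: "0 < K" using K n by simp
  have "K * Y \<le> K * (T * y + T)" using y T K0 by (intro mult_left_mono) auto
  moreover have "L * (T * m - T) \<le> L * M" using m L(3) by (intro mult_left_mono) auto
  ultimately have "T * (L * m) \<le> T * (K * y + K + L + 1)" using avg by (simp add: algebra_simps)
  then have "L * m \<le> K * y + K + L + 1" using T by simp
  then have "b * (L * m) \<le> b * (K * y + K + L + 1)" using ab by (intro mult_left_mono) auto
  moreover have "(a * K - b) * m \<le> (L * b) * m" using L my by (intro mult_right_mono) auto
  ultimately have 1: "K * (a * m) \<le> K * (b * (y + 2)) - K * (b - a) + b * (m + 1)"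
    using L(2) by (simp add: algebra_simps)
  have "b * (m + 1) \<le> b * (4 * n)" using my n ab by (intro mult_left_mono) auto
  also have "\<dots> = 4 * n * b" by simp
  also have "\<dots> \<le> 4 * n * (n * (b - a))" using True n by (intro mult_left_mono) auto
  also have "\<dots> = K * (b - a)" by (simp add: K)
  finally have "K * (a * m) \<le> K * (b * (y + 2))" using 1 by linarith
  then show ?thesis using K0 by simp
next
  case False
  have "a * m \<le> b * m" using ab my by (intro mult_right_mono) auto
  also have "\<dots> \<le> b * (y + 2)" using mono False ab by (intro mult_left_mono) auto
  finally show ?thesis .
qed

text \<open>The case in which the exactly fair assignment \<open>f\<close> of radius
  \<open>r\<close> exists; \<open>f\<close> is unknown to the algorithm and only serves as a
  comparison. The conditions on the fractions are stated for all \<open>h\<close>, as the default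
  0/1 satisfies them.\<close>

locale exact_assignment =
  fixes I :: assignment_input and r :: frac and f :: "nat \<Rightarrow> nat"
  assumes nonempty: "cols_of I \<noteq> []"
    and lowers: "\<And>h. 0 \<le> fst (lookup (0, 1) (lowers_of I) h)"
      "\<And>h. fst (lookup (0, 1) (lowers_of I) h) \<le> snd (lookup (0, 1) (lowers_of I) h)"
      "\<And>h. 0 < snd (lookup (0, 1) (lowers_of I) h)"
    and uppers: "\<And>h. 0 \<le> fst (lookup (0, 1) (uppers_of I) h)"
      "\<And>h. fst (lookup (0, 1) (uppers_of I) h) \<le> snd (lookup (0, 1) (uppers_of I) h)"
      "\<And>h. 0 < snd (lookup (0, 1) (uppers_of I) h)"
    and center: "\<And>p. p < length (cols_of I) \<Longrightarrow> f p \<in> set (centers_of I)"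
    and radius: "\<And>p. p < length (cols_of I) \<Longrightarrow> frac_le (dist_of I p (f p)) r"
    and fair_lower: "\<And>c h. c \<in> set (centers_of I) \<Longrightarrow> h < length (lowers_of I) \<Longrightarrow>
      fst (lookup (0, 1) (lowers_of I) h) * count_where (\<lambda>p. f p = c) I
      \<le> snd (lookup (0, 1) (lowers_of I) h) * count_where (\<lambda>p. f p = c \<and> lookup 0 (cols_of I) p = h) I"
    and fair_upper: "\<And>c h. c \<in> set (centers_of I) \<Longrightarrow> h < length (lowers_of I) \<Longrightarrow>
      snd (lookup (0, 1) (uppers_of I) h) * count_where (\<lambda>p. f p = c \<and> lookup 0 (cols_of I) p = h) I
      \<le> fst (lookup (0, 1) (uppers_of I) h) * count_where (\<lambda>p. f p = c) I"
begin

abbreviation "n \<equiv> length (cols_of I)"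
abbreviation "col \<equiv> lookup 0 (cols_of I)"
abbreviation "K \<equiv> grid I"
abbreviation "T \<equiv> int (length (snd (iterations I)))"

lemma n_pos: "1 \<le> int n"
  using nonempty by (cases "cols_of I") auto

lemma K_eq: "K = 4 * int n * int n"
  by (simp add: grid_def)

lemma K_pos: "0 < K"
  unfolding K_eq using n_pos by (intro mult_pos_pos) auto

lemma grid_upper:
  "fst (lookup (0, 1) (uppers_of I) h) * K \<le> grid_upper I h * snd (lookup (0, 1) (uppers_of I) h)"
  "grid_upper I h * snd (lookup (0, 1) (uppers_of I) h)
    \<le> fst (lookup (0, 1) (uppers_of I) h) * K + snd (lookup (0, 1) (uppers_of I) h) - 1"
  "0 \<le> grid_upper I h" "grid_upper I h \<le> K"
proof -
  let ?a = "fst (lookup (0, 1) (uppers_of I) h)" and ?b = "snd (lookup (0, 1) (uppers_of I) h)"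
  let ?U = "grid_upper I h"
  show 1: "?a * K \<le> ?U * ?b" "?U * ?b \<le> ?a * K + ?b - 1"
    unfolding grid_upper_def using int_ceil_bounds[OF uppers(3), of "?a * K" h] by auto
  have "0 \<le> ?U * ?b" using 1(1) uppers(1)[of h] K_pos by (meson mult_nonneg_nonneg order_trans less_imp_le)
  then show "0 \<le> ?U" using uppers(3)[of h] by (simp add: zero_le_mult_iff)
  have "?a * K \<le> ?b * K" using uppers(2)[of h] K_pos by simp
  then have "?U * ?b < (K + 1) * ?b" using 1(2) by (simp add: algebra_simps)
  then show "?U \<le> K" using uppers(3)[of h] by simp
qed

lemma grid_lower:
  "grid_lower I h * snd (lookup (0, 1) (lowers_of I) h) \<le> fst (lookup (0, 1) (lowers_of I) h) * K"
  "fst (lookup (0, 1) (lowers_of I) h) * K - snd (lookup (0, 1) (lowers_of I) h) + 1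
    \<le> grid_lower I h * snd (lookup (0, 1) (lowers_of I) h)"
  "0 \<le> grid_lower I h" "grid_lower I h \<le> K"
proof -
  let ?a = "fst (lookup (0, 1) (lowers_of I) h)" and ?b = "snd (lookup (0, 1) (lowers_of I) h)"
  let ?L = "grid_lower I h"
  show 1: "?L * ?b \<le> ?a * K" "?a * K - ?b + 1 \<le> ?L * ?b"
    unfolding grid_lower_def using int_floor_bounds[OF lowers(3), of "?a * K" h] by auto
  show "0 \<le> ?L"
    unfolding grid_lower_def using lowers(1,3)[of h] K_pos by (simp add: pos_imp_zdiv_nonneg_iff)
  have "?a * K \<le> ?b * K" using lowers(2)[of h] K_pos by simp
  then have "?L * ?b \<le> K * ?b" using 1(1) by (simp add: algebra_simps)
  then show "?L \<le> K" using lowers(3)[of h] by simp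
qed

lemma set_constraints: "set (constraints I) = (\<Union>c\<in>set (centers_of I). \<Union>h\<in>{..<length (lowers_of I)}.
    {(c, h, K - grid_upper I h, - grid_upper I h), (c, h, grid_lower I h - K, grid_lower I h)})"
  by (simp add: constraints_def atLeast0LessThan)

lemma constraints_cases:
  assumes "i \<in> set (constraints I)"
  obtains c h where "c \<in> set (centers_of I)" "h < length (lowers_of I)"
    "i = (c, h, K - grid_upper I h, - grid_upper I h) \<or> i = (c, h, grid_lower I h - K, grid_lower I h)"
  using assms unfolding set_constraints by blast

lemma constraints_mem:
  assumes "c \<in> set (centers_of I)" "h < length (lowers_of I)"
  shows "(c, h, K - grid_upper I h, - grid_upper I h) \<in> set (constraints I)"
    "(c, h, grid_lower I h - K, grid_lower I h) \<in> set (constraints I)"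
  using assms unfolding set_constraints by blast+

lemma weight_le:
  assumes "i \<in> set (constraints I)"
  shows "\<bar>weight i e\<bar> \<le> K"
  using assms
proof (rule constraints_cases)
  fix c h assume "i = (c, h, K - grid_upper I h, - grid_upper I h) \<or> i = (c, h, grid_lower I h - K, grid_lower I h)"
  then show ?thesis
    using grid_upper(3,4)[of h] grid_lower(3,4)[of h] K_pos by (auto simp: weight_def abs_le_iff)
qed

lemma constraints_feasible:
  assumes "i \<in> set (constraints I)"
  shows "sum_list (map (\<lambda>z. weight i (fst z, f (fst (fst z)))) (candidates I r)) \<le> 0"
proof -
  have sum: "sum_list (map (\<lambda>z. weight (c, h, a, b) (fst z, f (fst (fst z)))) (candidates I r)) =
    a * count_where (\<lambda>p. f p = c \<and> col p = h) I +
    b * (count_where (\<lambda>p. f p = c) I - count_where (\<lambda>p. f p = c \<and> col p = h) I)" for c h a b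
  proof -
    have "sum_list (map (\<lambda>z. weight (c, h, a, b) (fst z, f (fst (fst z)))) (candidates I r)) =
      sum_list (map (\<lambda>p. weight (c, h, a, b) ((p, col p), f p)) [0..<n])"
      by (simp add: candidates_def comp_def)
    also have "\<dots> = (\<Sum>p<n. weight (c, h, a, b) ((p, col p), f p))"
      by (simp add: interv_sum_list_conv_sum_set_nat atLeast0LessThan)
    also have "\<dots> = (\<Sum>p<n. a * of_bool (f p = c \<and> col p = h) +
       b * (of_bool (f p = c) - of_bool (f p = c \<and> col p = h)))"
      by (intro sum.cong) (auto simp: weight_def)
    finally show ?thesis
      by (simp only: count_where_eq sum.distrib sum_subtractf flip: sum_distrib_left)
  qed
  from assms show ?thesis
  proof (rule constraints_cases)
    fix c h assume c: "c \<in> set (centers_of I)" and h: "h < length (lowers_of I)"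
      and i: "i = (c, h, K - grid_upper I h, - grid_upper I h) \<or> i = (c, h, grid_lower I h - K, grid_lower I h)"
    let ?k = "count_where (\<lambda>p. f p = c \<and> col p = h) I" and ?m = "count_where (\<lambda>p. f p = c) I"
    have m: "0 \<le> ?m" by (simp add: count_where_def)
    have "K * ?k \<le> grid_upper I h * ?m"
    proof -
      let ?a = "fst (lookup (0, 1) (uppers_of I) h)" and ?b = "snd (lookup (0, 1) (uppers_of I) h)"
      have "?b * (K * ?k) = K * (?b * ?k)" by simp
      also have "\<dots> \<le> K * (?a * ?m)" using fair_upper[OF c h] K_pos by simp
      also have "\<dots> = (?a * K) * ?m" by simp
      also have "\<dots> \<le> (grid_upper I h * ?b) * ?m" using grid_upper(1) m by (rule mult_right_mono)
      also have "\<dots> = ?b * (grid_upper I h * ?m)" by simp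
      finally show ?thesis using uppers(3) by simp
    qed
    moreover have "grid_lower I h * ?m \<le> K * ?k"
    proof -
      let ?a = "fst (lookup (0, 1) (lowers_of I) h)" and ?b = "snd (lookup (0, 1) (lowers_of I) h)"
      have "?b * (grid_lower I h * ?m) = (grid_lower I h * ?b) * ?m" by simp
      also have "\<dots> \<le> (?a * K) * ?m" using grid_lower(1) m by (rule mult_right_mono)
      also have "\<dots> = K * (?a * ?m)" by simp
      also have "\<dots> \<le> K * (?b * ?k)" using fair_lower[OF c h] K_pos by simp
      also have "\<dots> = ?b * (K * ?k)" by simp
      finally show ?thesis using lowers(3) by simp
    qed
    ultimately have "(K - grid_upper I h) * ?k + - grid_upper I h * (?m - ?k) \<le> 0"
      "(grid_lower I h - K) * ?k + grid_lower I h * (?m - ?k) \<le> 0"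
      by (simp_all add: algebra_simps)
    then show ?thesis using i by (elim disjE) (simp_all only: sum)
  qed
qed

lemma candidate_center:
  "z \<in> set (candidates I r) \<Longrightarrow> f (fst (fst z)) \<in> set (snd z)"
  using center radius by (auto simp: candidates_def)

text \<open>For K = 4 n^2 the left side is 16 n^6 times the number of constraints, which explains
  the six repetitions over the columns and the 16 units in \<open>iterations\<close>.\<close>

lemma T_large: "int (length (constraints I)) * (int (length (candidates I r)))\<^sup>2 * K\<^sup>2 \<le> T"
proof -
  have "length (constraints I) * (n * (n * (n * (n * (n * (n * 16)))))) \<le> length (snd (iterations I))"
    using doubling(2)[of "repeat_for (constraints I) (repeat_for (cols_of I) (repeat_for (cols_of I) (repeat_for (cols_of I)
      (repeat_for (cols_of I) (repeat_for (cols_of I) (repeat_for (cols_of I) (replicate 16 ())))))))"]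
    unfolding iterations_def Let_def length_repeat_for length_replicate .
  then have "int (length (constraints I) * (n * (n * (n * (n * (n * (n * 16))))))) \<le> T"
    by (rule of_nat_mono)
  then have "int (length (constraints I)) * int n ^ 6 * 16 \<le> T"
    by (simp add: eval_nat_numeral ac_simps)
  moreover have "(int (length (candidates I r)))\<^sup>2 * K\<^sup>2 = int n ^ 6 * 16"
    by (simp add: candidates_def K_eq power_mult_distrib power_numeral_reduce)
  ultimately show ?thesis by (simp add: mult.assoc)
qed

lemma T_eq: "T = 2 ^ length (fst (iterations I))"
  by (simp add: iterations_def doubling(1) Let_def)

text \<open>The accuracy equals the bound \<open>K\<close> on the weights, so both cancel and an
  error of one unit per round remains.\<close>

lemma averaged_score_le: "i \<in> set (constraints I) \<Longrightarrow> score (averaged I r) i \<le> T"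
  using average_score_le[of "candidates I r" "\<lambda>z. f (fst (fst z))" "constraints I" K K "snd (iterations I)" i]
    candidate_center constraints_feasible weight_le T_large K_pos
  by (simp add: averaged_def mult.commute)

lemma rounded_edges:
  assumes "e \<in> set (rounded I r)"
  shows "fst (fst e) < n" "snd (fst e) = col (fst (fst e))" "snd e \<in> set (centers_of I)"
    "frac_le (dist_of I (fst (fst e)) (snd e)) r"
proof -
  have "e \<in> set (averaged I r)" using assms set_halvings unfolding rounded_def by blast
  moreover have "\<And>z. z \<in> set (candidates I r) \<Longrightarrow> snd z \<noteq> []" using candidate_center by force
  ultimately obtain z where "z \<in> set (candidates I r)" "fst e = fst z" "snd e \<in> set (snd z)"
    using average_edges unfolding averaged_def by blast
  then show "fst (fst e) < n" "snd (fst e) = col (fst (fst e))" "snd e \<in> set (centers_of I)"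
    "frac_le (dist_of I (fst (fst e)) (snd e)) r"
    by (auto simp: candidates_def)
qed

abbreviation "\<phi> \<equiv> lookup 0 (assigned I r)"

text \<open>Each point starts with \<open>T\<close> edges, a power of two, and every halving keeps
  exactly half of them, so a single one survives. All edges of a point carry its own color, so
  selecting by point alone gives the same list.\<close>

lemma rounded_at:
  assumes "p < n"
  shows "filter (\<lambda>e. fst (fst e) = p) (rounded I r) = [((p, col p), \<phi> p)]"
proof -
  have "cnt (\<lambda>e. fst e = (p, col p)) (averaged I r) = T"
    unfolding averaged_def
    using assms by (intro cnt_average_point) (auto simp: candidates_def comp_def distinct_map inj_on_def image_image)
  then have "cnt (\<lambda>e. fst e = (p, col p)) (rounded I r) = 1"
    unfolding rounded_def by (intro cnt_halvings_point) (simp add: T_eq)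
  moreover have "filter (\<lambda>e. fst e = (p, col p)) (rounded I r) = filter (\<lambda>e. fst (fst e) = p) (rounded I r)"
    using rounded_edges(2) by (intro filter_cong) (auto simp: prod_eq_iff)
  ultimately have "length (filter (\<lambda>e. fst (fst e) = p) (rounded I r)) = 1"
    by (simp add: cnt_def)
  then obtain e where e: "filter (\<lambda>e. fst (fst e) = p) (rounded I r) = [e]"
    by (auto simp: length_Suc_conv)
  have "e \<in> set (filter (\<lambda>e. fst (fst e) = p) (rounded I r))" unfolding e by simp
  then have "e \<in> set (rounded I r)" "fst (fst e) = p" by simp_all
  moreover have "\<phi> p = snd e"
    using assms e by (simp add: lookup_def assigned_def)
  ultimately show ?thesis using e rounded_edges(2)[of e] by (simp add: prod_eq_iff)
qed

lemma cnt_rounded: "cnt Q (rounded I r) = count_where (\<lambda>p. Q ((p, col p), \<phi> p)) I"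
proof -
  have "cnt Q (rounded I r) = (\<Sum>p<n. cnt (\<lambda>e. Q e \<and> fst (fst e) = p) (rounded I r))"
    by (rule cnt_partition) (use rounded_edges(1) in blast)
  also have "\<dots> = (\<Sum>p<n. of_bool (Q ((p, col p), \<phi> p)))"
  proof (rule sum.cong)
    fix p assume "p \<in> {..<n}"
    then have "filter Q (filter (\<lambda>e. fst (fst e) = p) (rounded I r)) = filter Q [((p, col p), \<phi> p)]"
      using rounded_at by simp
    then show "cnt (\<lambda>e. Q e \<and> fst (fst e) = p) (rounded I r) = of_bool (Q ((p, col p), \<phi> p))"
      by (simp add: cnt_def conj_commute split: if_splits)
  qed simp
  finally show ?thesis by (simp add: count_where_eq)
qed

text \<open>In the cluster of \<open>f p\<close>, exact fairness allows at most (1 - l) m \<le> (1 -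
  l) n < 1 points of other colors, that is, none.\<close>

lemma monochromatic:
  assumes h: "h < length (lowers_of I)" and p: "p < n"
    and l: "int n * (snd (lookup (0, 1) (lowers_of I) h) - fst (lookup (0, 1) (lowers_of I) h))
      < snd (lookup (0, 1) (lowers_of I) h)"
  shows "col p = h"
proof (rule ccontr)
  assume ne: "col p \<noteq> h"
  let ?a = "fst (lookup (0, 1) (lowers_of I) h)" and ?b = "snd (lookup (0, 1) (lowers_of I) h)"
  let ?k = "count_where (\<lambda>q. f q = f p \<and> col q = h) I" and ?m = "count_where (\<lambda>q. f q = f p) I"
  \<comment> \<open>The point \<open>p\<close> itself is counted on the right but not on the
    left.\<close>
  have "?k < ?m" unfolding count_where_eq
    by (rule sum_strict_mono_ex1) (use p ne in auto)
  then have "?b * 1 \<le> ?b * (?m - ?k)" using lowers(3)[of h] by (intro mult_left_mono) auto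
  also have "\<dots> \<le> (?b - ?a) * ?m"
    using fair_lower[OF center[OF p] h] by (simp add: algebra_simps)
  also have "\<dots> \<le> (?b - ?a) * int n"
    using lowers(2)[of h] count_where_le by (intro mult_left_mono) auto
  finally show False using l by (simp add: mult.commute)
qed

lemma accepted: "accepted I r (assigned I r)"
  unfolding accepted_def
proof (intro conjI ballI)
  fix p assume "p \<in> set [0..<n]"
  then have "((p, col p), \<phi> p) \<in> set (filter (\<lambda>e. fst (fst e) = p) (rounded I r))"
    using rounded_at[of p] by simp
  then have "((p, col p), \<phi> p) \<in> set (rounded I r)" by simp
  from rounded_edges(3,4)[OF this] show "frac_le (dist_of I p (\<phi> p)) r" "\<exists>c\<in>set (centers_of I). c = \<phi> p"
    by auto
next
  fix c h assume c: "c \<in> set (centers_of I)" and "h \<in> set [0..<length (lowers_of I)]"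
  then have h: "h < length (lowers_of I)" by simp
  let ?Y = "cnt (\<lambda>e. snd e = c \<and> snd (fst e) = h) (averaged I r)"
  let ?M = "cnt (\<lambda>e. snd e = c) (averaged I r)"
  let ?y = "count_where (\<lambda>p. \<phi> p = c \<and> col p = h) I" and ?m = "count_where (\<lambda>p. \<phi> p = c) I"
  have Y: "\<bar>T * ?y - ?Y\<bar> \<le> T - 1"
    using cnt_halvings[OF cnt_halve_class[of c h], of "fst (iterations I)" "averaged I r"]
    by (simp add: T_eq rounded_def[symmetric] cnt_rounded)
  have M: "\<bar>T * ?m - ?M\<bar> \<le> T - 1"
    using cnt_halvings[OF cnt_halve_center[of c], of "fst (iterations I)" "averaged I r"]
    by (simp add: T_eq rounded_def[symmetric] cnt_rounded)
  have T1: "1 \<le> T" by (simp add: T_eq)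
  have m: "0 \<le> ?m" "?m \<le> int n" by (simp add: count_where_def) (rule count_where_le)
  have y: "?y \<le> ?m" unfolding count_where_eq by (rule sum_mono) auto
  have up: "K * ?Y - grid_upper I h * ?M \<le> T"
    using averaged_score_le[OF constraints_mem(1)[OF c h]] by (simp add: score_eq algebra_simps)
  have lo: "grid_lower I h * ?M - K * ?Y \<le> T"
    using averaged_score_le[OF constraints_mem(2)[OF c h]] by (simp add: score_eq algebra_simps)
  let ?l = "lookup (0, 1) (lowers_of I) h" and ?u = "lookup (0, 1) (uppers_of I) h"
  have "snd ?u * (?y - 2) \<le> fst ?u * ?m"
    by (rule upper_rounding[OF uppers K_eq n_pos grid_upper(2,3) T1 up _ _ y m]) (use Y M in auto)
  moreover have "?m \<le> ?y" if "int n * (snd ?l - fst ?l) < snd ?l"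
    unfolding count_where_eq using monochromatic[OF h _ that] by (intro sum_mono) auto
  then have "fst ?l * ?m \<le> snd ?l * (?y + 2)"
    by (intro lower_rounding[OF lowers K_eq n_pos grid_lower(2,1,3) T1 lo _ _ m]) (use Y M in auto)
  ultimately show "fair_class I (assigned I r) c h"
    by (simp add: fair_class_def Let_def)
qed

end

text \<open>With positive denominators \<open>frac_le\<close> is the order of the real quotients
  \<open>v\<close>, so the nonempty list of solutions has a least radius.\<close>

lemma best_solution:
  assumes "p < length (cols_of I)" "c \<in> set (centers_of I)" "accepted I (dist_of I p c) (assigned I (dist_of I p c))"
    and pos: "\<And>p c. 0 < snd (dist_of I p c)"
  obtains s where "accepted I s (best_solution I)" "frac_le s (dist_of I p c)" "0 < snd s"
    "length (best_solution I) = length (cols_of I)"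
proof -
  define v where "v x = real_of_int (fst (fst x)) / real_of_int (snd (fst x))" for x :: "frac \<times> nat list"
  have sol: "0 < snd (fst x) \<and> accepted I (fst x) (snd x) \<and> length (snd x) = length (cols_of I)"
    if "x \<in> set (solutions I)" for x
    using that pos by (auto simp: solutions_def assigned_def)
  have le: "frac_le (fst x) (fst y) \<longleftrightarrow> v x \<le> v y" if "x \<in> set (solutions I)" "y \<in> set (solutions I)" for x y
  proof -
    have "v x \<le> v y \<longleftrightarrow> real_of_int (fst (fst x)) * real_of_int (snd (fst y)) \<le> real_of_int (fst (fst y)) * real_of_int (snd (fst x))"
      using sol[OF that(1)] sol[OF that(2)] by (simp add: v_def divide_simps mult.commute)
    also have "\<dots> \<longleftrightarrow> frac_le (fst x) (fst y)"
      unfolding frac_le_def by (simp only: of_int_mult[symmetric] of_int_le_iff)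
    finally show ?thesis by simp
  qed
  let ?x = "(dist_of I p c, assigned I (dist_of I p c))"
  have x: "?x \<in> set (solutions I)"
    using assms by (auto simp: solutions_def)
  then have "solutions I \<noteq> []" by auto
  then obtain y where y: "y \<in> set (solutions I)" "\<And>z. z \<in> set (solutions I) \<Longrightarrow> v y \<le> v z"
    using ex_min_if_finite[of "v ` set (solutions I)"] by (force simp: not_less)
  define F where "F = filter (\<lambda>x. \<forall>y\<in>set (solutions I). frac_le (fst x) (fst y)) (solutions I)"
  have F: "z \<in> set F \<longleftrightarrow> z \<in> set (solutions I) \<and> (\<forall>y\<in>set (solutions I). frac_le (fst z) (fst y))" for z
    by (simp add: F_def)
  have "y \<in> set F" using y le F by blast
  then have "F \<noteq> []" by auto
  then have "hd F \<in> set F" by simp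
  then have z: "hd F \<in> set (solutions I)" "frac_le (fst (hd F)) (fst ?x)" using x F by blast+
  have "best_solution I = snd (hd F)" by (simp add: best_solution_def F_def)
  then show ?thesis
    using that[of "fst (hd F)"] z sol[OF z(1)] by simp
qed

subsection \<open>Encodings\<close>

lemma enc_list_eq: "enc xs = val_of_list (map enc xs)"
  by (induction xs) (simp_all add: val_of_list_def)

lemma enc_nat_eq: "enc = val_of_nat"
  by (auto simp: enc_nat_def val_of_nat_def)

lemma enc_int_eq: "enc = Num"
  by (auto simp: enc_int_def)

lemma enc_quotient_of: "enc (quotient_of r) = val_of_rat r"
  by (simp add: val_of_rat_def enc_prod_eq enc_int_def case_prod_beta)

text \<open>Allows the center list to be read back from the encoded output of the given
  program.\<close>

lemma enc_nat_list_inject: "enc (xs :: nat list) = enc ys \<Longrightarrow> xs = ys"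
proof (induction xs arbitrary: ys)
  case (Cons x xs)
  then show ?case by (cases ys) (auto simp: enc_nat_def)
next
  case (Nil ys)
  then show ?case by (cases ys) auto
qed

text \<open>Instances contain functions and cannot be encoded by type; these tuples can. The final
  \<open>unit\<close> is encoded as 0, the end mark of \<open>val_of_list\<close>, so that a tuple
  has the encoding of a list of values of different types.\<close>

type_synonym ds_input = "nat \<times> frac list list \<times> nat \<times> nat \<times> nat list \<times> int list \<times> int list \<times> unit"
type_synonym gfds_input = "ds_input \<times> frac list \<times> frac list \<times> unit"

definition distance_table :: "'b ds_instance_scheme \<Rightarrow> frac list list" where
  "distance_table G = map (\<lambda>p. map (\<lambda>q. quotient_of (pdist G p q)) [0..<npoints G]) [0..<npoints G]"

definition color_table :: "'b ds_instance_scheme \<Rightarrow> nat list" where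
  "color_table G = map (color G) [0..<npoints G]"

definition lower_table :: "'b gfds_instance_scheme \<Rightarrow> frac list" where
  "lower_table G = map (\<lambda>h. quotient_of (gf_lower G h)) [0..<ncolors G]"

definition upper_table :: "'b gfds_instance_scheme \<Rightarrow> frac list" where
  "upper_table G = map (\<lambda>h. quotient_of (gf_upper G h)) [0..<ncolors G]"

definition ds_input :: "'b ds_instance_scheme \<Rightarrow> ds_input" where
  "ds_input G = (npoints G, distance_table G, kbound G, ncolors G, color_table G,
     map (ds_lower G) [0..<ncolors G], map (ds_upper G) [0..<ncolors G], ())"

definition gfds_input :: "'b gfds_instance_scheme \<Rightarrow> gfds_input" where
  "gfds_input G = (ds_input G, lower_table G, upper_table G, ())"

definition assignment_input :: "'b gfds_instance_scheme \<Rightarrow> nat list \<Rightarrow> assignment_input" where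
  "assignment_input G cs = (distance_table G, color_table G, lower_table G, upper_table G, cs)"

lemma enc_ds_input: "enc (ds_input G) = enc_ds G"
  by (simp add: ds_input_def enc_ds_def distance_table_def color_table_def enc_list_eq enc_nat_eq enc_int_eq
      enc_quotient_of comp_def enc_unit_def val_of_list_def[of "_ # _"] val_of_list_def[of "[]"])

lemma enc_gfds_input: "enc (gfds_input G) = enc_gfds G"
  by (simp add: gfds_input_def enc_ds_input enc_gfds_def lower_table_def upper_table_def enc_list_eq
      enc_quotient_of comp_def enc_unit_def val_of_list_def[of "_ # _"] val_of_list_def[of "[]"])

lemma frac_le_quotient_of: "frac_le (quotient_of a) (quotient_of b) \<longleftrightarrow> a \<le> b"
  unfolding rat_less_eq_code frac_le_def by (auto simp: case_prod_beta mult.commute)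

lemma quotient_of_frac: "r = of_int (fst (quotient_of r)) / of_int (snd (quotient_of r))"
  by (rule quotient_of_div) simp

lemma quotient_of_snd_pos: "0 < snd (quotient_of r)"
  by (rule quotient_of_denom_pos')

lemma of_rat_quotient_mult_le_iff:
  "real_of_rat r * real_of_int m \<le> real_of_int k \<longleftrightarrow> fst (quotient_of r) * m \<le> snd (quotient_of r) * k"
  "real_of_int k \<le> real_of_rat r * real_of_int m \<longleftrightarrow> snd (quotient_of r) * k \<le> fst (quotient_of r) * m"
proof -
  define a b where "a = fst (quotient_of r)" and "b = snd (quotient_of r)"
  have b: "0 < b" by (simp add: b_def quotient_of_snd_pos)
  have "real_of_rat r = real_of_int a / real_of_int b"
    by (subst quotient_of_frac) (simp add: a_def b_def of_rat_divide)
  then have *: "real_of_rat r * real_of_int m = real_of_int (a * m) / real_of_int b" by simp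
  have "real_of_rat r * real_of_int m \<le> real_of_int k \<longleftrightarrow> real_of_int (a * m) \<le> real_of_int (b * k)"
    unfolding * using b by (simp add: divide_simps mult.commute)
  then show "real_of_rat r * real_of_int m \<le> real_of_int k \<longleftrightarrow> fst (quotient_of r) * m \<le> snd (quotient_of r) * k"
    unfolding of_int_le_iff a_def b_def .
  have "real_of_int k \<le> real_of_rat r * real_of_int m \<longleftrightarrow> real_of_int (b * k) \<le> real_of_int (a * m)"
    unfolding * using b by (simp add: divide_simps mult.commute)
  then show "real_of_int k \<le> real_of_rat r * real_of_int m \<longleftrightarrow> snd (quotient_of r) * k \<le> fst (quotient_of r) * m"
    unfolding of_int_le_iff a_def b_def .
qed

lemma quotient_of_unit_interval:
  assumes "0 \<le> r" "r \<le> 1"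
  shows "0 \<le> fst (quotient_of r)" "fst (quotient_of r) \<le> snd (quotient_of r)"
  using frac_le_quotient_of[of 0 r] frac_le_quotient_of[of r 1] assms by (simp_all add: frac_le_def)

subsection \<open>Optimal solutions\<close>

lemma kcenter_cost_le_iff:
  assumes "finite P" "P \<noteq> {}"
  shows "kcenter_cost P d \<phi> \<le> r \<longleftrightarrow> (\<forall>p\<in>P. d p (\<phi> p) \<le> r)"
  unfolding kcenter_cost_def using assms by (subst Max_le_iff) auto

lemma dist_le_kcenter_cost: "finite P \<Longrightarrow> p \<in> P \<Longrightarrow> d p (\<phi> p) \<le> kcenter_cost P d \<phi>"
  unfolding kcenter_cost_def by (intro Max_ge) auto

text \<open>There are infinitely many assignments as functions on the whole type, but every cost is
  one of the finitely many distances within \<open>P\<close>.\<close>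

lemma finite_costs:
  assumes "finite P" "P \<noteq> {}" "\<forall>C \<phi>. feas C \<phi> \<longrightarrow> \<phi> ` P \<subseteq> P"
  shows "finite {kcenter_cost P d \<phi> | C \<phi>. feas C \<phi>}"
proof (rule finite_subset)
  show "{kcenter_cost P d \<phi> | C \<phi>. feas C \<phi>} \<subseteq> (\<lambda>(p, q). d p q) ` (P \<times> P)"
  proof safe
    fix C \<phi> assume "feas C \<phi>"
    have "kcenter_cost P d \<phi> \<in> (\<lambda>p. d p (\<phi> p)) ` P"
      unfolding kcenter_cost_def using assms(1,2) by (intro Max_in) auto
    then obtain p where "p \<in> P" "kcenter_cost P d \<phi> = d p (\<phi> p)" by blast
    moreover have "\<phi> p \<in> P" using assms(3) \<open>feas C \<phi>\<close> \<open>p \<in> P\<close> by blast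
    ultimately show "kcenter_cost P d \<phi> \<in> (\<lambda>(p, q). d p q) ` (P \<times> P)"
      by (intro image_eqI[of _ _ "(p, \<phi> p)"]) auto
  qed
qed (use assms(1) in simp)

lemma opt_cost_le:
  assumes "finite P" "P \<noteq> {}" "\<forall>C \<phi>. feas C \<phi> \<longrightarrow> \<phi> ` P \<subseteq> P" "feas C \<phi>"
  shows "opt_cost P d feas \<le> kcenter_cost P d \<phi>"
  unfolding opt_cost_def by (rule Min_le[OF finite_costs[OF assms(1-3)]]) (use assms(4) in auto)

lemma opt_cost_attained:
  assumes "finite P" "P \<noteq> {}" "\<forall>C \<phi>. feas C \<phi> \<longrightarrow> \<phi> ` P \<subseteq> P" "feas C0 \<phi>0"
  obtains C \<phi> where "feas C \<phi>" "kcenter_cost P d \<phi> = opt_cost P d feas"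
proof -
  have "opt_cost P d feas \<in> {kcenter_cost P d \<phi> | C \<phi>. feas C \<phi>}"
    unfolding opt_cost_def by (rule Min_in[OF finite_costs[OF assms(1-3)]]) (use assms(4) in auto)
  then show ?thesis using that by auto
qed

text \<open>
  A negative factor is impossible, since all solutions of the instance with one center for two
  points at distance 1 have positive cost.
\<close>

lemma ds_approx_algorithm_nonneg:
  assumes "ds_approx_algorithm \<alpha> A"
  shows "0 \<le> \<alpha>"
proof (rule ccontr)
  assume neg: "\<not> 0 \<le> \<alpha>"
  define J :: ds_instance where "J = \<lparr>npoints = 2, pdist = \<lambda>p q. if p = q then 0 else 1, kbound = 1,
    ncolors = 1, color = \<lambda>_. 0, ds_lower = \<lambda>_. 0, ds_upper = \<lambda>_. 2\<rparr>"
  have P: "points J = {0, 1}" by (auto simp: points_def J_def)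
  have d: "metric J p q = (if p = q then 0 else 1)" for p q by (simp add: metric_def J_def)
  have feas: "ds_feasible J {0} (\<lambda>_. 0)"
  proof -
    have "card ({0 :: nat} \<inter> X) \<le> 2" for X
      using card_mono[of "{0 :: nat}" "{0} \<inter> X"] by simp
    then show ?thesis
      unfolding ds_feasible_def P by (auto simp: k_clustering_def satisfies_DS_def J_def)
  qed
  have valid: "ds_valid J"
    unfolding ds_valid_def ds_wellformed_def
  proof (intro conjI exI)
    show "Metric_space (points J) (metric J)"
      by unfold_locales (auto simp: d)
    show "ds_feasible J {0} (\<lambda>_. 0)" by (rule feas)
  qed (auto simp: J_def colors_def points_def)
  have cost: "1 \<le> kcenter_cost (points J) (metric J) \<phi>" and mem: "\<phi> ` points J \<subseteq> points J"
    if "ds_feasible J C \<phi>" for C \<phi>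
  proof -
    have C: "C \<subseteq> {0, 1}" "card C \<le> 1" "\<phi> 0 \<in> C" "\<phi> 1 \<in> C"
      using that unfolding ds_feasible_def k_clustering_def P by (auto simp: J_def)
    then have "\<phi> 0 = \<phi> 1" using finite_subset[OF C(1)] by (auto simp: card_le_Suc0_iff_eq)
    then obtain p where "p \<in> {0, 1}" "\<phi> p \<noteq> p" by (metis insertCI zero_neq_one)
    then show "1 \<le> kcenter_cost (points J) (metric J) \<phi>"
      using dist_le_kcenter_cost[of "points J" p "metric J" \<phi>] by (auto simp: P d)
    show "\<phi> ` points J \<subseteq> points J" using C by (auto simp: P)
  qed
  obtain C \<phi> where "ds_feasible J C \<phi>"
     "kcenter_cost (points J) (metric J) \<phi> \<le> \<alpha> * opt_cost (points J) (metric J) (ds_feasible J)"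
    using assms valid unfolding ds_approx_algorithm_def solves_in_poly_time_def by blast
  moreover have "1 \<le> opt_cost (points J) (metric J) (ds_feasible J)"
  proof -
    obtain C \<phi> where "ds_feasible J C \<phi>" "kcenter_cost (points J) (metric J) \<phi> = opt_cost (points J) (metric J) (ds_feasible J)"
      by (rule opt_cost_attained[of "points J" "ds_feasible J" _ _ "metric J", OF _ _ _ feas])
        (use mem in \<open>auto simp: P\<close>)
    then show ?thesis using cost by metis
  qed
  then have "\<alpha> * opt_cost (points J) (metric J) (ds_feasible J) < 0" using neg by (simp add: mult_neg_pos)
  ultimately show False using cost by fastforce
qed

section \<open>From the optimal solution to the output\<close>

lemma count_where_card: "count_where P I = int (card {p. p < length (cols_of I) \<and> P p})"
proof -
  have "{p. p < length (cols_of I) \<and> P p} = set (filter P [0..<length (cols_of I)])" by auto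
  then show ?thesis
    unfolding count_where_def using distinct_card[of "filter P [0..<length (cols_of I)]"] by simp
qed

text \<open>The given program is specified for plain DS instances, so the fairness bounds are cut
  off.\<close>

lemma ds_feasible_truncate: "ds_feasible (ds_instance.truncate G) = ds_feasible G"
  by (intro ext) (simp add: ds_feasible_def points_def colors_def color_class_def[abs_def] ds_instance.truncate_def)

lemma ds_valid_truncate:
  assumes "gfds_valid G"
  shows "ds_valid (ds_instance.truncate G)"
proof -
  have [simp]: "metric (ds_instance.truncate G) = metric G" "points (ds_instance.truncate G) = points G"
    "colors (ds_instance.truncate G) = colors G"
    by (auto simp: metric_def[abs_def] points_def colors_def ds_instance.truncate_def)
  have "ds_wellformed (ds_instance.truncate G)"
    using assms by (auto simp: gfds_valid_def ds_wellformed_def) (auto simp: ds_instance.truncate_def)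
  moreover have "\<exists>C \<phi>. ds_feasible G C \<phi>"
    using assms by (auto simp: gfds_valid_def gfds_feasible_def)
  ultimately show ?thesis by (simp add: ds_valid_def ds_feasible_truncate)
qed

text \<open>A merged cluster is a disjoint union of old clusters. Counts therefore add up, and with
  them the fairness inequalities, which are linear in the counts.\<close>

lemma card_merged:
  assumes "finite P" "finite C" "\<forall>p\<in>P. \<phi> p \<in> C"
  shows "card {p \<in> P. \<psi> (\<phi> p) = c \<and> R p} = (\<Sum>c'\<in>{c'\<in>C. \<psi> c' = c}. card {p \<in> P. \<phi> p = c' \<and> R p})"
proof -
  have "{p \<in> P. \<psi> (\<phi> p) = c \<and> R p} = (\<Union>c'\<in>{c'\<in>C. \<psi> c' = c}. {p \<in> P. \<phi> p = c' \<and> R p})"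
    using assms(3) by auto
  then show ?thesis
    using assms(1,2) by (simp only:) (intro card_UN_disjoint; auto)
qed

lemma group_fair_cluster_iff:
  "group_fair (colors G) (color_class G) l u \<rho> (cluster (points G) \<phi> c) \<longleftrightarrow>
   (\<forall>h<ncolors G.
     l h * real (card {p. p < npoints G \<and> \<phi> p = c}) - real \<rho> \<le> real (card {p. p < npoints G \<and> \<phi> p = c \<and> color G p = h}) \<and>
     real (card {p. p < npoints G \<and> \<phi> p = c \<and> color G p = h}) \<le> u h * real (card {p. p < npoints G \<and> \<phi> p = c}) + real \<rho>)"
proof -
  have "cluster (points G) \<phi> c = {p. p < npoints G \<and> \<phi> p = c}"
    "cluster (points G) \<phi> c \<inter> color_class G h = {p. p < npoints G \<and> \<phi> p = c \<and> color G p = h}" for h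
    by (auto simp: cluster_def points_def color_class_def)
  then show ?thesis by (simp add: group_fair_def colors_def lessThan_def)
qed

lemma frac_le_trans:
  assumes "frac_le a b" "frac_le b c" "0 < snd b" "0 < snd a" "0 < snd c"
  shows "frac_le a c"
proof -
  have "fst a * snd b * snd c \<le> fst b * snd a * snd c"
    using assms(1,5) by (simp add: frac_le_def)
  moreover have "fst b * snd c * snd a \<le> fst c * snd b * snd a"
    using assms(2,4) by (simp add: frac_le_def)
  ultimately have "snd b * (fst a * snd c) \<le> snd b * (fst c * snd a)" by (simp add: ac_simps)
  then show ?thesis using assms(3) by (simp add: frac_le_def)
qed

lemma lookup_map_upt: "lookup d (map f [0..<n]) i = (if i < n then f i else d)"
  by (simp add: lookup_def)

lemma dist_of_assignment_input:
  "dist_of (assignment_input G cs) p c = (if p < npoints G \<and> c < npoints G then quotient_of (pdist G p c) else (0, 1))"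
  by (simp add: dist_of_def assignment_input_def distance_table_def lookup_map_upt) (simp add: lookup_def)

lemma assignment_correct:
  fixes G :: gfds_instance
  assumes valid: "gfds_valid G" and \<alpha>: "0 \<le> \<alpha>"
    and \<psi>: "ds_feasible G (set cs) \<psi>"
      "kcenter_cost (points G) (metric G) \<psi> \<le> \<alpha> * opt_cost (points G) (metric G) (ds_feasible G)"
  defines "\<phi> \<equiv> lookup 0 (best_solution (assignment_input G cs))"
  shows "gfds_feasible 2 G (set cs) \<phi>"
    "kcenter_cost (points G) (metric G) \<phi> \<le> (\<alpha> + 1) * opt_cost (points G) (metric G) (gfds_feasible 0 G)"
    "length (best_solution (assignment_input G cs)) = npoints G"
proof -
  let ?P = "points G" and ?d = "metric G" and ?I = "assignment_input G cs"
  define n where "n = npoints G"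
  have wf: "ds_wellformed G" "gf_wellformed G" using valid by (auto simp: gfds_valid_def)
  have n: "1 \<le> n" using wf(1) by (auto simp: ds_wellformed_def n_def)
  have P: "finite ?P" "?P \<noteq> {}" "\<And>p. p \<in> ?P \<longleftrightarrow> p < n"
    using n by (auto simp: points_def n_def lessThan_empty_iff)
  have cols: "cols_of ?I = map (color G) [0..<n]" "length (cols_of ?I) = n"
    and lowers_eq: "lowers_of ?I = map (\<lambda>h. quotient_of (gf_lower G h)) [0..<ncolors G]" "length (lowers_of ?I) = ncolors G"
    and uppers_eq: "uppers_of ?I = map (\<lambda>h. quotient_of (gf_upper G h)) [0..<ncolors G]"
    and centers: "centers_of ?I = cs"
    by (simp_all add: assignment_input_def color_table_def lower_table_def upper_table_def n_def)
  have dist: "dist_of ?I p c = (if p < n \<and> c < n then quotient_of (pdist G p c) else (0, 1))" for p c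
    unfolding n_def by (rule dist_of_assignment_input)
  have cs: "set cs \<subseteq> ?P" "\<And>p. p < n \<Longrightarrow> \<psi> p \<in> set cs"
    using \<psi>(1) by (auto simp: ds_feasible_def k_clustering_def P(3))
  have inside: "\<forall>C \<phi>. ds_feasible G C \<phi> \<longrightarrow> \<phi> ` ?P \<subseteq> ?P" "\<forall>C \<phi>. gfds_feasible 0 G C \<phi> \<longrightarrow> \<phi> ` ?P \<subseteq> ?P"
    by (auto simp: gfds_feasible_def ds_feasible_def k_clustering_def)
  obtain C0 \<phi>0 where "gfds_feasible 0 G C0 \<phi>0" using valid by (auto simp: gfds_valid_def)
  then obtain Co \<phi>o where opt: "gfds_feasible 0 G Co \<phi>o" "kcenter_cost ?P ?d \<phi>o = opt_cost ?P ?d (gfds_feasible 0 G)"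
    by (rule opt_cost_attained[OF P(1,2) inside(2)])
  define OPT where "OPT = opt_cost ?P ?d (gfds_feasible 0 G)"
  have Co: "Co \<subseteq> ?P" "\<And>p. p < n \<Longrightarrow> \<phi>o p \<in> Co" "finite Co"
    using opt(1) finite_subset[OF _ P(1)] by (auto simp: gfds_feasible_def ds_feasible_def k_clustering_def P(3))
  \<comment> \<open>An exactly fair solution is in particular feasible for the DS problem.\<close>
  have "opt_cost ?P ?d (ds_feasible G) \<le> OPT"
    using opt_cost_le[OF P(1,2) inside(1), of Co \<phi>o ?d] opt by (auto simp: gfds_feasible_def OPT_def)
  then have \<psi>_cost: "kcenter_cost ?P ?d \<psi> \<le> \<alpha> * OPT"
    using \<psi>(2) \<alpha> by (meson mult_left_mono order_trans)
  define f where "f p = \<psi> (\<phi>o p)" for p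
  have f: "f p \<in> set cs" "f p < n" if "p < n" for p
    using that Co(1) Co(2)[OF that] cs P(3) unfolding f_def by blast+
  have f_cost: "?d p (f p) \<le> (\<alpha> + 1) * OPT" if p: "p < n" for p
  proof -
    have \<phi>o: "\<phi>o p \<in> ?P" using Co p by blast
    interpret Metric_space ?P ?d using wf(1) by (simp add: ds_wellformed_def)
    have "?d p (f p) \<le> ?d p (\<phi>o p) + ?d (\<phi>o p) (f p)"
      using p \<phi>o f(2)[OF p] by (intro triangle) (auto simp: P(3))
    also have "?d p (\<phi>o p) \<le> OPT"
      using dist_le_kcenter_cost[OF P(1), of p ?d \<phi>o] p opt(2) by (simp add: P(3) OPT_def)
    also have "?d (\<phi>o p) (f p) \<le> \<alpha> * OPT"
      using dist_le_kcenter_cost[OF P(1) \<phi>o, of ?d \<psi>] \<psi>_cost by (simp add: f_def)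
    finally show ?thesis by (simp add: algebra_simps)
  qed
  have fair: "real_of_rat (gf_lower G h) * real (card {p. p < n \<and> f p = c}) \<le> real (card {p. p < n \<and> f p = c \<and> color G p = h})"
    "real (card {p. p < n \<and> f p = c \<and> color G p = h}) \<le> real_of_rat (gf_upper G h) * real (card {p. p < n \<and> f p = c})"
    if h: "h < ncolors G" for c h
  proof -
    let ?S = "{c'\<in>Co. \<psi> c' = c}"
    let ?m = "\<lambda>c'. card {p. p < n \<and> \<phi>o p = c'}" and ?k = "\<lambda>c'. card {p. p < n \<and> \<phi>o p = c' \<and> color G p = h}"
    have m: "card {p. p < n \<and> f p = c} = (\<Sum>c'\<in>?S. ?m c')"
      using card_merged[of "{..<n}" Co \<phi>o \<psi> c "\<lambda>_. True"] Co(2,3) by (simp add: f_def)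
    have k: "card {p. p < n \<and> f p = c \<and> color G p = h} = (\<Sum>c'\<in>?S. ?k c')"
      using card_merged[of "{..<n}" Co \<phi>o \<psi> c "\<lambda>p. color G p = h"] Co(2,3) by (simp add: f_def)
    have *: "real_of_rat (gf_lower G h) * real (?m c') \<le> real (?k c')" "real (?k c') \<le> real_of_rat (gf_upper G h) * real (?m c')"
      if "c' \<in> ?S" for c'
      using opt(1) that h by (auto simp: gfds_feasible_def satisfies_GF_def group_fair_cluster_iff n_def)
    show "real_of_rat (gf_lower G h) * real (card {p. p < n \<and> f p = c}) \<le> real (card {p. p < n \<and> f p = c \<and> color G p = h})"
      unfolding m k of_nat_sum sum_distrib_left by (rule sum_mono) (rule *(1))
    show "real (card {p. p < n \<and> f p = c \<and> color G p = h}) \<le> real_of_rat (gf_upper G h) * real (card {p. p < n \<and> f p = c})"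
      unfolding m k of_nat_sum sum_distrib_left by (rule sum_mono) (rule *(2))
  qed
  have counts: "count_where (\<lambda>p. g p = c) ?I = int (card {p. p < n \<and> g p = c})"
    "count_where (\<lambda>p. g p = c \<and> lookup 0 (cols_of ?I) p = h) ?I = int (card {p. p < n \<and> g p = c \<and> color G p = h})" for g c h
  proof -
    have "{p. p < n \<and> g p = c \<and> lookup 0 (cols_of ?I) p = h} = {p. p < n \<and> g p = c \<and> color G p = h}"
      by (auto simp: cols lookup_map_upt)
    then show "count_where (\<lambda>p. g p = c) ?I = int (card {p. p < n \<and> g p = c})"
      "count_where (\<lambda>p. g p = c \<and> lookup 0 (cols_of ?I) p = h) ?I = int (card {p. p < n \<and> g p = c \<and> color G p = h})"
      by (simp_all only: count_where_card cols(2))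
  qed
  have lower: "lookup (0, 1) (lowers_of ?I) h = (if h < ncolors G then quotient_of (gf_lower G h) else (0, 1))" for h
    by (simp only: lowers_eq lookup_map_upt)
  have upper: "lookup (0, 1) (uppers_of ?I) h = (if h < ncolors G then quotient_of (gf_upper G h) else (0, 1))" for h
    by (simp only: uppers_eq lookup_map_upt)
  have lu: "0 \<le> gf_lower G h" "gf_lower G h \<le> 1" "0 \<le> gf_upper G h" "gf_upper G h \<le> 1" if "h < ncolors G" for h
  proof -
    have "0 \<le> gf_lower G h \<and> gf_lower G h \<le> gf_upper G h \<and> gf_upper G h \<le> 1"
      using wf(2) that by (simp add: gf_wellformed_def colors_def)
    then show "0 \<le> gf_lower G h" "gf_lower G h \<le> 1" "0 \<le> gf_upper G h" "gf_upper G h \<le> 1"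
      by auto
  qed
  \<comment> \<open>A farthest point under \<open>f\<close> turns the radius of \<open>f\<close>
    into a distance between a point and a center, which is among the radii tried.\<close>
  obtain p0 where p0: "p0 < n" "\<And>p. p < n \<Longrightarrow> ?d p (f p) \<le> ?d p0 (f p0)"
  proof -
    have "Max ((\<lambda>p. ?d p (f p)) ` ?P) \<in> (\<lambda>p. ?d p (f p)) ` ?P"
      using P by (intro Max_in) auto
    then obtain p0 where p0: "p0 \<in> ?P" "Max ((\<lambda>p. ?d p (f p)) ` ?P) = ?d p0 (f p0)" by blast
    have "?d p (f p) \<le> ?d p0 (f p0)" if "p < n" for p
      unfolding p0(2)[symmetric] using that P by (intro Max_ge) auto
    then show ?thesis using p0(1) P(3) that by blast
  qed
  define r where "r = dist_of ?I p0 (f p0)"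
  have r: "r = quotient_of (pdist G p0 (f p0))" using p0(1) f by (simp add: r_def dist)
  interpret exact_assignment ?I r f
  proof
    show "cols_of ?I \<noteq> []" using n by (simp add: cols)
    show "0 \<le> fst (lookup (0, 1) (lowers_of ?I) h)"
      "fst (lookup (0, 1) (lowers_of ?I) h) \<le> snd (lookup (0, 1) (lowers_of ?I) h)"
      "0 < snd (lookup (0, 1) (lowers_of ?I) h)"
      "0 \<le> fst (lookup (0, 1) (uppers_of ?I) h)"
      "fst (lookup (0, 1) (uppers_of ?I) h) \<le> snd (lookup (0, 1) (uppers_of ?I) h)"
      "0 < snd (lookup (0, 1) (uppers_of ?I) h)" for h
      using lu[of h] quotient_of_unit_interval quotient_of_snd_pos unfolding lower upper by auto
    show "f p \<in> set (centers_of ?I)" if "p < length (cols_of ?I)" for p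
      using f(1) that by (simp only: cols(2) centers)
    show "frac_le (dist_of ?I p (f p)) r" if "p < length (cols_of ?I)" for p
    proof -
      have p: "p < n" using that by (simp only: cols(2))
      then have "pdist G p (f p) \<le> pdist G p0 (f p0)"
        using p0(2)[OF p] by (simp add: metric_def of_rat_less_eq)
      then show ?thesis using p f(2)[OF p] by (simp add: r dist frac_le_quotient_of)
    qed
    fix c h assume "h < length (lowers_of ?I)"
    then have h: "h < ncolors G" by (simp only: lowers_eq(2))
    show "fst (lookup (0, 1) (lowers_of ?I) h) * count_where (\<lambda>p. f p = c) ?I
      \<le> snd (lookup (0, 1) (lowers_of ?I) h) * count_where (\<lambda>p. f p = c \<and> lookup 0 (cols_of ?I) p = h) ?I"
      unfolding lower counts if_P[OF h] of_rat_quotient_mult_le_iff[symmetric] using fair(1)[OF h] by simp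
    show "snd (lookup (0, 1) (uppers_of ?I) h) * count_where (\<lambda>p. f p = c \<and> lookup 0 (cols_of ?I) p = h) ?I
      \<le> fst (lookup (0, 1) (uppers_of ?I) h) * count_where (\<lambda>p. f p = c) ?I"
      unfolding upper counts if_P[OF h] of_rat_quotient_mult_le_iff[symmetric] using fair(2)[OF h] by simp
  qed
  have acc: "accepted ?I (dist_of ?I p0 (f p0)) (assigned ?I (dist_of ?I p0 (f p0)))"
    using accepted unfolding r_def .
  have pos: "0 < snd (dist_of ?I p c)" for p c
    by (simp add: dist quotient_of_snd_pos)
  have "f p0 \<in> set (centers_of ?I)" using f(1)[OF p0(1)] by (simp only: centers)
  moreover have "p0 < length (cols_of ?I)" using p0(1) by (simp only: cols(2))
  ultimately obtain s where s: "accepted ?I s (best_solution ?I)" "frac_le s (dist_of ?I p0 (f p0))" "0 < snd s"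
    "length (best_solution ?I) = length (cols_of ?I)"
    using best_solution[OF _ _ acc pos] by blast
  show "length (best_solution ?I) = npoints G" using s(4) cols(2) n_def by simp
  have \<phi>_in: "\<phi> p \<in> set cs" and \<phi>_dist: "frac_le (dist_of ?I p (\<phi> p)) s" if "p < n" for p
    using s(1) that unfolding accepted_def cols centers \<phi>_def[symmetric] by auto
  have \<phi>_fair: "fair_class ?I (best_solution ?I) c h" if "c \<in> set cs" "h < ncolors G" for c h
    using s(1) that unfolding accepted_def lowers_eq(2) centers by auto
  have "?d p (\<phi> p) \<le> (\<alpha> + 1) * OPT" if p: "p < n" for p
  proof -
    have "\<phi> p < n" using \<phi>_in[OF p] cs(1) P(3) by blast
    then have "frac_le (quotient_of (pdist G p (\<phi> p))) s"
      using \<phi>_dist[OF p] p by (simp add: dist)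
    moreover have "frac_le s (quotient_of (pdist G p0 (f p0)))"
      using s(2) unfolding r_def[symmetric] r .
    ultimately have "frac_le (quotient_of (pdist G p (\<phi> p))) (quotient_of (pdist G p0 (f p0)))"
      using s(3) by (rule frac_le_trans) (rule quotient_of_snd_pos)+
    then have "?d p (\<phi> p) \<le> ?d p0 (f p0)"
      by (simp add: frac_le_quotient_of metric_def of_rat_less_eq)
    also have "\<dots> \<le> (\<alpha> + 1) * OPT" by (rule f_cost[OF p0(1)])
    finally show ?thesis .
  qed
  then show "kcenter_cost ?P ?d \<phi> \<le> (\<alpha> + 1) * opt_cost ?P ?d (gfds_feasible 0 G)"
    unfolding kcenter_cost_le_iff[OF P(1,2)] OPT_def[symmetric] using P(3) by blast
  have "satisfies_GF ?P (colors G) (color_class G) (\<lambda>h. real_of_rat (gf_lower G h)) (\<lambda>h. real_of_rat (gf_upper G h)) 2 (set cs) \<phi>"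
    unfolding satisfies_GF_def group_fair_cluster_iff n_def[symmetric]
  proof (intro ballI allI impI)
    fix c h assume c: "c \<in> set cs" and h: "h < ncolors G"
    let ?m = "card {p. p < n \<and> \<phi> p = c}" and ?k = "card {p. p < n \<and> \<phi> p = c \<and> color G p = h}"
    have "fst (quotient_of (gf_lower G h)) * int ?m \<le> snd (quotient_of (gf_lower G h)) * (int ?k + 2) \<and>
      snd (quotient_of (gf_upper G h)) * (int ?k - 2) \<le> fst (quotient_of (gf_upper G h)) * int ?m"
      using \<phi>_fair[OF c h]
      unfolding fair_class_def Let_def \<phi>_def[symmetric] counts lower upper if_P[OF h] .
    then show "real_of_rat (gf_lower G h) * real ?m - real 2 \<le> real ?k \<and> real ?k \<le> real_of_rat (gf_upper G h) * real ?m + real 2"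
      unfolding of_rat_quotient_mult_le_iff[symmetric] by simp
  qed
  moreover have "ds_feasible G (set cs) \<phi>"
    using \<psi>(1) \<phi>_in by (auto simp: ds_feasible_def k_clustering_def P(3))
  ultimately show "gfds_feasible 2 G (set cs) \<phi>" by (simp add: gfds_feasible_def)
qed

text \<open>Turns the program into a function on typed inputs. On inputs without a run of the right
  form the value is arbitrary.\<close>

definition program_output :: "prog \<Rightarrow> ds_input \<Rightarrow> nat list \<times> nat list" where
  "program_output A x = (SOME y. \<exists>t s. exec A (init_state (enc x)) t s \<and> s 0 = enc y)"

text \<open>The projections pick the distances, the colors and the two lists of fairness bounds.
  From the given program only the centers are taken; its assignment serves the analysis.\<close>

definition fair_clustering :: "prog \<Rightarrow> gfds_input \<Rightarrow> nat list \<times> nat list" where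
  "fair_clustering A x =
    (fst (program_output A (fst x)),
     best_solution (fst (snd (fst x)), fst (snd (snd (snd (snd (fst x))))), fst (snd x), fst (snd (snd x)),
       fst (program_output A (fst x))))"

theorem theorem3:
  fixes \<alpha> :: real and A :: prog
  assumes "ds_approx_algorithm \<alpha> A"
  shows "\<exists>B. gfds_approx_algorithm (\<alpha> + 1) 2 B"
proof -
  obtain q where q: "\<And>J. ds_valid J \<Longrightarrow> \<exists>t s. exec A (init_state (enc_ds J)) t s \<and> t \<le> poly q (vsize (enc_ds J)) \<and>
      (\<exists>C \<phi>. encodes_clustering J (s 0) C \<phi> \<and> ds_feasible J C \<phi> \<and>
        kcenter_cost (points J) (metric J) \<phi> \<le> \<alpha> * opt_cost (points J) (metric J) (ds_feasible J))"
    using assms unfolding ds_approx_algorithm_def solves_in_poly_time_def by blast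
  have A_out: "\<exists>t s \<psi>. exec A (init_state (enc (ds_input G))) t s \<and> t \<le> poly q (sz (ds_input G)) \<and>
      s 0 = enc (program_output A (ds_input G)) \<and> distinct (fst (program_output A (ds_input G))) \<and>
      ds_feasible G (set (fst (program_output A (ds_input G)))) \<psi> \<and>
      kcenter_cost (points G) (metric G) \<psi> \<le> \<alpha> * opt_cost (points G) (metric G) (ds_feasible G)"
    if G: "gfds_valid G" for G
  proof -
    let ?J = "ds_instance.truncate G"
    have J: "enc_ds ?J = enc (ds_input G)" "points ?J = points G" "metric ?J = metric G" "ds_feasible ?J = ds_feasible G"
      unfolding enc_ds_input ds_feasible_truncate
      by (simp_all add: enc_ds_def points_def metric_def[abs_def] ds_instance.truncate_def)
    obtain t s C \<psi> where s: "exec A (init_state (enc (ds_input G))) t s" "t \<le> poly q (sz (ds_input G))"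
        "encodes_clustering ?J (s 0) C \<psi>" "ds_feasible G C \<psi>"
        "kcenter_cost (points G) (metric G) \<psi> \<le> \<alpha> * opt_cost (points G) (metric G) (ds_feasible G)"
      using q[OF ds_valid_truncate[OF G]] unfolding J by blast
    obtain cs where cs: "distinct cs" "set cs = C" "s 0 = enc (cs, map \<psi> [0..<npoints ?J])"
      using s(3) unfolding encodes_clustering_def by (auto simp: enc_list_eq enc_nat_eq comp_def)
    have "\<exists>t s'. exec A (init_state (enc (ds_input G))) t s' \<and> s' 0 = enc (program_output A (ds_input G))"
      unfolding program_output_def by (rule someI) (use s(1) cs(3) in blast)
    \<comment> \<open>The choice operator promises only some run with this output; determinism
      identifies it with the run whose properties are known.\<close>
    then have s0: "s 0 = enc (program_output A (ds_input G))"
      using exec_deterministic[OF s(1)] by blast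
    then have "enc (fst (program_output A (ds_input G))) = enc cs"
      using cs(3) by (simp add: enc_prod_eq)
    then have "fst (program_output A (ds_input G)) = cs" by (rule enc_nat_list_inject)
    then show ?thesis using s s0 cs by blast
  qed
  define D where "D = gfds_input ` Collect gfds_valid"
  define E where "E = ds_input ` Collect gfds_valid"
  have "ptime_on E (program_output A)"
  proof (rule ptime_on_exec)
    show "poly_bounded E (\<lambda>x. poly q (sz x))" unfolding poly_bounded_def by blast
    fix x assume "x \<in> E"
    then obtain G where "x = ds_input G" "gfds_valid G" unfolding E_def by blast
    then show "\<exists>t s. exec A (init_state (enc x)) t s \<and> t \<le> poly q (sz x) \<and> s 0 = enc (program_output A x)"
      using A_out by blast
  qed
  then have A: "ptime_on D (\<lambda>x. program_output A (fst x))"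
    by (rule ptime_on_comp) (auto simp: D_def E_def gfds_input_def intro!: ptime_intros)
  have "ptime_on D (fair_clustering A)"
    unfolding fair_clustering_def by (intro ptime_intros A)
  then obtain B T where B: "poly_bounded D T"
    "\<And>x. x \<in> D \<Longrightarrow> \<exists>t\<le>T x. exec B (init_state (enc x)) t (init_state (enc (fair_clustering A x)))"
    by (rule ptime_onE) (rule that)
  obtain p where p: "\<And>x. x \<in> D \<Longrightarrow> T x \<le> poly p (sz x)"
    using B(1) unfolding poly_bounded_def by blast
  have "gfds_approx_algorithm (\<alpha> + 1) 2 B"
    unfolding gfds_approx_algorithm_def solves_in_poly_time_def
  proof (intro exI[of _ p] allI impI)
    fix G :: gfds_instance assume G: "gfds_valid G"
    let ?x = "gfds_input G"
    define cs where "cs = fst (program_output A (ds_input G))"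
    let ?\<phi> = "lookup 0 (best_solution (assignment_input G cs))"
    have out: "fair_clustering A ?x = (cs, best_solution (assignment_input G cs))"
      by (simp add: fair_clustering_def cs_def gfds_input_def ds_input_def assignment_input_def)
    obtain \<psi> where \<psi>: "distinct cs" "ds_feasible G (set cs) \<psi>"
      "kcenter_cost (points G) (metric G) \<psi> \<le> \<alpha> * opt_cost (points G) (metric G) (ds_feasible G)"
      using A_out[OF G] unfolding cs_def by blast
    note correct = assignment_correct[OF G ds_approx_algorithm_nonneg[OF assms] \<psi>(2,3)]
    have x: "?x \<in> D" using G by (simp add: D_def)
    obtain t where t: "t \<le> T ?x" "exec B (init_state (enc_gfds G)) t (init_state (enc (fair_clustering A ?x)))"
      using B(2)[OF x] unfolding enc_gfds_input by blast
    \<comment> \<open>The output has to list the values of a function on the points; reading the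
      list by \<open>lookup\<close> recovers it, as its length is the number of points.\<close>
    have "best_solution (assignment_input G cs) = map ?\<phi> [0..<npoints G]"
      by (rule nth_equalityI) (simp_all add: correct(3) lookup_def)
    then have "enc (fair_clustering A ?x) = enc (cs, map ?\<phi> [0..<npoints G])"
      unfolding out by simp
    also have "\<dots> = Pair (val_of_list (map val_of_nat cs)) (val_of_list (map (\<lambda>p. val_of_nat (?\<phi> p)) [0..<npoints G]))"
      by (simp add: enc_list_eq enc_nat_eq comp_def)
    finally have "encodes_clustering G (init_state (enc (fair_clustering A ?x)) 0) (set cs) ?\<phi>"
      unfolding encodes_clustering_def using \<psi>(1) by (auto simp: init_state_def)
    moreover have "t \<le> poly p (vsize (enc_gfds G))"
      using t(1) p[OF x] unfolding enc_gfds_input by (rule order_trans)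
    ultimately show "\<exists>t s. exec B (init_state (enc_gfds G)) t s \<and> t \<le> poly p (vsize (enc_gfds G)) \<and>
        (\<exists>C \<phi>. encodes_clustering G (s 0) C \<phi> \<and> gfds_feasible 2 G C \<phi> \<and>
          kcenter_cost (points G) (metric G) \<phi> \<le> (\<alpha> + 1) * opt_cost (points G) (metric G) (gfds_feasible 0 G))"
      using t(2) correct(1,2) by blast
  qed
  then show ?thesis by blast
qed

end
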